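(* If $Z=(X,Y)\in\Omega_{ss}$, then $Z$ is locally $\Sigma$-equivalent near the origin to $Z_{ss}=(X_{ss},Y_{ss})\in\Omega_{ss}$, where $$X_{ss}(x,y)=(y,\ x),\qquad Y_{ss}(x,y)=(y,\ x).$$
   Context: Let $\mathcal U\subset\mathbb R^2$ be a bounded open set containing the origin $O$, and let $\mathfrak X$ be the set of $\mathcal C^1$ vector fields on $\mathcal U$. Put $\Sigma^+=\{(x,y)\in\mathcal U:y>0\}$, $\Sigma^-=\{(x,y)\in\mathcal U:y<0\}$, $\Sigma=\{(x,y)\in\mathcal U:y=0\}$ (the switching line). $\Omega$ is the set of piecewise smooth vector fields $Z=(X,Y)$, with $X=(X_1,X_2)$, $Y=(Y_1,Y_2)\in\mathfrak X$, given by $Z=X$ on $\Sigma^+$ and $Z=Y$ on $\Sigma^-$. On $\Sigma$, $Z$ is defined to be $Z_\Sigma$ by the Filippov convention. If $X\equiv Y$ on $\Sigma$, then $Z_\Sigma=X=Y$. Otherwise: on the crossing set $\Sigma^c=\{p\in\Sigma:X_2(p)Y_2(p)>0\}$, $Z_\Sigma=X$ if $X_2>0$ and $Z_\Sigma=Y$ if $X_2<0$ (orbits cross $\Sigma$ there); on the sliding set $\Sigma^s=\{p\in\Sigma:X_2(p)Y_2(p)\le0\}$, $Z_\Sigma=\left(\frac{Y_2X_1-X_2Y_1}{Y_2-X_2},0\right)$ if $X_2\ne Y_2$, and $Z_\Sigma=(0,0)$ if $X_2=Y_2=0$. Orbits of $Z$ are obtained by concatenating orbits of $X$ in $\Sigma^+$,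 $Y$ in $\Sigma^-$ and $Z_\Sigma$ in $\Sigma$. $\Omega_0\subset\Omega$ is the set of $Z=(X,Y)$ with $X(0,0)=Y(0,0)=(0,0)$, $\det A^+\det A^-\neq0$ and $X_{2x}(0,0)\,Y_{2x}(0,0)>0$, where $A^+$ (resp. $A^-$) is the Jacobian matrix of $X$ (resp. $Y$) at $O$ and the subscript $x$ denotes the partial derivative in $x$. Let $\lambda_1^\pm,\lambda_2^\pm$ be the eigenvalues of $A^\pm$. Then $\Omega_1=\{Z\in\Omega_0:\lambda_1^+\ne\lambda_2^+,\ \lambda_1^-\ne\lambda_2^-,\ \ell\ne0\}$, where $\ell=\frac{\mathrm{Re}\lambda_1^+}{|\mathrm{Im}\lambda_1^+|}+\frac{\mathrm{Re}\lambda_1^-}{|\mathrm{Im}\lambda_1^-|}$ if $\mathrm{Im}\lambda_1^+\,\mathrm{Im}\lambda_1^-\ne0$, and $\ell=1$ if $\mathrm{Im}\lambda_1^+\,\mathrm{Im}\lambda_1^-=0$. Further, $\Omega_{ss}=\{Z\in\Omega_1:\lambda_1^\pm,\lambda_2^\pm\in\mathbb R,\ \lambda_1^+\lambda_2^+<0,\ \lambda_1^-\lambda_2^-<0\}$. $Z_1,Z_2\in\Omega_0$ are locally $\Sigma$-equivalent near the origin if there exist neighborhoods $U,V$ of the origin and a homeomorphism $H:U\to V$ that maps the orbits of $Z_1$ in $U$ onto the orbits of $Z_2$ in $V$, preserving the direction of time, and sends $\Sigma\cap U$ to $\Sigma\cap V$. *)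

theory Defs
  imports "HOL-Analysis.Analysis"
begin

text \<open>
  Points of the plane are vectors \<open>p :: real^2\<close>, with \<open>x = p $ 1\<close> and \<open>y = p $ 2\<close>.
  The ambient domain is always the parameter \<open>\<U>\<close>; a vector field is a total function of which
  only the values on \<open>\<U>\<close> matter.
\<close>

type_synonym vfield = "real^2 \<Rightarrow> real^2"

definition C1_field :: "(real^2) set \<Rightarrow> vfield \<Rightarrow> bool" where
  "C1_field \<U> X \<longleftrightarrow>
     (\<exists>X' :: real^2 \<Rightarrow> ((real^2) \<Rightarrow>\<^sub>L (real^2)).
        (\<forall>p\<in>\<U>. (X has_derivative blinfun_apply (X' p)) (at p)) \<and> continuous_on \<U> X')"

definition Sigma_plus :: "(real^2) set \<Rightarrow> (real^2) set" where
  "Sigma_plus \<U> = {p \<in> \<U>. p $ 2 > 0}"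

definition Sigma_minus :: "(real^2) set \<Rightarrow> (real^2) set" where
  "Sigma_minus \<U> = {p \<in> \<U>. p $ 2 < 0}"

definition Sigma_line :: "(real^2) set \<Rightarrow> (real^2) set" where
  "Sigma_line \<U> = {p \<in> \<U>. p $ 2 = 0}"

definition Omega :: "(real^2) set \<Rightarrow> (vfield \<times> vfield) set" where
  "Omega \<U> = {(X, Y). C1_field \<U> X \<and> C1_field \<U> Y}"



definition crossing_set :: "(real^2) set \<Rightarrow> vfield \<times> vfield \<Rightarrow> (real^2) set" where
  "crossing_set \<U> = (\<lambda>(X, Y). {p \<in> Sigma_line \<U>. X p $ 2 * Y p $ 2 > 0})"

definition sliding_set :: "(real^2) set \<Rightarrow> vfield \<times> vfield \<Rightarrow> (real^2) set" where
  "sliding_set \<U> = (\<lambda>(X, Y). {p \<in> Sigma_line \<U>. X p $ 2 * Y p $ 2 \<le> 0})"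

text \<open>Meaningful for \<open>p \<in> Sigma_line \<U>\<close> only.\<close>

definition Z_Sigma :: "(real^2) set \<Rightarrow> vfield \<times> vfield \<Rightarrow> vfield" where
  "Z_Sigma \<U> = (\<lambda>(X, Y) p.
     if \<forall>q\<in>Sigma_line \<U>. X q = Y q then X p
     else if p \<in> crossing_set \<U> (X, Y) then (if X p $ 2 > 0 then X p else Y p)
     else if X p $ 2 \<noteq> Y p $ 2 then
       vector [(Y p $ 2 * X p $ 1 - X p $ 2 * Y p $ 1) / (Y p $ 2 - X p $ 2), 0]
     else 0)"

lemma not_crossing_iff_sliding:
  "p \<in> Sigma_line \<U> \<Longrightarrow> p \<notin> crossing_set \<U> Z \<longleftrightarrow> p \<in> sliding_set \<U> Z"
  by (cases Z) (auto simp: crossing_set_def sliding_set_def)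


definition follows :: "vfield \<Rightarrow> (real^2) set \<Rightarrow> real set \<Rightarrow> (real \<Rightarrow> real^2) \<Rightarrow> bool" where
  "follows F S J \<gamma> \<longleftrightarrow>
     (\<forall>t\<in>J. \<gamma> t \<in> S \<and> (\<gamma> has_vector_derivative F (\<gamma> t)) (at t))"

text \<open>
  A trajectory inside \<open>W \<subseteq> \<U>\<close> is a continuous concatenation of arcs of \<open>X\<close> in the upper half,
  of \<open>Y\<close> in the lower half and of \<open>Z_Sigma\<close> in the switching line. The set \<open>D\<close> collects the
  switching times; it meets every compact subinterval of \<open>I\<close> in a finite set.
\<close>

definition trajectory ::
  "(real^2) set \<Rightarrow> vfield \<times> vfield \<Rightarrow> (real^2) set \<Rightarrow> real set \<Rightarrow> (real \<Rightarrow> real^2) \<Rightarrow> bool" where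
  "trajectory \<U> Z W I \<gamma> \<longleftrightarrow>
     is_interval I \<and> I \<noteq> {} \<and> continuous_on I \<gamma> \<and> \<gamma> ` I \<subseteq> W \<and>
     (\<exists>D. (\<forall>a\<in>I. \<forall>b\<in>I. finite (D \<inter> {a..b})) \<and>
          (\<forall>a\<in>I. \<forall>b\<in>I. a < b \<longrightarrow> {a<..<b} \<inter> D = {} \<longrightarrow>
             follows (fst Z) (Sigma_plus \<U>) {a<..<b} \<gamma> \<or>
             follows (snd Z) (Sigma_minus \<U>) {a<..<b} \<gamma> \<or>
             follows (Z_Sigma \<U> Z) (Sigma_line \<U>) {a<..<b} \<gamma>))"

text \<open>
  An orbit of \<open>Z\<close> in \<open>W\<close> is represented by a trajectory in \<open>W\<close> that cannot be extended within \<open>W\<close>.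
  Trajectories through a point need not be unique (sliding), so the extension must agree with the
  given one.
\<close>

definition orbit ::
  "(real^2) set \<Rightarrow> vfield \<times> vfield \<Rightarrow> (real^2) set \<Rightarrow> real set \<Rightarrow> (real \<Rightarrow> real^2) \<Rightarrow> bool" where
  "orbit \<U> Z W I \<gamma> \<longleftrightarrow>
     trajectory \<U> Z W I \<gamma> \<and>
     (\<forall>J \<delta>. trajectory \<U> Z W J \<delta> \<and> I \<subseteq> J \<and> (\<forall>t\<in>I. \<delta> t = \<gamma> t) \<longrightarrow> J = I)"

text \<open>Two parametrised curves describe the same oriented curve if they differ by an increasing
  change of parameter (automatically a homeomorphism of the intervals).\<close>

definition same_oriented_curve ::
  "real set \<Rightarrow> (real \<Rightarrow> real^2) \<Rightarrow> real set \<Rightarrow> (real \<Rightarrow> real^2) \<Rightarrow> bool" where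
  "same_oriented_curve I \<gamma> J \<delta> \<longleftrightarrow>
     (\<exists>\<tau>. strict_mono_on I \<tau> \<and> \<tau> ` I = J \<and> (\<forall>t\<in>I. \<gamma> t = \<delta> (\<tau> t)))"

definition locally_Sigma_equivalent ::
  "(real^2) set \<Rightarrow> vfield \<times> vfield \<Rightarrow> vfield \<times> vfield \<Rightarrow> bool" where
  "locally_Sigma_equivalent \<U> Z1 Z2 \<longleftrightarrow>
     (\<exists>U V H H'. open U \<and> 0 \<in> U \<and> U \<subseteq> \<U> \<and> open V \<and> 0 \<in> V \<and> V \<subseteq> \<U> \<and>
        homeomorphism U V H H' \<and>
        (\<forall>I \<gamma>. orbit \<U> Z1 U I \<gamma> \<longrightarrow>
           (\<exists>J \<delta>. orbit \<U> Z2 V J \<delta> \<and> same_oriented_curve I (H \<circ> \<gamma>) J \<delta>)) \<and>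
        (\<forall>J \<delta>. orbit \<U> Z2 V J \<delta> \<longrightarrow>
           (\<exists>I \<gamma>. orbit \<U> Z1 U I \<gamma> \<and> same_oriented_curve I (H \<circ> \<gamma>) J \<delta>)) \<and>
        H ` (Sigma_line \<U> \<inter> U) = Sigma_line \<U> \<inter> V)"



abbreviation jac0 :: "vfield \<Rightarrow> real^2^2" where
  "jac0 X \<equiv> jacobian X (at 0)"

text \<open>The entry \<open>jac0 X $ 2 $ 1\<close> is the partial derivative in \<open>x\<close> of the second component.\<close>

definition Omega0 :: "(real^2) set \<Rightarrow> (vfield \<times> vfield) set" where
  "Omega0 \<U> = {(X, Y) \<in> Omega \<U>. X 0 = 0 \<and> Y 0 = 0 \<and>
      det (jac0 X) * det (jac0 Y) \<noteq> 0 \<and> jac0 X $ 2 $ 1 * jac0 Y $ 2 $ 1 > 0}"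

text \<open>\<open>\<mu>1, \<mu>2\<close> are the complex eigenvalues of \<open>A\<close>, listed with multiplicity: the roots of the
  characteristic polynomial.\<close>

definition eigenvalues :: "real^2^2 \<Rightarrow> complex \<Rightarrow> complex \<Rightarrow> bool" where
  "eigenvalues A \<mu>1 \<mu>2 \<longleftrightarrow>
     (\<forall>z. det (mat z - map_matrix complex_of_real A) = (z - \<mu>1) * (z - \<mu>2))"

text \<open>The value does not depend on which eigenvalue of each matrix is chosen, because nonreal
  eigenvalues come in conjugate pairs.\<close>

definition ell :: "complex \<Rightarrow> complex \<Rightarrow> real" where
  "ell \<mu>p \<mu>m =
     (if Im \<mu>p * Im \<mu>m \<noteq> 0 then Re \<mu>p / \<bar>Im \<mu>p\<bar> + Re \<mu>m / \<bar>Im \<mu>m\<bar> else 1)"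

definition Omega1 :: "(real^2) set \<Rightarrow> (vfield \<times> vfield) set" where
  "Omega1 \<U> = {(X, Y) \<in> Omega0 \<U>. \<exists>\<mu>1p \<mu>2p \<mu>1m \<mu>2m.
      eigenvalues (jac0 X) \<mu>1p \<mu>2p \<and> eigenvalues (jac0 Y) \<mu>1m \<mu>2m \<and>
      \<mu>1p \<noteq> \<mu>2p \<and> \<mu>1m \<noteq> \<mu>2m \<and> ell \<mu>1p \<mu>1m \<noteq> 0}"

definition Omega_ss :: "(real^2) set \<Rightarrow> (vfield \<times> vfield) set" where
  "Omega_ss \<U> = {(X, Y) \<in> Omega1 \<U>. \<exists>\<mu>1p \<mu>2p \<mu>1m \<mu>2m :: real.
      eigenvalues (jac0 X) (complex_of_real \<mu>1p) (complex_of_real \<mu>2p) \<and>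
      eigenvalues (jac0 Y) (complex_of_real \<mu>1m) (complex_of_real \<mu>2m) \<and>
      \<mu>1p * \<mu>2p < 0 \<and> \<mu>1m * \<mu>2m < 0}"

definition X_ss :: vfield where
  "X_ss p = vector [p $ 2, p $ 1]"

definition Y_ss :: vfield where
  "Y_ss p = vector [p $ 2, p $ 1]"

end

theory Submission
  imports Defs
begin

text \<open>
  After a linear change of coordinates in each half-plane that preserves the switching line, the
  linear part of the field is \<open>(x, y) \<mapsto> (m x + n y, n x + m y)\<close> with \<open>\<bar>m\<bar> < n\<close>, so that the eigenvectors
  are the diagonals. In a quadrant, with \<open>P = x + y\<close> and \<open>Q = x - y\<close>, the orbits are the graphs of the
  solutions of a scalar equation \<open>dQ/dP = G P Q\<close> on the cone \<open>\<bar>Q\<bar> \<le> P\<close>, where \<open>G\<close> is decreasing in \<open>Q\<close>.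
  Hence solutions contract: the separatrix is unique, and the solution through a boundary point
  \<open>Q = \<rho> = \<plusminus>P\<close> depends continuously on \<open>\<rho>\<close>. Replacing \<open>Q\<close> by the label \<open>\<rho>\<close> straightens the orbits and is
  the identity on the two axes, so the four quadrants, which are related by reflections and time
  reversal, fit together. This yields a homeomorphism from a fixed square onto a neighbourhood
  of the origin that carries orbits to piecewise linear curves not depending on the field.
  Composing the homeomorphisms obtained for the two systems gives the equivalence.
\<close>

section \<open>Calculus off a finite set, and the Picard-Lindelof theorem\<close>

text \<open>Straightening each half-plane on its own is not enough: the two maps have to agree on
  the switching line, and the two sectors of one half-plane have to agree on the axis between them.
  Boundary points therefore serve as labels, so that the map is prescribed on the axes and only the
  interior has to be solved for. The fields are merely C1, so linearisation is replaced by strict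
  differentiability at 0, whose control of increments makes \<open>G\<close> monotone in
  \<open>Q\<close>; the contraction that results carries estimates down to the vertex, where the
  Lipschitz constant \<open>C / P\<close> blows up. Trajectories obey the equations only off a
  locally finite set of times and might a priori stay on the line. Near 0 every other point of the
  line is a crossing point, which excludes this, and a Gronwall estimate keeps nonconstant
  trajectories away from 0. Speeds differ between two systems, so orbits are compared through
  \<open>sig\<close>, which depends only on the straightened picture.\<close>

lemma nonneg_deriv_off_finite:
  fixes f f' :: "real \<Rightarrow> real"
  assumes ab: "a \<le> b" and cont: "continuous_on {a..b} f" and fin: "finite D"
    and der: "\<And>t. t \<in> {a<..<b} - D \<Longrightarrow> (f has_vector_derivative f' t) (at t)"
    and nn: "\<And>t. t \<in> {a<..<b} - D \<Longrightarrow> 0 \<le> f' t"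
  shows "f a \<le> f b"
proof -
  \<comment> \<open>The value 0 at the exceptional points keeps the integrand nonnegative everywhere
    and leaves its integral unchanged.\<close>
  let ?g = "\<lambda>t. if t \<in> {a<..<b} - D then f' t else 0"
  have "(?g has_integral (f b - f a)) {a..b}"
    using der by (intro fundamental_theorem_of_calculus_interior_strong[OF fin ab _ cont]) simp
  from has_integral_nonneg[OF this] nn show ?thesis by auto
qed

text \<open>If the inequality failed, monotonicity would make \<open>f\<close> constant,
  contradicting the positive derivative at any of the infinitely many points off
  \<open>D\<close>.\<close>

lemma pos_deriv_off_finite:
  fixes f f' :: "real \<Rightarrow> real"
  assumes ab: "a < b" and cont: "continuous_on {a..b} f" and fin: "finite D"
    and der: "\<And>t. t \<in> {a<..<b} - D \<Longrightarrow> (f has_vector_derivative f' t) (at t)"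
    and pos: "\<And>t. t \<in> {a<..<b} - D \<Longrightarrow> 0 < f' t"
  shows "f a < f b"
proof -
  have mono: "f x \<le> f y" if "a \<le> x" "x \<le> y" "y \<le> b" for x y
  proof (rule nonneg_deriv_off_finite[OF \<open>x \<le> y\<close> _ fin, of f f'])
    show "continuous_on {x..y} f" using cont by (rule continuous_on_subset) (use that in auto)
  qed (use that der pos in \<open>auto intro!: less_imp_le\<close>)
  have "infinite ({a<..<b} - D)" using ab fin by (simp add: Diff_infinite_finite)
  then obtain t where t: "t \<in> {a<..<b} - D" using infinite_imp_nonempty by blast
  show ?thesis
  proof (rule ccontr)
    assume "\<not> f a < f b"
    then have const: "f x = f a" if "x \<in> {a<..<b}" for x
      using mono[of a x] mono[of x b] that by auto
    have "(f has_vector_derivative 0) (at t)"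
      by (rule has_vector_derivative_transform_within_open[of "\<lambda>_. f a" _ _ "{a<..<b}"])
        (use t const in auto)
    then show False
      using der[OF t] pos[OF t] vector_derivative_unique_at by fastforce
  qed
qed

lemma zero_deriv_off_finite:
  fixes f :: "real \<Rightarrow> real"
  assumes ab: "a \<le> b" and cont: "continuous_on {a..b} f" and fin: "finite D"
    and der: "\<And>t. t \<in> {a<..<b} - D \<Longrightarrow> (f has_vector_derivative 0) (at t)"
  shows "f a = f b"
proof -
  have "f a \<le> f b"
    by (rule nonneg_deriv_off_finite[OF ab cont fin der]) auto
  moreover have "- f a \<le> - f b"
    by (rule nonneg_deriv_off_finite[OF ab _ fin, of _ "\<lambda>_. 0"])
      (use cont der in \<open>auto intro!: continuous_intros derivative_eq_intros\<close>)
  ultimately show ?thesis by simp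
qed

lemma gronwall_zero_forward:
  fixes f :: "real \<Rightarrow> 'a::real_inner"
  assumes ab: "a \<le> b" and cont: "continuous_on {a..b} f" and fin: "finite D"
    and der: "\<And>t. t \<in> {a<..<b} - D \<Longrightarrow> (f has_vector_derivative f' t) (at t)"
    and le: "\<And>t. t \<in> {a<..<b} - D \<Longrightarrow> norm (f' t) \<le> C * norm (f t)"
    and zero: "f a = 0"
  shows "f b = 0"
proof -
  \<comment> \<open>By Cauchy-Schwarz the squared norm of \<open>f\<close> times
    \<open>exp (- 2 * C * t)\<close> is nonincreasing; the minus sign brings this into the form of
    \<open>nonneg_deriv_off_finite\<close>.\<close>
  let ?N = "\<lambda>t. - ((f t \<bullet> f t) * exp (- 2 * C * t))"
  have "?N a \<le> ?N b"
  proof (rule nonneg_deriv_off_finite[OF ab _ fin])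
    show "continuous_on {a..b} ?N" by (intro continuous_intros cont)
    fix t assume t: "t \<in> {a<..<b} - D"
    let ?D = "(2 * C * (f t \<bullet> f t) - 2 * (f t \<bullet> f' t)) * exp (- 2 * C * t)"
    show "(?N has_vector_derivative ?D) (at t)"
      unfolding has_vector_derivative_def
      by (rule has_derivative_eq_rhs, (rule derivative_intros der[OF t, unfolded has_vector_derivative_def] | simp)+)
        (auto simp: algebra_simps inner_commute)
    have "f t \<bullet> f' t \<le> norm (f t) * norm (f' t)" by (rule norm_cauchy_schwarz)
    also have "\<dots> \<le> norm (f t) * (C * norm (f t))" by (intro mult_left_mono le t) auto
    also have "\<dots> = C * (f t \<bullet> f t)" by (simp add: dot_square_norm power2_eq_square)
    finally show "0 \<le> ?D" by (auto intro!: mult_nonneg_nonneg)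
  qed
  then have "(f b \<bullet> f b) * exp (- 2 * C * b) \<le> 0" using zero by simp
  then have "f b \<bullet> f b \<le> 0" by (simp add: mult_le_0_iff)
  then show ?thesis by (metis inner_eq_zero_iff inner_ge_zero order_antisym)
qed

lemma gronwall_zero:
  fixes f :: "real \<Rightarrow> 'a::real_inner"
  assumes cont: "continuous_on {a..b} f" and fin: "finite D"
    and der: "\<And>t. t \<in> {a<..<b} - D \<Longrightarrow> (f has_vector_derivative f' t) (at t)"
    and le: "\<And>t. t \<in> {a<..<b} - D \<Longrightarrow> norm (f' t) \<le> C * norm (f t)"
    and t0: "t0 \<in> {a..b}" and zero: "f t0 = 0" and t: "t \<in> {a..b}"
  shows "f t = 0"
proof (cases "t0 \<le> t")
  case True
  show ?thesis
    by (rule gronwall_zero_forward[OF True _ fin, of f f' C])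
      (use t0 t zero in \<open>auto intro!: der le continuous_on_subset[OF cont]\<close>)
next
  case False
  \<comment> \<open>Backwards in time the forward estimate is applied to the reflected
    curve.\<close>
  let ?f = "\<lambda>s. f (- s)"
  have "?f (- t) = 0"
  proof (rule gronwall_zero_forward[where f = ?f and a = "- t0" and b = "- t" and D = "uminus ` D" and f' = "\<lambda>s. - f' (- s)" and C = C])
    show "continuous_on {- t0..- t} ?f"
      by (rule continuous_on_compose2[OF cont]) (use t0 t in \<open>auto intro!: continuous_intros\<close>)
    fix s assume "s \<in> {- t0<..<- t} - uminus ` D"
    then have s: "- s \<in> {a<..<b} - D" using t0 t by (auto simp: image_iff)
    show "(?f has_vector_derivative - f' (- s)) (at s)"
    proof -
      have "(uminus has_vector_derivative - 1) (at s)" by (auto intro!: derivative_eq_intros)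
      from vector_diff_chain_at[OF this der[OF s]] show ?thesis by (simp add: o_def)
    qed
    show "norm (- f' (- s)) \<le> C * norm (f (- s))" using le[OF s] by simp
  qed (use False fin zero in auto)
  then show ?thesis by simp
qed

text \<open>The fixed point is sought for the exponentially rescaled unknown, which makes the integral
  operator a contraction on the whole interval at once.\<close>

lemma picard_lindelof:
  fixes f :: "real \<Rightarrow> 'a::banach \<Rightarrow> 'a"
  assumes ab: "a \<le> b" and contf: "continuous_on ({a..b} \<times> UNIV) (\<lambda>(t, x). f t x)"
    and lip: "\<And>t x y. t \<in> {a..b} \<Longrightarrow> norm (f t x - f t y) \<le> K * norm (x - y)"
  obtains q where "q a = x0"
    "\<And>t. t \<in> {a..b} \<Longrightarrow> (q has_vector_derivative f t (q t)) (at t within {a..b})"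
proof -
  \<comment> \<open>The weight \<open>L / 2 * exp (L * s)\<close> integrates to half the increment
    of \<open>exp (L * s)\<close>; with \<open>K \<le> L / 2\<close> this gives the contraction
    factor 1/2. The maximum with 1 keeps \<open>L\<close> positive.\<close>
  define L where "L = 2 * max K 1"
  have L: "L > 0" "K \<le> L / 2" by (auto simp: L_def)
  \<comment> \<open>Clamping to \<open>{a..b}\<close> extends functions on the interval to bounded
    continuous functions on the line, the complete space in which the fixed point is sought.\<close>
  define c where "c t = max a (min b t)" for t
  have c: "c t \<in> {a..b}" for t using ab by (auto simp: c_def)
  have cid: "c t = t" if "t \<in> {a..b}" for t using that by (auto simp: c_def)
  have contc: "continuous_on UNIV c" unfolding c_def by (intro continuous_intros)
  define F where "F \<phi> s = f s (exp (L * s) *\<^sub>R apply_bcontfun \<phi> s)" for \<phi> s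
  have contF: "continuous_on {a..b} (F \<phi>)" for \<phi>
  proof -
    have "continuous_on {a..b} (\<lambda>s. exp (L * s) *\<^sub>R apply_bcontfun \<phi> s)"
      by (intro continuous_on_scaleR continuous_on_apply_bcontfun) (intro continuous_intros)
    then have "continuous_on {a..b} (\<lambda>s. (s, exp (L * s) *\<^sub>R apply_bcontfun \<phi> s))"
      by (intro continuous_on_Pair continuous_on_id)
    from continuous_on_compose2[OF contf this] show ?thesis
      by (auto simp: F_def)
  qed
  have intF: "F \<phi> integrable_on {a..t}" if "t \<in> {a..b}" for \<phi> t
    by (rule integrable_continuous_real, rule continuous_on_subset[OF contF]) (use that in auto)
  define h where "h \<phi> t = exp (- L * t) *\<^sub>R (x0 + integral {a..t} (F \<phi>))" for \<phi> t
  have conth: "continuous_on {a..b} (h \<phi>)" for \<phi>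
    unfolding h_def
    by (intro continuous_intros indefinite_integral_continuous_1 integrable_continuous_real contF)
  have bc: "(\<lambda>t. h \<phi> (c t)) \<in> bcontfun" for \<phi>
  proof -
    have "bounded (h \<phi> ` {a..b})"
      by (intro compact_imp_bounded compact_continuous_image conth) simp
    then have "bounded (range (\<lambda>t. h \<phi> (c t)))"
      by (rule bounded_subset) (use c in auto)
    moreover have "continuous_on UNIV (\<lambda>t. h \<phi> (c t))"
      by (rule continuous_on_compose2[OF conth contc]) (use c in auto)
    ultimately show ?thesis by (simp add: bcontfun_def)
  qed
  define T where "T \<phi> = Bcontfun (\<lambda>t. h \<phi> (c t))" for \<phi>
  have T: "apply_bcontfun (T \<phi>) t = h \<phi> (c t)" for \<phi> t
    by (simp add: T_def Bcontfun_inverse[OF bc])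
  have "dist (T \<phi>) (T \<psi>) \<le> 1/2 * dist \<phi> \<psi>" for \<phi> \<psi>
  proof (rule dist_bound)
    fix u
    let ?t = "c u" and ?d = "dist \<phi> \<psi>"
    have t: "?t \<in> {a..b}" by (rule c)
    have E: "((\<lambda>s. L / 2 * exp (L * s) * ?d) has_integral
        (exp (L * ?t) * ?d / 2 - exp (L * a) * ?d / 2)) {a..?t}"
      by (rule fundamental_theorem_of_calculus)
        (use t L in \<open>auto intro!: derivative_eq_intros simp: has_real_derivative_iff_has_vector_derivative[symmetric]\<close>)
    have "norm (F \<phi> s - F \<psi> s) \<le> L / 2 * exp (L * s) * ?d" if "s \<in> {a..?t}" for s
    proof -
      have s: "s \<in> {a..b}" using that t by auto
      have "norm (F \<phi> s - F \<psi> s) \<le> K * norm (exp (L * s) *\<^sub>R (apply_bcontfun \<phi> s - apply_bcontfun \<psi> s))"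
        using lip[OF s, of "exp (L * s) *\<^sub>R apply_bcontfun \<phi> s" "exp (L * s) *\<^sub>R apply_bcontfun \<psi> s"]
        by (simp add: F_def scaleR_diff_right)
      also have "\<dots> \<le> L / 2 * norm (exp (L * s) *\<^sub>R (apply_bcontfun \<phi> s - apply_bcontfun \<psi> s))"
        by (intro mult_right_mono L) auto
      also have "\<dots> = L / 2 * exp (L * s) * dist (apply_bcontfun \<phi> s) (apply_bcontfun \<psi> s)"
        by (simp add: dist_norm)
      also have "\<dots> \<le> L / 2 * exp (L * s) * ?d"
        using L by (intro mult_left_mono dist_bounded) auto
      finally show ?thesis .
    qed
    then have "norm (integral {a..?t} (\<lambda>s. F \<phi> s - F \<psi> s)) \<le> integral {a..?t} (\<lambda>s. L / 2 * exp (L * s) * ?d)"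
      using E by (intro integral_norm_bound_integral integrable_diff intF[OF t]) auto
    also have "\<dots> = exp (L * ?t) * ?d / 2 - exp (L * a) * ?d / 2"
      using E by (rule integral_unique)
    also have "\<dots> \<le> exp (L * ?t) * (?d / 2)" by simp
    finally have I: "norm (integral {a..?t} (F \<phi>) - integral {a..?t} (F \<psi>)) \<le> exp (L * ?t) * (?d / 2)"
      by (simp add: integral_diff[OF intF[OF t] intF[OF t]])
    have "dist (T \<phi> u) (T \<psi> u) = exp (- L * ?t) * norm (integral {a..?t} (F \<phi>) - integral {a..?t} (F \<psi>))"
      by (simp add: T h_def dist_norm flip: scaleR_diff_right)
    also have "\<dots> \<le> exp (- L * ?t) * (exp (L * ?t) * (?d / 2))"
      by (intro mult_left_mono I) simp
    also have "\<dots> = 1/2 * ?d" by (simp add: exp_minus)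
    finally show "dist (T \<phi> u) (T \<psi> u) \<le> 1/2 * ?d" .
  qed
  then have "\<exists>!\<phi>. T \<phi> = \<phi>" by (intro banach_fix_type[of "1/2"]) auto
  then obtain \<phi> where \<phi>: "T \<phi> = \<phi>" by blast
  define q where "q t = x0 + integral {a..t} (F \<phi>)" for t
  have q: "exp (L * t) *\<^sub>R apply_bcontfun \<phi> t = q t" if "t \<in> {a..b}" for t
    using T[of \<phi> t] by (simp add: \<phi> cid[OF that] h_def q_def exp_minus)
  show ?thesis
  proof
    show "q a = x0" by (simp add: q_def)
    fix t assume t: "t \<in> {a..b}"
    have "(q has_vector_derivative F \<phi> t) (at t within {a..b})"
      unfolding q_def
      by (auto intro!: derivative_eq_intros integral_has_vector_derivative[OF contF] t)
    then show "(q has_vector_derivative f t (q t)) (at t within {a..b})"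
      by (simp add: F_def q[OF t])
  qed
qed

section \<open>Scalar equations on a cone\<close>

lemma has_real_derivative_within_Icc_at:
  assumes "(f has_real_derivative l) (at t within {a..b})" "a < t" "t < b"
  shows "(f has_vector_derivative l) (at t)"
  using assms at_within_interior[of t "{a..b}"]
  by (simp add: has_real_derivative_iff_has_vector_derivative)

text \<open>A negative derivative wherever \<open>d \<ge> 0\<close> blocks upward passage through 0:
  after the last time with \<open>d \<le> 0\<close> the function would have to decrease. Even
  touching 0 after time \<open>a\<close> is impossible, since \<open>d\<close> would have been
  positive just before.\<close>

lemma barrier:
  fixes d :: "real \<Rightarrow> real"
  assumes init: "d a \<le> 0"
    and der: "\<And>t. t \<in> {a..b} \<Longrightarrow> (d has_real_derivative d' t) (at t within {a..b})"
    and neg: "\<And>t. t \<in> {a..b} \<Longrightarrow> 0 \<le> d t \<Longrightarrow> d' t < 0"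
    and t: "t \<in> {a<..b}"
  shows "d t < 0"
proof -
  have cont: "continuous_on {a..b} d"
    using der by (meson DERIV_continuous continuous_on_eq_continuous_within)
  have le: "d u \<le> 0" if u: "u \<in> {a..b}" for u
  proof -
    define S where "S = {a..u} \<inter> d -` {..0}"
    have "closed S" unfolding S_def
      by (rule continuous_closed_preimage[OF continuous_on_subset[OF cont]]) (use u in auto)
    moreover have "bounded S" unfolding S_def by (rule bounded_subset[of "{a..u}"]) auto
    ultimately have "compact S" using compact_eq_bounded_closed by blast
    moreover have "a \<in> S" using u init by (auto simp: S_def)
    ultimately obtain s where s: "s \<in> S" "\<And>t. t \<in> S \<Longrightarrow> t \<le> s"
      using compact_attains_sup[of S] by blast
    have "- d s \<le> - d u"
    proof (rule nonneg_deriv_off_finite[where f = "\<lambda>t. - d t" and D = "{}" and f' = "\<lambda>t. - d' t"])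
      show "continuous_on {s..u} (\<lambda>t. - d t)"
        by (intro continuous_intros continuous_on_subset[OF cont]) (use s u in \<open>auto simp: S_def\<close>)
      fix t assume t: "t \<in> {s<..<u} - {}"
      then have t': "a < t" "t < b" "t \<in> {a..b}" using s u by (auto simp: S_def)
      show "((\<lambda>t. - d t) has_vector_derivative - d' t) (at t)"
        by (intro derivative_intros has_real_derivative_within_Icc_at[OF der[OF t'(3)] t'(1,2)])
      have "t \<notin> S" using s(2)[of t] t by auto
      then have "d t \<ge> 0" using t t' by (auto simp: S_def)
      then show "0 \<le> - d' t" using neg[OF t'(3)] by auto
    qed (use s in \<open>auto simp: S_def\<close>)
    then show ?thesis using s by (auto simp: S_def)
  qed
  show ?thesis
  proof (rule ccontr)
    assume "\<not> d t < 0"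
    then have "d t = 0" using le[of t] t by auto
    then have "d' t < 0" using neg[of t] t by auto
    then obtain e where e: "e > 0" "\<And>h. 0 < h \<Longrightarrow> t - h \<in> {a..b} \<Longrightarrow> h < e \<Longrightarrow> d t < d (t - h)"
      using has_real_derivative_neg_dec_left[OF der[of t]] t by force
    define h where "h = min (e / 2) (t - a)"
    have "h > 0" "h < e" "t - h \<in> {a..b}" using e t by (auto simp: h_def)
    then show False using e(2)[of h] le[of "t - h"] \<open>d t = 0\<close> by auto
  qed
qed

text \<open>\<open>G\<close> is the slope of a nearly linear field, hence nearly homogeneous of
  degree 0; this is why \<open>bd\<close> is uniform while the constant in \<open>lip\<close>
  degenerates like \<open>1 / P\<close>, and why solutions are always started at some positive
  \<open>P\<close>. By \<open>upper\<close> and \<open>lower\<close> solutions enter the cone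
  through its sides as \<open>P\<close> grows, so that side points can label them.
  \<open>dec\<close> is the source of the contraction.\<close>

locale cone_ode =
  fixes G :: "real \<Rightarrow> real \<Rightarrow> real" and C R :: real
  assumes R: "R > 0" and C: "C > 0"
    and cont: "continuous_on {(P, Q). 0 < P \<and> P \<le> R \<and> \<bar>Q\<bar> \<le> P} (\<lambda>(P, Q). G P Q)"
    and dec: "\<lbrakk>0 < P; P \<le> R; \<bar>Q1\<bar> \<le> P; \<bar>Q2\<bar> \<le> P; Q1 \<le> Q2\<rbrakk> \<Longrightarrow> G P Q2 \<le> G P Q1"
    and lip: "\<lbrakk>0 < P; P \<le> R; \<bar>Q1\<bar> \<le> P; \<bar>Q2\<bar> \<le> P\<rbrakk> \<Longrightarrow> \<bar>G P Q1 - G P Q2\<bar> \<le> C / P * \<bar>Q1 - Q2\<bar>"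
    and bd: "\<lbrakk>0 < P; P \<le> R; \<bar>Q\<bar> \<le> P\<rbrakk> \<Longrightarrow> \<bar>G P Q\<bar> \<le> C"
    and upper: "\<lbrakk>0 < P; P \<le> R\<rbrakk> \<Longrightarrow> G P P < 1"
    and lower: "\<lbrakk>0 < P; P \<le> R\<rbrakk> \<Longrightarrow> - 1 < G P (- P)"
begin

definition sol :: "real \<Rightarrow> (real \<Rightarrow> real) \<Rightarrow> bool" where
  "sol P0 q \<longleftrightarrow> (\<forall>P\<in>{P0..R}. \<bar>q P\<bar> \<le> P \<and> (q has_real_derivative G P (q P)) (at P within {P0..R}))"

lemma sol_mono:
  assumes "sol P0 q" "P0 \<le> P1" shows "sol P1 q"
  using assms unfolding sol_def
  by (auto intro!: DERIV_subset[of q _ _ "{P0..R}" "{P1..R}"])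

lemma sol_cont: "sol P0 q \<Longrightarrow> continuous_on {P0..R} q"
  unfolding sol_def by (meson DERIV_continuous continuous_on_eq_continuous_within)

lemma sol_at:
  "sol P0 q \<Longrightarrow> P0 < P \<Longrightarrow> P < R \<Longrightarrow> (q has_vector_derivative G P (q P)) (at P)"
  unfolding sol_def by (intro has_real_derivative_within_Icc_at) auto

lemma sol_le: "sol P0 q \<Longrightarrow> P0 \<le> P \<Longrightarrow> P \<le> R \<Longrightarrow> \<bar>q P\<bar> \<le> P"
  unfolding sol_def by auto

lemma sol_lipschitz:
  assumes "sol P0 q" "0 < P0" "P \<in> {P0..R}" "P' \<in> {P0..R}"
  shows "\<bar>q P - q P'\<bar> \<le> C * \<bar>P - P'\<bar>"
proof -
  have "norm (q P - q P') \<le> C * norm (P - P')"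
    by (rule field_differentiable_bound[where S = "{P0..R}" and f' = "\<lambda>P. G P (q P)"])
      (use assms bd in \<open>auto simp: sol_def\<close>)
  then show ?thesis by simp
qed

lemma sol_eqI:
  assumes q: "sol P0 q1" "sol P0 q2" and P0: "0 < P0"
    and P: "P \<in> {P0..R}" "q1 P = q2 P" and P': "P' \<in> {P0..R}"
  shows "q1 P' = q2 P'"
proof -
  have "q1 P' - q2 P' = 0"
  proof (rule gronwall_zero[where f = "\<lambda>P. q1 P - q2 P" and f' = "\<lambda>P. G P (q1 P) - G P (q2 P)" and D = "{}"
        and C = "C / P0", OF _ _ _ _ P(1) _ P'])
    show "continuous_on {P0..R} (\<lambda>P. q1 P - q2 P)" by (intro continuous_intros sol_cont q)
    fix t assume "t \<in> {P0<..<R} - {}"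
    then have t: "P0 < t" "t < R" by auto
    show "((\<lambda>P. q1 P - q2 P) has_vector_derivative G t (q1 t) - G t (q2 t)) (at t)"
      by (intro derivative_intros sol_at[OF q(1)] sol_at[OF q(2)] t)
    have "\<bar>G t (q1 t) - G t (q2 t)\<bar> \<le> C / t * \<bar>q1 t - q2 t\<bar>"
      by (rule lip) (use t P0 sol_le[OF q(1)] sol_le[OF q(2)] in auto)
    also have "\<dots> \<le> C / P0 * \<bar>q1 t - q2 t\<bar>"
      using t P0 C by (intro mult_right_mono divide_left_mono) auto
    finally show "norm (G t (q1 t) - G t (q2 t)) \<le> C / P0 * norm (q1 t - q2 t)" by simp
  qed (use P in auto)
  then show ?thesis by simp
qed

text \<open>Since \<open>G\<close> is decreasing in \<open>Q\<close>, the gap between ordered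
  solutions never grows. No Lipschitz constant enters, so the bound stays uniform as
  \<open>P0\<close> tends to 0.\<close>

lemma sol_contract:
  assumes q: "sol P0 q1" "sol P0 q2" and P0: "0 < P0" "P0 \<le> P" "P \<le> R"
    and le: "\<And>t. P0 \<le> t \<Longrightarrow> t \<le> R \<Longrightarrow> q1 t \<le> q2 t"
  shows "q2 P - q1 P \<le> q2 P0 - q1 P0"
proof -
  have "q1 P0 - q2 P0 \<le> q1 P - q2 P"
  proof (rule nonneg_deriv_off_finite[where f = "\<lambda>P. q1 P - q2 P" and D = "{}" and f' = "\<lambda>P. G P (q1 P) - G P (q2 P)"])
    show "continuous_on {P0..P} (\<lambda>P. q1 P - q2 P)"
      by (intro continuous_intros continuous_on_subset[OF sol_cont[OF q(1)]] continuous_on_subset[OF sol_cont[OF q(2)]])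
        (use P0 in auto)
    fix t assume "t \<in> {P0<..<P} - {}"
    then have t: "P0 < t" "t < R" using P0 by auto
    show "((\<lambda>P. q1 P - q2 P) has_vector_derivative G t (q1 t) - G t (q2 t)) (at t)"
      by (intro derivative_intros sol_at[OF q(1)] sol_at[OF q(2)] t)
    show "0 \<le> G t (q1 t) - G t (q2 t)"
      using dec[of t "q1 t" "q2 t"] t P0 sol_le[OF q(1)] sol_le[OF q(2)] le[of t] by auto
  qed (use P0 in auto)
  then show ?thesis by simp
qed

lemma sol_less:
  assumes q: "sol P0 q1" "sol P0 q2" and P0: "0 < P0" "P0 \<le> P" "P \<le> R" and less: "q1 P0 < q2 P0"
  shows "q1 P < q2 P"
proof (rule ccontr)
  assume "\<not> q1 P < q2 P"
  moreover have "continuous_on {P0..P} (\<lambda>t. q2 t - q1 t)"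
    by (intro continuous_intros continuous_on_subset[OF sol_cont[OF q(1)]] continuous_on_subset[OF sol_cont[OF q(2)]])
        (use P0 in auto)
  ultimately obtain t where t: "P0 \<le> t" "t \<le> P" "q2 t - q1 t = 0"
    using IVT2'[of "\<lambda>t. q2 t - q1 t" P 0 P0] less P0 by auto
  then show False using sol_eqI[OF q P0(1), of t P0] P0 less by auto
qed

text \<open>Clamping \<open>Q\<close> to the cone makes the right-hand side globally Lipschitz for
  \<open>P \<ge> \<rho>\<close>. The strict slope conditions on the two sides then act as barriers,
  so that the solution stays where the clamp is the identity.\<close>

lemma ex_sol_pos:
  assumes \<rho>: "0 < \<rho>" "\<rho> \<le> R"
  shows "\<exists>q. sol \<rho> q \<and> q \<rho> = \<rho> \<and> (\<forall>P\<in>{\<rho><..R}. \<bar>q P\<bar> < P)"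
proof -
  define cl where "cl P Q = max (- P) (min P Q)" for P Q :: real
  have cl: "\<bar>cl P Q\<bar> \<le> P" if "0 < P" for P Q using that by (auto simp: cl_def)
  obtain q where q0: "q \<rho> = \<rho>" and
    q': "\<And>P. P \<in> {\<rho>..R} \<Longrightarrow> (q has_vector_derivative G P (cl P (q P))) (at P within {\<rho>..R})"
  proof (rule picard_lindelof[of \<rho> R "\<lambda>P Q. G P (cl P Q)" "C / \<rho>" \<rho>])
    have "continuous_on ({\<rho>..R} \<times> UNIV) (\<lambda>x. (fst x, cl (fst x) (snd x)))"
      unfolding cl_def by (intro continuous_intros)
    from continuous_on_compose2[OF cont this]
    show "continuous_on ({\<rho>..R} \<times> UNIV) (\<lambda>(P, Q). G P (cl P Q))"
      using \<rho> cl by (force simp: case_prod_beta)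
    fix P x y assume P: "P \<in> {\<rho>..R}"
    have "\<bar>G P (cl P x) - G P (cl P y)\<bar> \<le> C / P * \<bar>cl P x - cl P y\<bar>"
      by (rule lip) (use P \<rho> cl in auto)
    also have "\<dots> \<le> C / \<rho> * \<bar>x - y\<bar>"
      using P \<rho> C by (intro mult_mono divide_left_mono) (auto simp: cl_def)
    finally show "norm (G P (cl P x) - G P (cl P y)) \<le> C / \<rho> * norm (x - y)" by simp
  qed (use \<rho> in auto)
  note q'' = q'[folded has_real_derivative_iff_has_vector_derivative]
  have up: "q P - P < 0" if "P \<in> {\<rho><..R}" for P
  proof (rule barrier[OF _ _ _ that, where d = "\<lambda>P. q P - P" and d' = "\<lambda>P. G P (cl P (q P)) - 1"])
    show "((\<lambda>P. q P - P) has_real_derivative G t (cl t (q t)) - 1) (at t within {\<rho>..R})"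
      if "t \<in> {\<rho>..R}" for t
      by (intro derivative_intros q'' that)
    show "G t (cl t (q t)) - 1 < 0" if "t \<in> {\<rho>..R}" "0 \<le> q t - t" for t
    proof -
      have "cl t (q t) = t" using that \<rho> by (auto simp: cl_def)
      then show ?thesis using upper[of t] that \<rho> by auto
    qed
  qed (use q0 in auto)
  have low: "- q P - P < 0" if "P \<in> {\<rho><..R}" for P
  proof (rule barrier[OF _ _ _ that, where d = "\<lambda>P. - q P - P" and d' = "\<lambda>P. - G P (cl P (q P)) - 1"])
    show "((\<lambda>P. - q P - P) has_real_derivative - G t (cl t (q t)) - 1) (at t within {\<rho>..R})"
      if "t \<in> {\<rho>..R}" for t
      by (intro derivative_intros q'' that)
    show "- G t (cl t (q t)) - 1 < 0" if "t \<in> {\<rho>..R}" "0 \<le> - q t - t" for t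
    proof -
      have "cl t (q t) = - t" using that \<rho> by (auto simp: cl_def)
      then show ?thesis using lower[of t] that \<rho> by auto
    qed
  qed (use q0 \<rho> in auto)
  have lt: "\<bar>q P\<bar> < P" if "P \<in> {\<rho><..R}" for P using up[OF that] low[OF that] by auto
  have le: "\<bar>q P\<bar> \<le> P" if "P \<in> {\<rho>..R}" for P
    using lt[of P] that q0 \<rho> by (cases "P = \<rho>") auto
  then have "cl P (q P) = q P" if "P \<in> {\<rho>..R}" for P
    using le[OF that] by (auto simp: cl_def)
  then have "sol \<rho> q" using le q'' by (simp add: sol_def)
  then show ?thesis using q0 lt by blast
qed

text \<open>Reflection of \<open>Q\<close> exchanges \<open>upper\<close> and \<open>lower\<close>,
  so that solutions entering at negative \<open>Q\<close> are obtained from those entering at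
  positive \<open>Q\<close>.\<close>

lemma reflect: "cone_ode (\<lambda>P Q. - G P (- Q)) C R"
proof
  have "continuous_on {(P, Q). 0 < P \<and> P \<le> R \<and> \<bar>Q\<bar> \<le> P} (\<lambda>x. (fst x, - snd x))"
    by (intro continuous_intros)
  from continuous_on_compose2[OF cont this]
  have "continuous_on {(P, Q). 0 < P \<and> P \<le> R \<and> \<bar>Q\<bar> \<le> P} (\<lambda>x. G (fst x) (- snd x))"
    by (force simp: case_prod_beta)
  then show "continuous_on {(P, Q). 0 < P \<and> P \<le> R \<and> \<bar>Q\<bar> \<le> P} (\<lambda>(P, Q). - G P (- Q))"
    by (simp add: case_prod_beta continuous_on_minus)
  show "\<bar>- G P (- Q1) - - G P (- Q2)\<bar> \<le> C / P * \<bar>Q1 - Q2\<bar>"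
    if "0 < P" "P \<le> R" "\<bar>Q1\<bar> \<le> P" "\<bar>Q2\<bar> \<le> P" for P Q1 Q2
    using lip[of P "- Q2" "- Q1"] that by auto
  show "- G P (- Q2) \<le> - G P (- Q1)"
    if "0 < P" "P \<le> R" "\<bar>Q1\<bar> \<le> P" "\<bar>Q2\<bar> \<le> P" "Q1 \<le> Q2" for P Q1 Q2
    using dec[of P "- Q2" "- Q1"] that by auto
  show "\<bar>- G P (- Q)\<bar> \<le> C" if "0 < P" "P \<le> R" "\<bar>Q\<bar> \<le> P" for P Q
    using bd[of P "- Q"] that by auto
  show "- G P (- P) < 1" "- 1 < - G P (- (- P))" if "0 < P" "P \<le> R" for P
    using lower[of P] upper[of P] that by auto
qed (rule R C)+

lemma ex_sol:
  assumes \<rho>: "\<rho> \<noteq> 0" "\<bar>\<rho>\<bar> \<le> R"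
  shows "\<exists>q. sol \<bar>\<rho>\<bar> q \<and> q \<bar>\<rho>\<bar> = \<rho> \<and> (\<forall>P\<in>{\<bar>\<rho>\<bar><..R}. \<bar>q P\<bar> < P)"
proof (cases "\<rho> > 0")
  case True
  then show ?thesis using ex_sol_pos[of \<rho>] \<rho> by auto
next
  case False
  interpret r: cone_ode "\<lambda>P Q. - G P (- Q)" C R by (rule reflect)
  obtain q where q: "r.sol (- \<rho>) q" "q (- \<rho>) = - \<rho>" "\<forall>P\<in>{- \<rho><..R}. \<bar>q P\<bar> < P"
    using r.ex_sol_pos[of "- \<rho>"] \<rho> False by auto
  have "sol (- \<rho>) (\<lambda>P. - q P)"
    using q(1) unfolding sol_def r.sol_def by (auto intro!: derivative_eq_intros)
  then show ?thesis using q False by (intro exI[of _ "\<lambda>P. - q P"]) auto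
qed

section \<open>Solutions labelled by the side point where they enter the cone\<close>

definition psi :: "real \<Rightarrow> real \<Rightarrow> real" where
  "psi \<rho> = (SOME q. sol \<bar>\<rho>\<bar> q \<and> q \<bar>\<rho>\<bar> = \<rho> \<and> (\<forall>P\<in>{\<bar>\<rho>\<bar><..R}. \<bar>q P\<bar> < P))"

lemma psi:
  assumes "\<rho> \<noteq> 0" "\<bar>\<rho>\<bar> \<le> R"
  shows "sol \<bar>\<rho>\<bar> (psi \<rho>)" "psi \<rho> \<bar>\<rho>\<bar> = \<rho>" "\<And>P. \<bar>\<rho>\<bar> < P \<Longrightarrow> P \<le> R \<Longrightarrow> \<bar>psi \<rho> P\<bar> < P"
  using someI_ex[OF ex_sol[OF assms], folded psi_def] by auto

text \<open>Solutions keep their order, so it suffices to compare them at the later entry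
  \<open>P0\<close>. There the newcomer lies on a side of the cone and an earlier one strictly
  inside; the sign of the later label decides. Simultaneous entries lie on opposite sides.\<close>

lemma psi_less:
  assumes "\<rho>1 < \<rho>2" "\<rho>1 \<noteq> 0" "\<rho>2 \<noteq> 0" "\<bar>\<rho>1\<bar> \<le> P" "\<bar>\<rho>2\<bar> \<le> P" "P \<le> R"
  shows "psi \<rho>1 P < psi \<rho>2 P"
proof -
  define P0 where "P0 = max \<bar>\<rho>1\<bar> \<bar>\<rho>2\<bar>"
  have r: "\<bar>\<rho>1\<bar> \<le> R" "\<bar>\<rho>2\<bar> \<le> R" using assms by auto
  note p1 = psi[OF assms(2) r(1)] and p2 = psi[OF assms(3) r(2)]
  have less: "psi \<rho>1 P0 < psi \<rho>2 P0"
  proof (rule linorder_cases[of "\<bar>\<rho>1\<bar>" "\<bar>\<rho>2\<bar>"])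
    assume *: "\<bar>\<rho>1\<bar> < \<bar>\<rho>2\<bar>"
    then have "P0 = \<bar>\<rho>2\<bar>" "\<rho>2 > 0" using assms(1) by (auto simp: P0_def)
    then show ?thesis using p2(2) p1(3)[of P0] * r by auto
  next
    assume *: "\<bar>\<rho>1\<bar> = \<bar>\<rho>2\<bar>"
    then show ?thesis using p2(2) p1(2) assms(1) by (auto simp: P0_def)
  next
    assume *: "\<bar>\<rho>2\<bar> < \<bar>\<rho>1\<bar>"
    then have "P0 = \<bar>\<rho>1\<bar>" "\<rho>1 < 0" using assms(1) by (auto simp: P0_def)
    then show ?thesis using p1(2) p2(3)[of P0] * r by auto
  qed
  show ?thesis
    by (rule sol_less[OF sol_mono[OF p1(1)] sol_mono[OF p2(1)] _ _ _ less])
      (use assms in \<open>auto simp: P0_def\<close>)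
qed

text \<open>At the later entry the difference consists of the difference of the labels and of the
  displacement of the earlier solution since its own entry, which contribute the factors 1 and
  \<open>C\<close>; afterwards contraction preserves the bound. Labels of equal sign enter through
  the same side, so close labels have close entry points.\<close>

lemma psi_lipschitz_less:
  assumes "\<rho>1 < \<rho>2" "0 < \<rho>1 * \<rho>2" "\<bar>\<rho>1\<bar> \<le> P" "\<bar>\<rho>2\<bar> \<le> P" "P \<le> R"
  shows "psi \<rho>2 P - psi \<rho>1 P \<le> (1 + C) * (\<rho>2 - \<rho>1)"
proof -
  define P0 where "P0 = max \<bar>\<rho>1\<bar> \<bar>\<rho>2\<bar>"
  have nz: "\<rho>1 \<noteq> 0" "\<rho>2 \<noteq> 0" and r: "\<bar>\<rho>1\<bar> \<le> R" "\<bar>\<rho>2\<bar> \<le> R" using assms by auto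
  note p1 = psi[OF nz(1) r(1)] and p2 = psi[OF nz(2) r(2)]
  have P0: "0 < P0" "P0 \<le> P" "P0 \<le> R" using assms nz by (auto simp: P0_def)
  have "psi \<rho>2 P - psi \<rho>1 P \<le> psi \<rho>2 P0 - psi \<rho>1 P0"
    by (rule sol_contract[OF sol_mono[OF p1(1)] sol_mono[OF p2(1)]])
      (use assms nz P0 in \<open>auto simp: P0_def intro!: less_imp_le psi_less\<close>)
  also have "\<dots> \<le> (1 + C) * (\<rho>2 - \<rho>1)"
  proof (cases "\<rho>1 > 0")
    case True
    then have "P0 = \<rho>2" "0 < \<rho>2" using assms by (auto simp: P0_def)
    then show ?thesis
      using p1(2) p2(2) sol_lipschitz[OF p1(1), of \<rho>1 \<rho>2] True assms by (auto simp: algebra_simps)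
  next
    case False
    then have *: "\<rho>1 < 0" "\<rho>2 < 0" using assms nz by (auto simp: zero_less_mult_iff)
    then have "P0 = - \<rho>1" using assms by (auto simp: P0_def)
    then show ?thesis
      using p1(2) p2(2) sol_lipschitz[OF p2(1), of "- \<rho>1" "- \<rho>2"] * assms by (auto simp: algebra_simps)
  qed
  finally show ?thesis .
qed

lemma psi_lipschitz:
  assumes "0 < \<rho>1 * \<rho>2" "\<bar>\<rho>1\<bar> \<le> P" "\<bar>\<rho>2\<bar> \<le> P" "P \<le> R"
  shows "\<bar>psi \<rho>1 P - psi \<rho>2 P\<bar> \<le> (1 + C) * \<bar>\<rho>1 - \<rho>2\<bar>"
proof -
  have nz: "\<rho>1 \<noteq> 0" "\<rho>2 \<noteq> 0" using assms by auto
  consider "\<rho>1 < \<rho>2" | "\<rho>2 < \<rho>1" | "\<rho>1 = \<rho>2" by linarith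
  then show ?thesis
  proof cases
    case 1
    then show ?thesis
      using psi_lipschitz_less[of \<rho>1 \<rho>2 P] psi_less[of \<rho>1 \<rho>2 P] assms nz by simp
  next
    case 2
    have "0 < \<rho>2 * \<rho>1" using assms(1) by (simp add: mult.commute)
    with 2 show ?thesis
      using psi_lipschitz_less[of \<rho>2 \<rho>1 P] psi_less[of \<rho>2 \<rho>1 P] assms nz by simp
  qed simp
qed

text \<open>The Lipschitz bound in the label is uniform down to label 0, so the values are Cauchy as
  the label tends to 0 from the side \<open>e\<close>. The bound records the rate of
  convergence.\<close>

lemma psi_limit:
  assumes e: "e = 1 \<or> e = - 1" and P: "0 < P" "P \<le> R"
  shows "\<exists>l. \<forall>\<rho>. 0 < e * \<rho> \<and> e * \<rho> \<le> P \<longrightarrow> \<bar>psi \<rho> P - l\<bar> \<le> (1 + C) * \<bar>\<rho>\<bar>"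
proof -
  define S where "S = {\<rho>. 0 < e * \<rho> \<and> e * \<rho> \<le> P}"
  define X where "X n = e * (P / real (Suc n))" for n
  have ee: "e * e = 1" using e by auto
  have X0: "X \<longlonglongrightarrow> 0"
  proof -
    have "(\<lambda>n. (e * P) * inverse (real (Suc n))) \<longlonglongrightarrow> (e * P) * 0"
      by (intro tendsto_intros LIMSEQ_inverse_real_of_nat)
    then show ?thesis by (simp add: X_def[abs_def] field_simps)
  qed
  have XS: "X n \<in> S" for n
  proof -
    have "e * X n = P / real (Suc n)" using ee by (simp add: X_def mult.assoc[symmetric] del: of_nat_Suc)
    moreover have "P / real (Suc n) \<le> P" using P by (simp add: field_simps)
    ultimately show ?thesis using P by (simp add: S_def)
  qed
  have L: "\<bar>psi \<rho>1 P - psi \<rho>2 P\<bar> \<le> (1 + C) * \<bar>\<rho>1 - \<rho>2\<bar>" if "\<rho>1 \<in> S" "\<rho>2 \<in> S" for \<rho>1 \<rho>2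
    by (rule psi_lipschitz) (use that e P in \<open>auto simp: S_def mult_neg_neg\<close>)
  then have "(1 + C)-lipschitz_on S (\<lambda>\<rho>. psi \<rho> P)"
    using C by (auto simp: lipschitz_on_def dist_real_def)
  then have "Cauchy (\<lambda>n. psi (X n) P)"
    by (rule uniformly_continuous_on_Cauchy[OF lipschitz_on_uniformly_continuous LIMSEQ_imp_Cauchy[OF X0] XS])
  then obtain l where l: "(\<lambda>n. psi (X n) P) \<longlonglongrightarrow> l"
    using Cauchy_convergent_iff convergent_def by blast
  have "\<bar>psi \<rho> P - l\<bar> \<le> (1 + C) * \<bar>\<rho>\<bar>" if "\<rho> \<in> S" for \<rho>
  proof (rule LIMSEQ_le)
    show "(\<lambda>n. \<bar>psi \<rho> P - psi (X n) P\<bar>) \<longlonglongrightarrow> \<bar>psi \<rho> P - l\<bar>" by (intro tendsto_intros l)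
    have "(\<lambda>n. (1 + C) * \<bar>\<rho> - X n\<bar>) \<longlonglongrightarrow> (1 + C) * \<bar>\<rho> - 0\<bar>" by (intro tendsto_intros X0)
    then show "(\<lambda>n. (1 + C) * \<bar>\<rho> - X n\<bar>) \<longlonglongrightarrow> (1 + C) * \<bar>\<rho>\<bar>" by simp
    show "\<exists>N. \<forall>n\<ge>N. \<bar>psi \<rho> P - psi (X n) P\<bar> \<le> (1 + C) * \<bar>\<rho> - X n\<bar>" using L XS that by blast
  qed
  then show ?thesis by (auto simp: S_def)
qed

section \<open>The separatrix as the limit of solutions with label tending to 0\<close>

definition chi :: "real \<Rightarrow> real \<Rightarrow> real" where
  "chi e P = (SOME l. \<forall>\<rho>. 0 < e * \<rho> \<and> e * \<rho> \<le> P \<longrightarrow> \<bar>psi \<rho> P - l\<bar> \<le> (1 + C) * \<bar>\<rho>\<bar>)"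

lemma chi:
  assumes "e = 1 \<or> e = - 1" "0 < e * \<rho>" "e * \<rho> \<le> P" "P \<le> R"
  shows "\<bar>psi \<rho> P - chi e P\<bar> \<le> (1 + C) * \<bar>\<rho>\<bar>"
  using someI_ex[OF psi_limit[OF assms(1), of P], folded chi_def] assms by auto

text \<open>The labels depend on \<open>P0\<close> but not on \<open>P\<close>: one and the same
  sequence of solutions converges at every \<open>P \<ge> P0\<close>, as \<open>chi_sol\<close>
  requires.\<close>

lemma chi_tendsto:
  assumes e: "e = 1 \<or> e = - 1" and P: "0 < P0" "P0 \<le> P" "P \<le> R"
  shows "(\<lambda>n. psi (e * (P0 / real (Suc n))) P) \<longlonglongrightarrow> chi e P"
proof (rule LIM_zero_cancel, rule Lim_null_comparison)
  have ee: "e * e = 1" and ae: "\<bar>e\<bar> = 1" using e by auto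
  show "\<forall>\<^sub>F n in sequentially. norm (psi (e * (P0 / real (Suc n))) P - chi e P)
      \<le> ((1 + C) * P0) * inverse (real (Suc n))"
  proof (rule always_eventually, rule allI)
    fix n
    define r where "r = e * (P0 / real (Suc n))"
    have er: "e * r = P0 / real (Suc n)" "\<bar>r\<bar> = P0 / real (Suc n)"
      using ee ae P by (simp_all add: r_def mult.assoc[symmetric] abs_mult del: of_nat_Suc)
    have "P0 / real (Suc n) \<le> P0" "0 < P0 / real (Suc n)" using P by (simp_all add: field_simps)
    then have "\<bar>psi r P - chi e P\<bar> \<le> (1 + C) * \<bar>r\<bar>"
      using P er by (intro chi[OF e]) simp_all
    also have "\<dots> = ((1 + C) * P0) * inverse (real (Suc n))"
      unfolding er by (simp add: divide_inverse)
    finally show "norm (psi (e * (P0 / real (Suc n))) P - chi e P) \<le> ((1 + C) * P0) * inverse (real (Suc n))"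
      by (simp add: r_def)
  qed
  have "(\<lambda>n. ((1 + C) * P0) * inverse (real (Suc n))) \<longlonglongrightarrow> ((1 + C) * P0) * 0"
    by (intro tendsto_intros LIMSEQ_inverse_real_of_nat)
  then show "(\<lambda>n. ((1 + C) * P0) * inverse (real (Suc n))) \<longlonglongrightarrow> 0" by simp
qed

text \<open>The convergence is uniform on \<open>{P0..R}\<close>, and by \<open>lip\<close> so is
  that of the slopes; hence differentiation passes to the limit.\<close>

lemma chi_sol:
  assumes e: "e = 1 \<or> e = - 1" and P0: "0 < P0" "P0 \<le> R"
  shows "sol P0 (chi e)"
proof -
  define \<rho> where "\<rho> n = e * (P0 / real (Suc n))" for n
  define f where "f n = psi (\<rho> n)" for n
  have ee: "e * e = 1" and ae: "\<bar>e\<bar> = 1" using e by auto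
  have e\<rho>: "e * \<rho> n = P0 / real (Suc n)" "\<bar>\<rho> n\<bar> = P0 / real (Suc n)" for n
    using ee ae P0 by (simp_all add: \<rho>_def mult.assoc[symmetric] abs_mult del: of_nat_Suc)
  have le: "P0 / real (Suc n) \<le> P0" "0 < P0 / real (Suc n)" for n using P0 by (simp_all add: field_simps)
  have solf: "sol P0 (f n)" for n
  proof -
    have "\<rho> n \<noteq> 0" using e\<rho>(2)[of n] le(2)[of n] by auto
    then show ?thesis
      unfolding f_def by (rule sol_mono[OF psi(1)]) (use e\<rho>(2)[of n] le(1)[of n] P0 in auto)
  qed
  have lim: "(\<lambda>n. f n P) \<longlonglongrightarrow> chi e P" if "P \<in> {P0..R}" for P
    using chi_tendsto[OF e P0(1), of P] that by (simp add: f_def \<rho>_def)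
  have chile: "\<bar>chi e P\<bar> \<le> P" if P: "P \<in> {P0..R}" for P
    by (rule LIMSEQ_le_const2[OF tendsto_rabs[OF lim[OF P]]]) (use sol_le[OF solf] P in auto)
  have "\<exists>g. \<forall>x\<in>{P0..R}. (\<lambda>n. f n x) \<longlonglongrightarrow> g x \<and>
      (g has_derivative (\<lambda>h. G x (chi e x) * h)) (at x within {P0..R})"
  proof (rule has_derivative_sequence[where f' = "\<lambda>n x h. G x (f n x) * h"])
    show "(f n has_derivative (*) (G x (f n x))) (at x within {P0..R})" if "x \<in> {P0..R}" for n x
      using solf[of n] that by (auto simp: sol_def has_field_derivative_def)
    show "P0 \<in> {P0..R}" using P0 by simp
    then show "(\<lambda>n. f n P0) \<longlonglongrightarrow> chi e P0" by (rule lim)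
    fix \<epsilon> :: real assume \<epsilon>: "\<epsilon> > 0"
    \<comment> \<open>The Lipschitz constant of \<open>G\<close> on \<open>{P0..R}\<close> times the
      rate from \<open>chi\<close> at the label of absolute value
      \<open>P0 / real (Suc n)\<close>.\<close>
    define M where "M = C / P0 * ((1 + C) * P0)"
    have "(\<lambda>n. M * inverse (real (Suc n))) \<longlonglongrightarrow> M * 0"
      by (intro tendsto_intros LIMSEQ_inverse_real_of_nat)
    then have "\<forall>\<^sub>F n in sequentially. M * inverse (real (Suc n)) < \<epsilon>"
      using \<epsilon> order_tendstoD(2) by fastforce
    then show "\<forall>\<^sub>F n in sequentially. \<forall>x\<in>{P0..R}. \<forall>h. norm (G x (f n x) * h - G x (chi e x) * h) \<le> \<epsilon> * norm h"
    proof (rule eventually_mono, intro ballI allI)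
      fix n x h assume n: "M * inverse (real (Suc n)) < \<epsilon>" and x: "x \<in> {P0..R}"
      have "\<bar>G x (f n x) - G x (chi e x)\<bar> \<le> C / x * \<bar>f n x - chi e x\<bar>"
        by (rule lip) (use x P0 sol_le[OF solf] chile[OF x] in auto)
      also have "\<dots> \<le> C / P0 * ((1 + C) * \<bar>\<rho> n\<bar>)"
        unfolding f_def using x P0 C e\<rho>[of n] le[of n]
        by (intro mult_mono divide_left_mono chi[OF e]) auto
      also have "\<dots> = M * inverse (real (Suc n))"
        unfolding e\<rho> by (simp add: M_def divide_inverse)
      finally have "\<bar>G x (f n x) - G x (chi e x)\<bar> * \<bar>h\<bar> \<le> \<epsilon> * \<bar>h\<bar>"
        using n by (intro mult_right_mono) auto
      then show "norm (G x (f n x) * h - G x (chi e x) * h) \<le> \<epsilon> * norm h"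
        by (simp add: abs_mult[symmetric] algebra_simps)
    qed
  qed (rule convex_real_interval)
  then obtain g where g: "\<And>x. x \<in> {P0..R} \<Longrightarrow> (\<lambda>n. f n x) \<longlonglongrightarrow> g x"
    "\<And>x. x \<in> {P0..R} \<Longrightarrow> (g has_real_derivative G x (chi e x)) (at x within {P0..R})"
    unfolding has_field_derivative_def by blast
  have geq: "g x = chi e x" if "x \<in> {P0..R}" for x
    using LIMSEQ_unique[OF g(1)[OF that] lim[OF that]] .
  have "(chi e has_real_derivative G x (chi e x)) (at x within {P0..R})" if "x \<in> {P0..R}" for x
    by (rule has_field_derivative_transform_within[OF g(2)[OF that], of 1]) (use that geq in auto)
  then show ?thesis using chile by (auto simp: sol_def)
qed

text \<open>The contraction makes the separatrix unique: the gap between the two one-sided limits is at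
  most its value at an earlier point \<open>p\<close>, which is at most \<open>2 p\<close>.\<close>

lemma chi_unique:
  assumes P: "0 < P" "P \<le> R"
  shows "chi 1 P = chi (- 1) P"
proof (rule ccontr)
  have le: "chi (- 1) t \<le> chi 1 t" if t: "0 < t" "t \<le> R" for t
  proof -
    have "psi (- 1 * (t / real (Suc n))) t \<le> psi (1 * (t / real (Suc n))) t" for n
    proof -
      define r where "r = t / real (Suc n)"
      have "r \<le> t" "0 < r" using t by (simp_all add: r_def field_simps)
      then show ?thesis using psi_less[of "- r" r t] t by (simp del: of_nat_Suc flip: r_def)
    qed
    then show ?thesis
      using t by (intro LIMSEQ_le[OF chi_tendsto[of "- 1" t t] chi_tendsto[of 1 t t]]) auto
  qed
  assume ne: "chi 1 P \<noteq> chi (- 1) P"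
  define d where "d = chi 1 P - chi (- 1) P"
  \<comment> \<open>With this \<open>p\<close> the bound \<open>2 * p\<close> is at most
    \<open>d / 2\<close>, below the assumed gap \<open>d\<close>.\<close>
  define p where "p = min P (d / 4)"
  have d: "0 < d" using ne le[OF P] by (simp add: d_def)
  then have p: "0 < p" "p \<le> P" "p \<le> R" using P by (auto simp: p_def)
  have p4: "p \<le> d / 4" unfolding p_def by (rule min.cobounded2)
  have s: "sol p (chi 1)" "sol p (chi (- 1))" using p by (auto intro!: chi_sol)
  have "d \<le> chi 1 p - chi (- 1) p"
    unfolding d_def by (rule sol_contract[OF s(2,1)]) (use p P le in auto)
  also have "\<dots> \<le> 2 * p" using sol_le[OF s(1), of p] sol_le[OF s(2), of p] p by auto
  finally show False using p4 d by simp
qed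

section \<open>The complete family of solutions and its joint continuity\<close>

definition Phi :: "real \<Rightarrow> real \<Rightarrow> real" where
  "Phi \<rho> = (if \<rho> = 0 then chi 1 else psi \<rho>)"

lemma chi_Phi:
  assumes "\<bar>\<rho>\<bar> \<le> P" "0 < P" "P \<le> R"
  shows "\<bar>Phi \<rho> P - Phi 0 P\<bar> \<le> (1 + C) * \<bar>\<rho>\<bar>"
  using chi[of "sgn \<rho>" \<rho> P] assms chi_unique[of P]
  by (cases \<rho> "0::real" rule: linorder_cases) (auto simp: Phi_def)

text \<open>Passing to the limit yields only weak inequalities against the separatrix; inserting the
  solution with half the label restores strictness.\<close>

lemma Phi_less:
  assumes "\<rho>1 < \<rho>2" "\<bar>\<rho>1\<bar> \<le> P" "\<bar>\<rho>2\<bar> \<le> P" "P \<le> R"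
  shows "Phi \<rho>1 P < Phi \<rho>2 P"
proof -
  have P: "0 < P" using assms by auto
  have pos: "Phi 0 P < Phi \<rho> P" if \<rho>: "0 < \<rho>" "\<rho> \<le> P" for \<rho>
  proof -
    have "psi (\<rho> / 2) P < psi \<rho> P" by (rule psi_less) (use \<rho> assms in auto)
    moreover have "chi 1 P \<le> psi (\<rho> / 2) P"
    proof (rule LIMSEQ_le_const2[OF chi_tendsto[of 1 "\<rho> / 2" P]])
      show "\<exists>N. \<forall>n\<ge>N. psi (1 * (\<rho> / 2 / real (Suc n))) P \<le> psi (\<rho> / 2) P"
      proof (intro exI allI impI)
        fix n
        define r where "r = \<rho> / 2 / real (Suc n)"
        have "r \<le> \<rho> / 2" "0 < r" using \<rho> by (simp_all add: r_def field_simps)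
        then show "psi (1 * (\<rho> / 2 / real (Suc n))) P \<le> psi (\<rho> / 2) P"
          unfolding r_def[symmetric] using psi_less[of r "\<rho> / 2" P] \<rho> assms
          by (cases "r = \<rho> / 2") auto
      qed
    qed (use \<rho> assms in auto)
    ultimately show ?thesis using \<rho> by (auto simp: Phi_def)
  qed
  have neg: "Phi \<rho> P < Phi 0 P" if \<rho>: "\<rho> < 0" "- \<rho> \<le> P" for \<rho>
  proof -
    have "psi \<rho> P < psi (\<rho> / 2) P" by (rule psi_less) (use \<rho> assms in auto)
    moreover have "psi (\<rho> / 2) P \<le> chi (- 1) P"
    proof (rule LIMSEQ_le_const[OF chi_tendsto[of "- 1" "- \<rho> / 2" P]])
      show "\<exists>N. \<forall>n\<ge>N. psi (\<rho> / 2) P \<le> psi (- 1 * (- \<rho> / 2 / real (Suc n))) P"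
      proof (intro exI allI impI)
        fix n
        define r where "r = - \<rho> / 2 / real (Suc n)"
        have "r \<le> - \<rho> / 2" "0 < r" using \<rho> by (simp_all add: r_def field_simps mult_nonpos_nonneg)
        then show "psi (\<rho> / 2) P \<le> psi (- 1 * (- \<rho> / 2 / real (Suc n))) P"
          unfolding r_def[symmetric] using psi_less[of "\<rho> / 2" "- r" P] \<rho> assms
          by (cases "r = - \<rho> / 2") auto
      qed
    qed (use \<rho> assms in auto)
    ultimately show ?thesis using \<rho> assms P chi_unique[of P] by (auto simp: Phi_def)
  qed
  consider "\<rho>1 \<ge> 0" "\<rho>1 = 0" | "\<rho>2 = 0" | "\<rho>1 \<noteq> 0" "\<rho>2 \<noteq> 0" by auto
  then show ?thesis
    by cases (use pos neg assms in \<open>auto simp: Phi_def intro: psi_less\<close>)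
qed

lemma Phi_sol:
  assumes "\<bar>\<rho>\<bar> \<le> P0" "0 < P0" "P0 \<le> R"
  shows "sol P0 (Phi \<rho>)"
  using assms chi_sol[of 1 P0] sol_mono[OF psi(1)[of \<rho>], of P0] by (auto simp: Phi_def)

lemma Phi_diag: "0 < P \<Longrightarrow> P \<le> R \<Longrightarrow> Phi P P = P" "0 < P \<Longrightarrow> P \<le> R \<Longrightarrow> Phi (- P) P = - P"
  using psi(2)[of P] psi(2)[of "- P"] by (auto simp: Phi_def)

lemma Phi_inside: "\<bar>\<rho>\<bar> < P \<Longrightarrow> P \<le> R \<Longrightarrow> \<bar>Phi \<rho> P\<bar> < P"
  using Phi_less[of \<rho> P P] Phi_less[of "- P" \<rho> P] Phi_diag[of P] by (smt (verit))

lemma Phi_lipschitz: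
  assumes "\<bar>\<rho>1\<bar> \<le> P" "\<bar>\<rho>2\<bar> \<le> P" "0 < P" "P \<le> R"
  shows "\<bar>Phi \<rho>1 P - Phi \<rho>2 P\<bar> \<le> (1 + C) * \<bar>\<rho>1 - \<rho>2\<bar>"
proof (cases "\<rho>1 * \<rho>2 > 0")
  case True
  then show ?thesis using psi_lipschitz[OF True assms(1,2,4)] by (auto simp: Phi_def)
next
  case False
  \<comment> \<open>Labels of opposite sign are compared through label 0, because their absolute
    values add up to their distance.\<close>
  then have "\<bar>\<rho>1\<bar> + \<bar>\<rho>2\<bar> = \<bar>\<rho>1 - \<rho>2\<bar>" by (auto simp: zero_less_mult_iff)
  then have "(1 + C) * \<bar>\<rho>1\<bar> + (1 + C) * \<bar>\<rho>2\<bar> = (1 + C) * \<bar>\<rho>1 - \<rho>2\<bar>"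
    by (simp flip: distrib_left)
  then show ?thesis using chi_Phi[of \<rho>1 P] chi_Phi[of \<rho>2 P] assms by linarith
qed

text \<open>Starting the solution strictly between \<open>\<bar>\<rho>\<bar>\<close> and
  \<open>P\<close> makes the derivative at \<open>P\<close> two-sided.\<close>

lemma Phi_at:
  assumes "\<bar>\<rho>\<bar> < P" "P < R"
  shows "(Phi \<rho> has_vector_derivative G P (Phi \<rho> P)) (at P)"
proof -
  obtain P0 where "\<bar>\<rho>\<bar> < P0" "P0 < P" using dense assms by blast
  then show ?thesis using assms by (intro sol_at[OF Phi_sol[of \<rho> P0]]) auto
qed

text \<open>Two points are joined by following a solution from the smaller to the larger
  \<open>P\<close> and changing the label there, where both labels are admissible; this even gives a
  Lipschitz bound.\<close>

lemma Phi_cont: "continuous_on {(P, \<rho>). 0 < P \<and> P \<le> R \<and> \<bar>\<rho>\<bar> \<le> P} (\<lambda>(P, \<rho>). Phi \<rho> P)"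
proof -
  have le: "\<bar>Phi \<rho>1 P1 - Phi \<rho>2 P2\<bar> \<le> (1 + C) * \<bar>\<rho>1 - \<rho>2\<bar> + C * \<bar>P1 - P2\<bar>"
    if "0 < P1" "P1 \<le> P2" "P2 \<le> R" "\<bar>\<rho>1\<bar> \<le> P1" "\<bar>\<rho>2\<bar> \<le> P2" for \<rho>1 \<rho>2 P1 P2
    using Phi_lipschitz[of \<rho>1 P2 \<rho>2] sol_lipschitz[OF Phi_sol[of \<rho>1 P1], of P1 P2] that by auto
  let ?S = "{(P, \<rho>). 0 < P \<and> P \<le> R \<and> \<bar>\<rho>\<bar> \<le> P}"
  have "(1 + 2 * C)-lipschitz_on ?S (\<lambda>(P, \<rho>). Phi \<rho> P)"
  proof (rule lipschitz_onI)
    fix x y assume xy: "x \<in> ?S" "y \<in> ?S"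
    obtain P1 \<rho>1 P2 \<rho>2 where [simp]: "x = (P1, \<rho>1)" "y = (P2, \<rho>2)" by (cases x, cases y)
    have "\<bar>Phi \<rho>1 P1 - Phi \<rho>2 P2\<bar> \<le> (1 + C) * \<bar>\<rho>1 - \<rho>2\<bar> + C * \<bar>P1 - P2\<bar>"
      using le[of P1 P2 \<rho>1 \<rho>2] le[of P2 P1 \<rho>2 \<rho>1] xy by (cases "P1 \<le> P2") (auto simp: abs_minus_commute)
    also have "\<dots> \<le> (1 + C) * dist x y + C * dist x y"
      using C dist_fst_le[of x y] dist_snd_le[of x y]
      by (intro add_mono mult_left_mono) (auto simp: dist_real_def)
    finally show "dist (case x of (P, \<rho>) \<Rightarrow> Phi \<rho> P) (case y of (P, \<rho>) \<Rightarrow> Phi \<rho> P) \<le> (1 + 2 * C) * dist x y"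
      by (simp add: dist_real_def algebra_simps)
  qed (use C in auto)
  then show ?thesis by (rule lipschitz_on_continuous_on)
qed

end

section \<open>Straightening the orbits in one quadrant\<close>

definition vec2 :: "real \<Rightarrow> real \<Rightarrow> real^2" where
  "vec2 a b = vector [a, b]"

lemma vec2_nth [simp]: "vec2 a b $ 1 = a" "vec2 a b $ 2 = b"
  by (simp_all add: vec2_def)

lemma vec2_eq_iff: "(p :: real^2) = q \<longleftrightarrow> p $ 1 = q $ 1 \<and> p $ 2 = q $ 2"
  by (simp add: vec_eq_iff forall_2)

lemma vec2_conv_axis: "vec2 a b = a *\<^sub>R axis 1 1 + b *\<^sub>R axis 2 1"
  by (simp add: vec2_eq_iff axis_def)

lemma has_vector_derivative_vec2:
  assumes "(f has_vector_derivative f') F" "(g has_vector_derivative g') F"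
  shows "((\<lambda>t. vec2 (f t) (g t)) has_vector_derivative vec2 f' g') F"
  unfolding vec2_conv_axis has_vector_derivative_def
  by (rule has_derivative_eq_rhs, (rule derivative_intros assms[unfolded has_vector_derivative_def])+)
    (auto simp: algebra_simps)

lemma continuous_on_vec2 [continuous_intros]:
  "continuous_on S f \<Longrightarrow> continuous_on S g \<Longrightarrow> continuous_on S (\<lambda>t. vec2 (f t) (g t))"
  unfolding vec2_conv_axis by (intro continuous_intros)

lemma has_vector_derivative_nth:
  "(f has_vector_derivative f') F \<Longrightarrow> ((\<lambda>t. f t $ i) has_vector_derivative f' $ i) F"
  by (rule bounded_linear.has_vector_derivative[OF bounded_linear_vec_nth])

lemma norm_le_sum_abs: "norm (p :: real^2) \<le> \<bar>p $ 1\<bar> + \<bar>p $ 2\<bar>"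
  using norm_le_l1_cart[of p] by (simp add: UNIV_2)

lemma divide_rescale:
  fixes N P D c :: real
  assumes "P \<noteq> 0"
  shows "N * (P * D) / ((c * P) * (c * P)) = N / (c * c) / P * D"
  using assms by (simp add: divide_simps)

text \<open>For a sector, \<open>P = x + y\<close> and \<open>Q = x - y\<close> are the coordinates along the unstable and the
  stable eigenvector; orbits are graphs of solutions of \<open>dQ/dP = G P Q\<close>.\<close>

definition pt :: "real \<Rightarrow> real \<Rightarrow> real^2" where
  "pt P Q = vec2 ((P + Q) / 2) ((P - Q) / 2)"

lemma pt_nth [simp]: "pt P Q $ 1 = (P + Q) / 2" "pt P Q $ 2 = (P - Q) / 2"
  by (simp_all add: pt_def)

text \<open>\<open>a\<close> and \<open>- b\<close> are the eigenvalues of the linear part along the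
  two diagonals. The estimates compare increments of \<open>F\<close> rather than values, because
  monotonicity of the slope in \<open>Q\<close> needs a Lipschitz bound on the nonlinear
  remainder.\<close>

locale quadrant =
  fixes F :: vfield and a b \<delta> R :: real
  assumes R: "R > 0" and \<delta>: "0 < \<delta>" "4 * \<delta> \<le> a" "4 * \<delta> \<le> b"
    and F0: "F 0 = 0" and contF: "continuous_on {p. 0 \<le> p $ 1 \<and> 0 \<le> p $ 2 \<and> p $ 1 + p $ 2 \<le> R} F"
    and A_est: "\<And>p q. \<lbrakk>0 \<le> p $ 1; 0 \<le> p $ 2; p $ 1 + p $ 2 \<le> R; 0 \<le> q $ 1; 0 \<le> q $ 2; q $ 1 + q $ 2 \<le> R\<rbrakk> \<Longrightarrow>
        \<bar>(F p $ 1 + F p $ 2) - (F q $ 1 + F q $ 2) - a * (p $ 1 + p $ 2 - (q $ 1 + q $ 2))\<bar> \<le> \<delta> * norm (p - q)"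
    and B_est: "\<And>p q. \<lbrakk>0 \<le> p $ 1; 0 \<le> p $ 2; p $ 1 + p $ 2 \<le> R; 0 \<le> q $ 1; 0 \<le> q $ 2; q $ 1 + q $ 2 \<le> R\<rbrakk> \<Longrightarrow>
        \<bar>(F p $ 1 - F p $ 2) - (F q $ 1 - F q $ 2) + b * (p $ 1 - p $ 2 - (q $ 1 - q $ 2))\<bar> \<le> \<delta> * norm (p - q)"
begin

section \<open>The slope equation of a nearly linear field\<close>

definition A :: "real^2 \<Rightarrow> real" where "A p = F p $ 1 + F p $ 2"
definition B :: "real^2 \<Rightarrow> real" where "B p = F p $ 1 - F p $ 2"
definition G :: "real \<Rightarrow> real \<Rightarrow> real" where "G P Q = B (pt P Q) / A (pt P Q)"
text \<open>In \<open>G_diff\<close> the numerator is at most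
  \<open>(b + \<delta>) * (a + 2 * \<delta>) * (P * D)\<close>, with \<open>D\<close> the distance
  of the two values of \<open>Q\<close>, and the denominator at least the square of
  \<open>(a - \<delta>) * P\<close>. The quotient also dominates
  \<open>(b + \<delta>) / (a - \<delta>)\<close>, the bound for \<open>G\<close> itself.\<close>

definition C :: real where "C = (b + \<delta>) * (a + 2 * \<delta>) / (a - \<delta>)\<^sup>2"

lemma ab: "a > 0" "b > 0" "a - \<delta> > 0" using \<delta> by auto

lemma pt_Q: "\<bar>Q\<bar> \<le> P \<Longrightarrow> P \<le> R \<Longrightarrow> 0 \<le> pt P Q $ 1 \<and> 0 \<le> pt P Q $ 2 \<and> pt P Q $ 1 + pt P Q $ 2 \<le> R"
  by (auto simp: field_simps)

lemma pt_diff: "norm (pt P Q1 - pt P Q2) \<le> \<bar>Q1 - Q2\<bar>"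
  using norm_le_sum_abs[of "pt P Q1 - pt P Q2"] by (auto simp: field_simps)

lemma norm_pt: "\<bar>Q\<bar> \<le> P \<Longrightarrow> norm (pt P Q) \<le> P"
  using norm_le_sum_abs[of "pt P Q"] by (auto simp: field_simps)

lemma A_bounds:
  assumes "\<bar>Q\<bar> \<le> P" "P \<le> R"
  shows "(a - \<delta>) * P \<le> A (pt P Q)" "A (pt P Q) \<le> (a + \<delta>) * P"
proof -
  have "\<bar>A (pt P Q) - a * P\<bar> \<le> \<delta> * norm (pt P Q)"
    using A_est[of "pt P Q" 0] pt_Q[OF assms] R F0 by (simp add: A_def field_simps)
  also have "\<dots> \<le> \<delta> * P" using \<delta> norm_pt[of Q P] assms by (intro mult_left_mono) auto
  finally show "(a - \<delta>) * P \<le> A (pt P Q)" "A (pt P Q) \<le> (a + \<delta>) * P"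
    by (auto simp: algebra_simps)
qed

lemma A_pos: "\<bar>Q\<bar> \<le> P \<Longrightarrow> 0 < P \<Longrightarrow> P \<le> R \<Longrightarrow> 0 < A (pt P Q)"
  using A_bounds(1)[of Q P] ab mult_pos_pos[of "a - \<delta>" P] by linarith

lemma B_near:
  assumes "\<bar>Q\<bar> \<le> P" "P \<le> R"
  shows "\<bar>B (pt P Q) + b * Q\<bar> \<le> \<delta> * P"
proof -
  have "\<bar>B (pt P Q) + b * Q\<bar> \<le> \<delta> * norm (pt P Q)"
    using B_est[of "pt P Q" 0] pt_Q[OF assms] R F0 by (simp add: B_def field_simps)
  also have "\<dots> \<le> \<delta> * P" using \<delta> norm_pt[of Q P] assms by (intro mult_left_mono) auto
  finally show ?thesis .
qed

lemma B_bound: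
  assumes "\<bar>Q\<bar> \<le> P" "P \<le> R"
  shows "\<bar>B (pt P Q)\<bar> \<le> (b + \<delta>) * P"
proof -
  have "\<bar>b * Q\<bar> \<le> b * P" using ab assms by (simp add: abs_mult)
  then show ?thesis using B_near[OF assms] by (auto simp: algebra_simps)
qed

lemma AB_diff:
  assumes "\<bar>Q1\<bar> \<le> P" "\<bar>Q2\<bar> \<le> P" "P \<le> R"
  shows "\<bar>A (pt P Q1) - A (pt P Q2)\<bar> \<le> \<delta> * \<bar>Q1 - Q2\<bar>"
    "\<bar>B (pt P Q1) - B (pt P Q2) + b * (Q1 - Q2)\<bar> \<le> \<delta> * \<bar>Q1 - Q2\<bar>"
proof -
  have le: "\<delta> * norm (pt P Q1 - pt P Q2) \<le> \<delta> * \<bar>Q1 - Q2\<bar>"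
    using \<delta> pt_diff by (intro mult_left_mono) auto
  have "\<bar>A (pt P Q1) - A (pt P Q2)\<bar> \<le> \<delta> * norm (pt P Q1 - pt P Q2)"
    using A_est[of "pt P Q1" "pt P Q2"] pt_Q[OF assms(1,3)] pt_Q[OF assms(2,3)] by (simp add: A_def field_simps)
  then show "\<bar>A (pt P Q1) - A (pt P Q2)\<bar> \<le> \<delta> * \<bar>Q1 - Q2\<bar>" using le by linarith
  have "\<bar>B (pt P Q1) - B (pt P Q2) + b * (Q1 - Q2)\<bar> \<le> \<delta> * norm (pt P Q1 - pt P Q2)"
    using B_est[of "pt P Q1" "pt P Q2"] pt_Q[OF assms(1,3)] pt_Q[OF assms(2,3)] by (simp add: B_def field_simps)
  then show "\<bar>B (pt P Q1) - B (pt P Q2) + b * (Q1 - Q2)\<bar> \<le> \<delta> * \<bar>Q1 - Q2\<bar>" using le by linarith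
qed

lemma G_diff:
  assumes "\<bar>Q1\<bar> \<le> P" "\<bar>Q2\<bar> \<le> P" "0 < P" "P \<le> R"
  shows "G P Q1 - G P Q2 = ((B (pt P Q1) - B (pt P Q2)) * A (pt P Q1) - B (pt P Q1) * (A (pt P Q1) - A (pt P Q2)))
    / (A (pt P Q1) * A (pt P Q2))"
  using A_pos[of Q1 P] A_pos[of Q2 P] assms by (simp add: G_def field_simps)

sublocale cone_ode G C R
proof
  show "R > 0" by (rule R)
  show "C > 0" using ab \<delta> by (auto simp: C_def intro!: divide_pos_pos mult_pos_pos add_pos_pos)
  have "continuous_on {(P, Q). 0 < P \<and> P \<le> R \<and> \<bar>Q\<bar> \<le> P} (\<lambda>x. pt (fst x) (snd x))"
    unfolding pt_def by (intro continuous_intros) auto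
  from continuous_on_compose2[OF contF this]
  have cF: "continuous_on {(P, Q). 0 < P \<and> P \<le> R \<and> \<bar>Q\<bar> \<le> P} (\<lambda>x. F (pt (fst x) (snd x)))"
    using pt_Q by (force simp del: pt_nth)
  have "A (pt (fst x) (snd x)) \<noteq> 0" if "x \<in> {(P, Q). 0 < P \<and> P \<le> R \<and> \<bar>Q\<bar> \<le> P}" for x
    using A_pos[of "snd x" "fst x"] that by auto
  then have "continuous_on {(P, Q). 0 < P \<and> P \<le> R \<and> \<bar>Q\<bar> \<le> P} (\<lambda>x. G (fst x) (snd x))"
    unfolding G_def A_def B_def by (intro continuous_intros cF) auto
  then show "continuous_on {(P, Q). 0 < P \<and> P \<le> R \<and> \<bar>Q\<bar> \<le> P} (\<lambda>(P, Q). G P Q)"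
    by (simp add: case_prod_beta)
next
  fix P Q1 Q2 :: real assume P: "0 < P" "P \<le> R" and Q: "\<bar>Q1\<bar> \<le> P" "\<bar>Q2\<bar> \<le> P" and le: "Q1 \<le> Q2"
  define D where "D = Q2 - Q1"
  have D: "D \<ge> 0" using le by (simp add: D_def)
  have pos: "0 < A (pt P Q1)" "0 < A (pt P Q2)" using A_pos P Q by auto
  \<comment> \<open>The main term of the numerator in \<open>G_diff\<close>: \<open>B\<close> falls
    in \<open>Q\<close> at rate at least \<open>b - \<delta>\<close>, and this is weighted by
    \<open>A\<close>. The other term has the small factor \<open>\<delta>\<close>.\<close>
  have "(b - \<delta>) * D * ((a - \<delta>) * P) \<le> (B (pt P Q1) - B (pt P Q2)) * A (pt P Q1)"
  proof (rule mult_mono)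
    show "(b - \<delta>) * D \<le> B (pt P Q1) - B (pt P Q2)"
      using AB_diff(2)[OF Q P(2)] le by (auto simp: D_def algebra_simps)
    then show "0 \<le> B (pt P Q1) - B (pt P Q2)"
      using mult_nonneg_nonneg[of "b - \<delta>" D] D \<delta> by linarith
    show "(a - \<delta>) * P \<le> A (pt P Q1)" by (rule A_bounds) (use P Q in auto)
    show "0 \<le> (a - \<delta>) * P" using ab P by simp
  qed
  moreover have "\<bar>B (pt P Q1) * (A (pt P Q1) - A (pt P Q2))\<bar> \<le> ((b + \<delta>) * P) * (\<delta> * D)"
    unfolding abs_mult using AB_diff(1)[OF Q P(2)] B_bound[OF Q(1) P(2)] P ab \<delta> D
    by (intro mult_mono) (auto simp: D_def)
  moreover have "((b + \<delta>) * P) * (\<delta> * D) \<le> (b - \<delta>) * D * ((a - \<delta>) * P)"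
  proof -
    \<comment> \<open>The bound \<open>3 * \<delta> \<le> b\<close> costs a factor 2, which
      \<open>3 * \<delta> \<le> a\<close> absorbs.\<close>
    have "(b + \<delta>) * \<delta> \<le> (b - \<delta>) * (a - \<delta>)"
    proof -
      have "(b + \<delta>) * \<delta> \<le> (2 * (b - \<delta>)) * \<delta>" using \<delta> by (intro mult_right_mono) auto
      also have "\<dots> = (b - \<delta>) * (2 * \<delta>)" by simp
      also have "\<dots> \<le> (b - \<delta>) * (a - \<delta>)" using \<delta> by (intro mult_left_mono) auto
      finally show ?thesis .
    qed
    then have "((b + \<delta>) * \<delta>) * (P * D) \<le> ((b - \<delta>) * (a - \<delta>)) * (P * D)"
      using P D by (intro mult_right_mono) auto
    then show ?thesis by (simp add: ac_simps)
  qed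
  ultimately have "0 \<le> (B (pt P Q1) - B (pt P Q2)) * A (pt P Q1) - B (pt P Q1) * (A (pt P Q1) - A (pt P Q2))"
    by linarith
  then have "0 \<le> G P Q1 - G P Q2" using pos by (simp add: G_diff[OF Q P])
  then show "G P Q2 \<le> G P Q1" by simp
next
  fix P Q1 Q2 :: real assume P: "0 < P" "P \<le> R" and Q: "\<bar>Q1\<bar> \<le> P" "\<bar>Q2\<bar> \<le> P"
  define D where "D = \<bar>Q1 - Q2\<bar>"
  have D: "D \<ge> 0" by (simp add: D_def)
  have pos: "0 < A (pt P Q1)" "0 < A (pt P Q2)" using A_pos P Q by auto
  have bD: "\<bar>b * (Q1 - Q2)\<bar> = b * D" using ab by (simp add: D_def abs_mult)
  then have "\<bar>B (pt P Q1) - B (pt P Q2)\<bar> \<le> (b + \<delta>) * D"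
    using AB_diff(2)[OF Q P(2)] by (auto simp: D_def algebra_simps)
  then have "\<bar>(B (pt P Q1) - B (pt P Q2)) * A (pt P Q1)\<bar> \<le> ((b + \<delta>) * D) * ((a + \<delta>) * P)"
    unfolding abs_mult using A_bounds(2)[OF Q(1) P(2)] pos \<delta> D ab by (intro mult_mono) auto
  moreover have "\<bar>B (pt P Q1) * (A (pt P Q1) - A (pt P Q2))\<bar> \<le> ((b + \<delta>) * P) * (\<delta> * D)"
    unfolding abs_mult using AB_diff(1)[OF Q P(2)] B_bound[OF Q(1) P(2)] P ab \<delta> D
    by (intro mult_mono) (auto simp: D_def)
  ultimately have N: "\<bar>(B (pt P Q1) - B (pt P Q2)) * A (pt P Q1) - B (pt P Q1) * (A (pt P Q1) - A (pt P Q2))\<bar>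
      \<le> (b + \<delta>) * (a + 2 * \<delta>) * (P * D)" by (auto simp: algebra_simps)
  have M: "((a - \<delta>) * P) * ((a - \<delta>) * P) \<le> A (pt P Q1) * A (pt P Q2)"
    using A_bounds(1)[OF Q(1) P(2)] A_bounds(1)[OF Q(2) P(2)] pos ab P by (intro mult_mono) auto
  have "\<bar>G P Q1 - G P Q2\<bar> = \<bar>(B (pt P Q1) - B (pt P Q2)) * A (pt P Q1) - B (pt P Q1) * (A (pt P Q1) - A (pt P Q2))\<bar>
      / (A (pt P Q1) * A (pt P Q2))"
    using pos by (simp add: G_diff[OF Q P] abs_divide abs_mult)
  also have "\<dots> \<le> (b + \<delta>) * (a + 2 * \<delta>) * (P * D) / (((a - \<delta>) * P) * ((a - \<delta>) * P))"
    by (rule frac_le[OF _ N _ M]) (use ab \<delta> P D in auto)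
  also have "\<dots> = C / P * D" using P by (simp add: C_def power2_eq_square divide_rescale)
  finally show "\<bar>G P Q1 - G P Q2\<bar> \<le> C / P * \<bar>Q1 - Q2\<bar>" by (simp add: D_def)
next
  fix P Q :: real assume P: "0 < P" "P \<le> R" and Q: "\<bar>Q\<bar> \<le> P"
  have "\<bar>G P Q\<bar> = \<bar>B (pt P Q)\<bar> / A (pt P Q)" using A_pos[OF Q P] by (simp add: G_def)
  also have "\<dots> \<le> ((b + \<delta>) * P) / ((a - \<delta>) * P)"
    by (rule frac_le) (use A_bounds(1)[OF Q P(2)] B_bound[OF Q P(2)] ab \<delta> P in auto)
  also have "\<dots> = (b + \<delta>) * (a - \<delta>) / (a - \<delta>)\<^sup>2" using P ab(3) by (simp add: power2_eq_square)
  also have "\<dots> \<le> C" unfolding C_def using ab \<delta> by (intro divide_right_mono mult_left_mono) auto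
  finally show "\<bar>G P Q\<bar> \<le> C" .
next
  fix P :: real assume P: "0 < P" "P \<le> R"
  \<comment> \<open>On the side \<open>Q = P\<close> this is a lower bound for \<open>A - B\<close>,
    on the side \<open>Q = - P\<close> for \<open>A + B\<close>.\<close>
  have pos: "0 < (a + b - 2 * \<delta>) * P" using \<delta> P by (intro mult_pos_pos) auto
  have "B (pt P P) < A (pt P P)"
    using A_bounds(1)[of P P] B_near[of P P] pos P by (auto simp: algebra_simps)
  then show "G P P < 1" using A_pos[of P P] P by (simp add: G_def)
  have "- A (pt P (- P)) < B (pt P (- P))"
    using A_bounds(1)[of "- P" P] B_near[of "- P" P] pos P by (auto simp: algebra_simps)
  then show "- 1 < G P (- P)" using A_pos[of "- P" P] P by (simp add: G_def field_simps)
qed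

text \<open>The inverse of the straightening: the sum of the coordinates of \<open>w\<close> is
  \<open>P\<close>, their difference is the label, so diagonal lines go to orbits. The origin needs
  a value of its own because \<open>Phi\<close> is controlled only for \<open>P > 0\<close>.\<close>

definition k :: "real^2 \<Rightarrow> real^2" where
  "k w = (if w = 0 then 0 else pt (w $ 1 + w $ 2) (Phi (w $ 1 - w $ 2) (w $ 1 + w $ 2)))"

section \<open>The straightening map on one closed quadrant\<close>

definition T :: "(real^2) set" where
  "T = {w. 0 \<le> w $ 1 \<and> 0 \<le> w $ 2 \<and> w $ 1 + w $ 2 < R}"

lemma T_cone:
  assumes "w \<in> T" "w \<noteq> 0"
  shows "\<bar>w $ 1 - w $ 2\<bar> \<le> w $ 1 + w $ 2" "0 < w $ 1 + w $ 2" "w $ 1 + w $ 2 \<le> R"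
  using assms by (auto simp: T_def vec2_eq_iff)

lemma Phi_cases:
  assumes "\<bar>\<rho>\<bar> \<le> P" "0 < P" "P \<le> R"
  shows "\<bar>Phi \<rho> P\<bar> \<le> P" "Phi \<rho> P = P \<longleftrightarrow> \<rho> = P" "Phi \<rho> P = - P \<longleftrightarrow> \<rho> = - P"
  using Phi_inside[of \<rho> P] Phi_diag[of P] assms by (smt (verit))+

lemma k_sum: "w \<in> T \<Longrightarrow> k w $ 1 + k w $ 2 = w $ 1 + w $ 2"
  by (auto simp: k_def field_simps)

lemma k_nonneg:
  assumes "w \<in> T"
  shows "0 \<le> k w $ 1" "0 \<le> k w $ 2" "k w $ 1 = 0 \<longleftrightarrow> w $ 1 = 0" "k w $ 2 = 0 \<longleftrightarrow> w $ 2 = 0"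
proof -
  have "0 \<le> k w $ 1 \<and> 0 \<le> k w $ 2 \<and> (k w $ 1 = 0 \<longleftrightarrow> w $ 1 = 0) \<and> (k w $ 2 = 0 \<longleftrightarrow> w $ 2 = 0)"
  proof (cases "w = 0")
    case False
    define P \<rho> where "P = w $ 1 + w $ 2" and "\<rho> = w $ 1 - w $ 2"
    note c = Phi_cases[OF T_cone[OF assms False], folded P_def \<rho>_def]
    have "k w = pt P (Phi \<rho> P)" using False by (simp add: k_def P_def \<rho>_def)
    moreover have "w $ 1 = (P + \<rho>) / 2" "w $ 2 = (P - \<rho>) / 2" by (auto simp: P_def \<rho>_def)
    ultimately show ?thesis using c by (auto simp: field_simps)
  qed (simp add: k_def)
  then show "0 \<le> k w $ 1" "0 \<le> k w $ 2" "k w $ 1 = 0 \<longleftrightarrow> w $ 1 = 0" "k w $ 2 = 0 \<longleftrightarrow> w $ 2 = 0" by auto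
qed

lemma inj_k: "inj_on k T"
proof (rule inj_onI)
  fix w v assume w: "w \<in> T" and v: "v \<in> T" and eq: "k w = k v"
  have P: "w $ 1 + w $ 2 = v $ 1 + v $ 2" using k_sum[OF w] k_sum[OF v] eq by simp
  show "w = v"
  proof (cases "w = 0 \<or> v = 0")
    case True
    then show ?thesis using P w v by (auto simp: T_def vec2_eq_iff)
  next
    case False
    define P where "P = w $ 1 + w $ 2"
    have "k w $ 1 = (P + Phi (w $ 1 - w $ 2) P) / 2" "k v $ 1 = (P + Phi (v $ 1 - v $ 2) P) / 2"
      using False P by (auto simp: k_def P_def)
    then have "Phi (w $ 1 - w $ 2) P = Phi (v $ 1 - v $ 2) P" using eq by simp
    then have "w $ 1 - w $ 2 = v $ 1 - v $ 2"
      using Phi_less[of "w $ 1 - w $ 2" "v $ 1 - v $ 2" P] Phi_less[of "v $ 1 - v $ 2" "w $ 1 - w $ 2" P]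
        T_cone[OF w] T_cone[OF v] False P by (fastforce simp: P_def)
    then show ?thesis using P by (auto simp: vec2_eq_iff)
  qed
qed

lemma cont_k: "continuous_on T k"
proof -
  have "continuous_on (T - {0}) (\<lambda>w. (w $ 1 + w $ 2, w $ 1 - w $ 2))" by (intro continuous_intros)
  from continuous_on_compose2[OF Phi_cont this]
  have "continuous_on (T - {0}) (\<lambda>w. Phi (w $ 1 - w $ 2) (w $ 1 + w $ 2))"
    using T_cone by force
  then have "continuous_on (T - {0}) (\<lambda>w. pt (w $ 1 + w $ 2) (Phi (w $ 1 - w $ 2) (w $ 1 + w $ 2)))"
    unfolding pt_def by (intro continuous_intros) auto
  then have c: "continuous_on (T - {0}) k"
    by (rule continuous_on_eq) (auto simp: k_def)
  show ?thesis
    unfolding continuous_on_eq_continuous_within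
  proof
    fix x assume x: "x \<in> T"
    show "continuous (at x within T) k"
    proof (cases "x = 0")
      case True
      \<comment> \<open>At the vertex \<open>k\<close> preserves the sum of the coordinates and
        stays in the quadrant, so this sum bounds the norm of the image.\<close>
      have k0: "k 0 = 0" by (simp add: k_def)
      show ?thesis unfolding continuous_within True k0
      proof (rule Lim_null_comparison[where g = "\<lambda>w::real^2. w $ 1 + w $ 2"])
        have "norm (k w) \<le> w $ 1 + w $ 2" if "w \<in> T" for w
          using norm_le_sum_abs[of "k w"] k_nonneg(1,2)[OF that] k_sum[OF that] by simp
        then show "\<forall>\<^sub>F w in at 0 within T. norm (k w) \<le> w $ 1 + w $ 2"
          by (simp add: eventually_at_filter)
        have "((\<lambda>w::real^2. w $ 1 + w $ 2) \<longlongrightarrow> (0 :: real^2) $ 1 + (0 :: real^2) $ 2) (at 0 within T)"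
          by (intro tendsto_intros)
        then show "((\<lambda>w::real^2. w $ 1 + w $ 2) \<longlongrightarrow> 0) (at 0 within T)" by simp
      qed
    next
      case False
      have "at x within T = at x within (T - {0})"
        by (rule at_within_nhd[of x "- {0}"]) (use False in auto)
      then show ?thesis using c x False by (simp add: continuous_on_eq_continuous_within)
    qed
  qed
qed

lemma A_pos_k: "w \<in> T \<Longrightarrow> w \<noteq> 0 \<Longrightarrow> 0 < A (k w)"
  using A_pos T_cone Phi_cases(1) by (auto simp: k_def)

text \<open>The slope conditions on the sides of the cone are crossing conditions:
  \<open>B < A\<close> at \<open>Q = P\<close> means that the second component of \<open>F\<close>
  is positive, \<open>- A < B\<close> at \<open>Q = - P\<close> that the first one is.\<close>

lemma F_axis_pos: "0 < x \<Longrightarrow> x \<le> R \<Longrightarrow> 0 < F (vec2 x 0) $ 2" "0 < x \<Longrightarrow> x \<le> R \<Longrightarrow> 0 < F (vec2 0 x) $ 1"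
  using upper[of x] lower[of x] A_pos[of x x] A_pos[of "- x" x]
  by (auto simp: G_def pt_def A_def B_def field_simps)

lemma k_line:
  assumes "0 < w $ 1 + s" "0 < w $ 2 + s"
  shows "k (w + s *\<^sub>R vec2 1 1) = pt (w $ 1 + w $ 2 + 2 * s) (Phi (w $ 1 - w $ 2) (w $ 1 + w $ 2 + 2 * s))"
proof -
  have "w + s *\<^sub>R vec2 1 1 \<noteq> 0" using assms by (auto simp: vec2_eq_iff)
  then show ?thesis by (simp add: k_def algebra_simps)
qed

lemma F_pt: "A (pt P Q) \<noteq> 0 \<Longrightarrow> vec2 (1 + G P Q) (1 - G P Q) = (2 / A (pt P Q)) *\<^sub>R F (pt P Q)"
  by (auto simp: vec2_eq_iff G_def A_def B_def field_simps)

text \<open>Along the diagonal direction \<open>P\<close> grows at rate 2, along \<open>F\<close> at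
  rate \<open>A\<close>; their quotient is the change of speed.\<close>

lemma k_has_derivative:
  assumes w: "w \<in> T" "0 < w $ 1" "0 < w $ 2"
  shows "((\<lambda>s. k (w + s *\<^sub>R vec2 1 1)) has_vector_derivative (2 / A (k w)) *\<^sub>R F (k w)) (at 0)"
proof -
  define P \<rho> where "P = w $ 1 + w $ 2" and "\<rho> = w $ 1 - w $ 2"
  have P: "\<bar>\<rho>\<bar> < P" "P < R" "0 < P" using w by (auto simp: P_def \<rho>_def T_def)
  have kw: "k w = pt P (Phi \<rho> P)" using w by (auto simp: k_def P_def \<rho>_def)
  have "((\<lambda>s. P + 2 * s) has_vector_derivative 2) (at 0)" by (auto intro!: derivative_eq_intros)
  from vector_diff_chain_at[OF this, of "Phi \<rho>"] Phi_at[of \<rho> P] P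
  have "((\<lambda>s. Phi \<rho> (P + 2 * s)) has_vector_derivative 2 * G P (Phi \<rho> P)) (at 0)"
    by (simp add: o_def)
  then have "((\<lambda>s. pt (P + 2 * s) (Phi \<rho> (P + 2 * s))) has_vector_derivative
      vec2 ((2 + 2 * G P (Phi \<rho> P)) / 2) ((2 - 2 * G P (Phi \<rho> P)) / 2)) (at 0)"
    unfolding pt_def by (intro has_vector_derivative_vec2) (auto intro!: derivative_eq_intros)
  also have "vec2 ((2 + 2 * G P (Phi \<rho> P)) / 2) ((2 - 2 * G P (Phi \<rho> P)) / 2) = (2 / A (k w)) *\<^sub>R F (k w)"
  proof -
    have "A (pt P (Phi \<rho> P)) \<noteq> 0" using A_pos_k[of w] w kw by force
    from F_pt[OF this] show ?thesis by (simp add: kw add_divide_distrib diff_divide_distrib)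
  qed
  finally show ?thesis
    by (rule has_vector_derivative_transform_within_open[of _ _ _ "{- min (w $ 1) (w $ 2)<..}"])
      (use w k_line[of w] in \<open>auto simp: P_def \<rho>_def\<close>)
qed

text \<open>As \<open>A\<close> does not vanish, \<open>P\<close> can replace time, and
  \<open>Q - Phi \<rho> P\<close> measures the departure from the orbit labelled
  \<open>\<rho>\<close>. Its derivative is bounded by a multiple of itself, so Gronwall makes it
  vanish. The sign \<open>\<sigma>\<close> serves the sectors whose time is reversed.\<close>

lemma k_unique:
  assumes \<sigma>: "\<bar>\<sigma>\<bar> = 1" and d: "0 < d"
    and \<gamma>: "\<And>t. \<bar>t - t0\<bar> < d \<Longrightarrow> 0 < \<gamma> t $ 1 \<and> 0 < \<gamma> t $ 2 \<and> \<gamma> t $ 1 + \<gamma> t $ 2 < R \<and>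
        (\<gamma> has_vector_derivative \<sigma> *\<^sub>R F (\<gamma> t)) (at t)"
    and w: "w \<in> T" and t0: "\<gamma> t0 = k w"
  shows "\<exists>d'>0. \<forall>t. \<bar>t - t0\<bar> < d' \<longrightarrow>
    (let s = (\<gamma> t $ 1 + \<gamma> t $ 2 - (w $ 1 + w $ 2)) / 2
     in 0 < w $ 1 + s \<and> 0 < w $ 2 + s \<and> \<gamma> t = k (w + s *\<^sub>R vec2 1 1))"
proof -
  define P where "P t = \<gamma> t $ 1 + \<gamma> t $ 2" for t
  define Q where "Q t = \<gamma> t $ 1 - \<gamma> t $ 2" for t
  define \<rho> where "\<rho> = w $ 1 - w $ 2"
  have \<gamma>pt: "\<gamma> t = pt (P t) (Q t)" for t by (auto simp: P_def Q_def vec2_eq_iff)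
  have w0: "0 < w $ 1" "0 < w $ 2" using k_nonneg[OF w] \<gamma>[of t0] t0 d w by (auto simp: T_def less_le)
  have Pt0: "P t0 = w $ 1 + w $ 2" using k_sum[OF w] t0 by (simp add: P_def)
  have P': "(P has_vector_derivative \<sigma> * A (\<gamma> t)) (at t)" if "\<bar>t - t0\<bar> < d" for t
  proof -
    have "((\<lambda>t. \<gamma> t $ 1 + \<gamma> t $ 2) has_vector_derivative (\<sigma> *\<^sub>R F (\<gamma> t)) $ 1 + (\<sigma> *\<^sub>R F (\<gamma> t)) $ 2) (at t)"
      by (intro derivative_intros has_vector_derivative_nth) (use \<gamma>[OF that] in auto)
    then show ?thesis by (simp add: P_def[abs_def] A_def distrib_left)
  qed
  have Q': "(Q has_vector_derivative \<sigma> * B (\<gamma> t)) (at t)" if "\<bar>t - t0\<bar> < d" for t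
  proof -
    have "((\<lambda>t. \<gamma> t $ 1 - \<gamma> t $ 2) has_vector_derivative (\<sigma> *\<^sub>R F (\<gamma> t)) $ 1 - (\<sigma> *\<^sub>R F (\<gamma> t)) $ 2) (at t)"
      by (intro derivative_intros has_vector_derivative_nth) (use \<gamma>[OF that] in auto)
    then show ?thesis by (simp add: Q_def[abs_def] B_def right_diff_distrib)
  qed
  have "isCont P t0" using P'[of t0] d has_vector_derivative_continuous by auto
  then obtain d1 where d1: "d1 > 0" "\<And>t. \<bar>t - t0\<bar> < d1 \<Longrightarrow> \<bar>P t - P t0\<bar> < min (w $ 1) (w $ 2)"
    using w0 unfolding continuous_at_eps_delta dist_real_def by (metis min_less_iff_conj)
  \<comment> \<open>Halving puts the closed interval of radius \<open>d'\<close> inside both open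
    neighbourhoods.\<close>
  define d' where "d' = min d d1 / 2"
  have d': "d' > 0" "d' < d" "d' < d1" using d d1 by (auto simp: d'_def)
  have near: "\<bar>\<rho>\<bar> < P t" "\<bar>Q t\<bar> \<le> P t" "0 < P t" "P t < R" if "\<bar>t - t0\<bar> \<le> d'" for t
  proof -
    have "\<bar>P t - P t0\<bar> < min (w $ 1) (w $ 2)" using d1(2)[of t] that d' by auto
    then show "\<bar>\<rho>\<bar> < P t" using Pt0 by (auto simp: \<rho>_def)
    show "\<bar>Q t\<bar> \<le> P t" "0 < P t" "P t < R" using \<gamma>[of t] that d' by (auto simp: P_def Q_def)
  qed
  have Q: "Q t - Phi \<rho> (P t) = 0" if t: "\<bar>t - t0\<bar> < d'" for t
  proof (rule gronwall_zero[where f = "\<lambda>t. Q t - Phi \<rho> (P t)" and a = "t0 - d'" and b = "t0 + d'" and D = "{}"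
        and f' = "\<lambda>t. \<sigma> * B (\<gamma> t) - \<sigma> * A (\<gamma> t) * G (P t) (Phi \<rho> (P t))" and C = "(a + \<delta>) * C" and ?t0.0 = t0])
    have der: "((\<lambda>t. Q t - Phi \<rho> (P t)) has_vector_derivative
        \<sigma> * B (\<gamma> t) - \<sigma> * A (\<gamma> t) * G (P t) (Phi \<rho> (P t))) (at t)" if "\<bar>t - t0\<bar> \<le> d'" for t
    proof -
      have t: "\<bar>t - t0\<bar> < d" using that d' by auto
      from vector_diff_chain_at[OF P'[OF t], of "Phi \<rho>"] Phi_at[of \<rho> "P t"] near[OF that]
      have "((\<lambda>t. Phi \<rho> (P t)) has_vector_derivative \<sigma> * A (\<gamma> t) * G (P t) (Phi \<rho> (P t))) (at t)"
        by (simp add: o_def)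
      then show ?thesis by (intro derivative_intros Q'[OF t])
    qed
    then show "((\<lambda>t. Q t - Phi \<rho> (P t)) has_vector_derivative
        \<sigma> * B (\<gamma> t) - \<sigma> * A (\<gamma> t) * G (P t) (Phi \<rho> (P t))) (at t)" if "t \<in> {t0 - d'<..<t0 + d'} - {}" for t
      using that by (auto simp: abs_le_iff)
    show "continuous_on {t0 - d'..t0 + d'} (\<lambda>t. Q t - Phi \<rho> (P t))"
      by (rule continuous_on_vector_derivative, rule has_vector_derivative_at_within, rule der) auto
    fix t assume "t \<in> {t0 - d'<..<t0 + d'} - {}"
    then have n: "\<bar>\<rho>\<bar> < P t" "\<bar>Q t\<bar> \<le> P t" "0 < P t" "P t < R" using near[of t] by auto
    have Pn: "\<bar>Phi \<rho> (P t)\<bar> \<le> P t" using Phi_inside[of \<rho> "P t"] n by auto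
    have Ap: "0 < A (\<gamma> t)" unfolding \<gamma>pt by (rule A_pos) (use n in auto)
    have "\<sigma> * B (\<gamma> t) - \<sigma> * A (\<gamma> t) * G (P t) (Phi \<rho> (P t)) = \<sigma> * A (\<gamma> t) * (G (P t) (Q t) - G (P t) (Phi \<rho> (P t)))"
      using Ap unfolding G_def[of "P t" "Q t"] \<gamma>pt[symmetric] by (simp add: right_diff_distrib)
    then have "\<bar>\<sigma> * B (\<gamma> t) - \<sigma> * A (\<gamma> t) * G (P t) (Phi \<rho> (P t))\<bar> = A (\<gamma> t) * \<bar>G (P t) (Q t) - G (P t) (Phi \<rho> (P t))\<bar>"
      using Ap \<sigma> by (simp add: abs_mult)
    \<comment> \<open>The linear bound on \<open>A\<close> cancels the singular factor
      \<open>C / P t\<close>, leaving a constant.\<close>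
    also have "\<dots> \<le> ((a + \<delta>) * P t) * (C / P t * \<bar>Q t - Phi \<rho> (P t)\<bar>)"
    proof (rule mult_mono)
      show "A (\<gamma> t) \<le> (a + \<delta>) * P t" unfolding \<gamma>pt by (rule A_bounds) (use n in auto)
      show "\<bar>G (P t) (Q t) - G (P t) (Phi \<rho> (P t))\<bar> \<le> C / P t * \<bar>Q t - Phi \<rho> (P t)\<bar>"
        by (rule lip) (use n Pn in auto)
    qed (use n ab \<delta> in auto)
    also have "\<dots> = (a + \<delta>) * C * \<bar>Q t - Phi \<rho> (P t)\<bar>" using n by simp
    finally show "norm (\<sigma> * B (\<gamma> t) - \<sigma> * A (\<gamma> t) * G (P t) (Phi \<rho> (P t)))
        \<le> (a + \<delta>) * C * norm (Q t - Phi \<rho> (P t))" by simp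
  next
    have "k w = pt (P t0) (Phi \<rho> (P t0))" using w0 by (auto simp: k_def Pt0 \<rho>_def)
    then show "Q t0 - Phi \<rho> (P t0) = 0" using \<gamma>pt[of t0] t0 by (auto simp: vec2_eq_iff field_simps)
  qed (use t d' in \<open>auto simp: abs_less_iff\<close>)
  show ?thesis
  proof (intro exI[of _ d'] conjI allI impI)
    fix t assume t: "\<bar>t - t0\<bar> < d'"
    define s where "s = (\<gamma> t $ 1 + \<gamma> t $ 2 - (w $ 1 + w $ 2)) / 2"
    have s: "2 * s = P t - P t0" using Pt0 by (simp add: s_def P_def)
    moreover have "\<bar>P t - P t0\<bar> < min (w $ 1) (w $ 2)" using d1(2)[of t] t d' by auto
    ultimately have ws: "0 < w $ 1 + s" "0 < w $ 2 + s" by auto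
    have "k (w + s *\<^sub>R vec2 1 1) = pt (P t) (Phi \<rho> (P t))"
      using k_line[OF ws] s Pt0 by (simp add: \<rho>_def)
    also have "\<dots> = \<gamma> t" using \<gamma>pt[of t] Q[OF t] by simp
    finally show "let s = (\<gamma> t $ 1 + \<gamma> t $ 2 - (w $ 1 + w $ 2)) / 2
        in 0 < w $ 1 + s \<and> 0 < w $ 2 + s \<and> \<gamma> t = k (w + s *\<^sub>R vec2 1 1)"
      unfolding Let_def s_def[symmetric] using ws by simp
  qed (rule d')
qed

end

section \<open>Normalised sectors\<close>

text \<open>Strict differentiability at 0, with \<open>M\<close> as the linear part. It is what the
  construction takes from C1 regularity, and it survives linear changes of coordinates.\<close>

definition strict_at0 :: "vfield \<Rightarrow> vfield \<Rightarrow> bool" where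
  "strict_at0 F M \<longleftrightarrow> F 0 = 0 \<and> M 0 = 0 \<and>
    (\<forall>\<epsilon>>0. \<exists>r>0. \<forall>p q. norm p < r \<longrightarrow> norm q < r \<longrightarrow> norm (F p - F q - (M p - M q)) \<le> \<epsilon> * norm (p - q))"

lemma strict_at0_conj:
  fixes F M L K :: vfield
  assumes F: "strict_at0 F M" and L: "bounded_linear L" and K: "bounded_linear K"
  shows "strict_at0 (\<lambda>q. L (F (K q))) (\<lambda>q. L (M (K q)))"
proof -
  interpret L: bounded_linear L by (rule L)
  interpret K: bounded_linear K by (rule K)
  obtain l where l: "l > 0" "\<And>x. norm (L x) \<le> norm x * l" using L.pos_bounded by auto
  obtain k where k: "k > 0" "\<And>x. norm (K x) \<le> norm x * k" using K.pos_bounded by auto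
  show ?thesis unfolding strict_at0_def
  proof (intro conjI allI impI)
    fix \<epsilon> :: real assume \<epsilon>: "\<epsilon> > 0"
    then have "\<epsilon> / (l * k) > 0" using l k by simp
    then obtain r where r: "r > 0" and le: "\<And>p q. norm p < r \<Longrightarrow> norm q < r \<Longrightarrow>
        norm (F p - F q - (M p - M q)) \<le> \<epsilon> / (l * k) * norm (p - q)"
      using F unfolding strict_at0_def by meson
    show "\<exists>r>0. \<forall>p q. norm p < r \<longrightarrow> norm q < r \<longrightarrow>
        norm (L (F (K p)) - L (F (K q)) - (L (M (K p)) - L (M (K q)))) \<le> \<epsilon> * norm (p - q)"
    proof (intro exI[of _ "r / k"] conjI allI impI)
      show "r / k > 0" using r k by simp
      fix p q :: "real^2" assume pq: "norm p < r / k" "norm q < r / k"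
      have Kr: "norm (K p) < r" "norm (K q) < r"
        using k(2)[of p] k(2)[of q] pq k(1) by (simp_all add: field_simps)
      have "norm (L (F (K p)) - L (F (K q)) - (L (M (K p)) - L (M (K q))))
          = norm (L (F (K p) - F (K q) - (M (K p) - M (K q))))" by (simp add: L.diff)
      also have "\<dots> \<le> (\<epsilon> / (l * k) * norm (K p - K q)) * l"
        by (rule order_trans[OF l(2)]) (intro mult_right_mono le Kr less_imp_le[OF l(1)])
      also have "\<dots> \<le> (\<epsilon> / (l * k) * (norm (p - q) * k)) * l"
        using k(2)[of "p - q"] \<epsilon> l k by (intro mult_right_mono mult_left_mono) (auto simp: K.diff)
      also have "\<dots> = \<epsilon> * norm (p - q)" using l k by simp
      finally show "norm (L (F (K p)) - L (F (K q)) - (L (M (K p)) - L (M (K q)))) \<le> \<epsilon> * norm (p - q)" .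
    qed
  qed (use F in \<open>simp_all add: strict_at0_def L.zero K.zero\<close>)
qed

lemma strict_at0_lipschitz:
  assumes F: "strict_at0 F M" and M: "bounded_linear M"
  shows "\<exists>r>0. \<exists>C. C-lipschitz_on (ball 0 r) F"
proof -
  obtain m where m: "m > 0" "\<And>x. norm (M x) \<le> norm x * m" using bounded_linear.pos_bounded[OF M] by auto
  obtain r where r: "r > 0" and le: "\<And>p q. norm p < r \<Longrightarrow> norm q < r \<Longrightarrow>
      norm (F p - F q - (M p - M q)) \<le> 1 * norm (p - q)"
    using F unfolding strict_at0_def by (meson zero_less_one)
  have "(1 + m)-lipschitz_on (ball 0 r) F"
  proof (rule lipschitz_onI)
    fix p q :: "real^2" assume "p \<in> ball 0 r" "q \<in> ball 0 r"
    then have "norm (F p - F q - (M p - M q)) \<le> 1 * norm (p - q)" by (intro le) auto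
    moreover have "norm (F p - F q) \<le> norm (F p - F q - (M p - M q)) + norm (M p - M q)"
      using norm_triangle_ineq[of "F p - F q - (M p - M q)" "M p - M q"] by simp
    moreover have "norm (M p - M q) \<le> norm (p - q) * m"
      using m(2)[of "p - q"] by (simp add: linear_diff[OF bounded_linear.linear[OF M]])
    ultimately show "dist (F p) (F q) \<le> (1 + m) * dist p q" by (simp add: dist_norm algebra_simps)
  qed (use m in simp)
  then show ?thesis using r by blast
qed

text \<open>Mean value inequality for \<open>X\<close> minus its derivative at 0, on a ball where
  the derivative differs from that at 0 by at most \<open>\<epsilon>\<close>.\<close>

lemma C1_strict_at0:
  assumes U: "open U" "0 \<in> U" and X: "C1_field U X" "X 0 = 0"
  shows "strict_at0 X ((*v) (jac0 X))"
proof -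
  obtain X' where X': "\<And>p. p \<in> U \<Longrightarrow> (X has_derivative blinfun_apply (X' p)) (at p)" and cont: "continuous_on U X'"
    using X(1) unfolding C1_field_def by blast
  have J: "jac0 X *v h = X' 0 h" for h
  proof -
    have "X differentiable (at 0)" using X'[OF U(2)] unfolding differentiable_def by blast
    then have "(X has_derivative ((*v) (jac0 X))) (at 0)" by (simp add: jacobian_works)
    from has_derivative_unique[OF this X'[OF U(2)]] show ?thesis by simp
  qed
  show ?thesis unfolding strict_at0_def J
  proof (intro conjI allI impI)
    fix \<epsilon> :: real assume \<epsilon>: "\<epsilon> > 0"
    obtain r1 where r1: "r1 > 0" "ball 0 r1 \<subseteq> U" using U open_contains_ball by blast
    obtain r2 where r2: "r2 > 0" "\<And>p. p \<in> U \<Longrightarrow> dist p 0 < r2 \<Longrightarrow> dist (X' p) (X' 0) < \<epsilon>"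
      using cont[unfolded continuous_on_iff, rule_format, OF U(2) \<epsilon>] by blast
    define r where "r = min r1 r2"
    show "\<exists>r>0. \<forall>p q. norm p < r \<longrightarrow> norm q < r \<longrightarrow> norm (X p - X q - (X' 0 p - X' 0 q)) \<le> \<epsilon> * norm (p - q)"
    proof (intro exI[of _ r] conjI allI impI)
      show "r > 0" using r1 r2 by (simp add: r_def)
      fix p q :: "real^2" assume pq: "norm p < r" "norm q < r"
      have "norm ((X p - X' 0 p) - (X q - X' 0 q)) \<le> \<epsilon> * norm (p - q)"
      proof (rule differentiable_bound[where f = "\<lambda>p. X p - X' 0 p" and f' = "\<lambda>p. blinfun_apply (X' p - X' 0)" and S = "ball 0 r"])
        fix x :: "real^2" assume x: "x \<in> ball 0 r"
        then have xU: "x \<in> U" using r1 by (auto simp: r_def)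
        have "((\<lambda>p. X p - X' 0 p) has_derivative (\<lambda>h. X' x h - X' 0 h)) (at x within ball 0 r)"
          by (rule has_derivative_diff[OF has_derivative_at_withinI[OF X'[OF xU]]
                bounded_linear_imp_has_derivative[OF blinfun.bounded_linear_right]])
        moreover have "(\<lambda>h. X' x h - X' 0 h) = blinfun_apply (X' x - X' 0)"
          by (simp add: fun_eq_iff blinfun.diff_left)
        ultimately show "((\<lambda>p. X p - X' 0 p) has_derivative blinfun_apply (X' x - X' 0)) (at x within ball 0 r)"
          by simp
        have "norm (X' x - X' 0) < \<epsilon>" using r2(2)[OF xU] x by (simp add: r_def dist_norm)
        then show "onorm (blinfun_apply (X' x - X' 0)) \<le> \<epsilon>" by (simp add: norm_blinfun.rep_eq)
      qed (use pq in auto)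
      then show "norm (X p - X q - (X' 0 p - X' 0 q)) \<le> \<epsilon> * norm (p - q)" by (simp add: algebra_simps)
    qed
  qed (simp_all add: X)
qed

text \<open>\<open>M\<close> has eigenvalue \<open>n + m\<close> along \<open>(1, 1)\<close> and
  \<open>m - n\<close> along \<open>(1, -1)\<close>; the condition on \<open>m\<close> and
  \<open>n\<close> makes it a saddle with these two directions.\<close>

lemma quadrant_ex:
  assumes F: "strict_at0 F M" and M: "\<And>q. M q = vec2 (m * q $ 1 + n * q $ 2) (n * q $ 1 + m * q $ 2)"
    and mn: "\<bar>m\<bar> < n"
  shows "\<exists>\<delta> R0. 0 < R0 \<and> (\<forall>R. 0 < R \<longrightarrow> R \<le> R0 \<longrightarrow> quadrant F (n + m) (n - m) \<delta> R)"
proof -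
  have "bounded_linear M"
    unfolding linear_conv_bounded_linear[symmetric]
    by (rule linearI) (auto simp: M vec2_eq_iff algebra_simps)
  then obtain r1 C where r1: "r1 > 0" "C-lipschitz_on (ball 0 r1) F"
    using strict_at0_lipschitz[OF F] by blast
  define \<delta> where "\<delta> = min (n + m) (n - m) / 4"
  have \<delta>: "0 < \<delta>" "4 * \<delta> \<le> n + m" "4 * \<delta> \<le> n - m" using mn by (auto simp: \<delta>_def)
  \<comment> \<open>Half of \<open>\<delta>\<close>, because the absolute components of the
    remainder sum to at most twice its norm.\<close>
  then obtain r2 where r2: "r2 > 0" and le: "\<And>p q. norm p < r2 \<Longrightarrow> norm q < r2 \<Longrightarrow>
      norm (F p - F q - (M p - M q)) \<le> \<delta> / 2 * norm (p - q)"
    using F unfolding strict_at0_def by (meson half_gt_zero)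
  define R0 where "R0 = min r1 r2 / 2"
  have R0: "0 < R0" "R0 < r1" "R0 < r2" using r1 r2 by (auto simp: R0_def)
  have small: "norm p \<le> R" if "0 \<le> p $ 1" "0 \<le> p $ 2" "p $ 1 + p $ 2 \<le> R" for p :: "real^2" and R
    using norm_le_sum_abs[of p] that by auto
  show ?thesis
  proof (rule exI[of _ \<delta>], rule exI[of _ R0], intro conjI allI impI)
    fix R assume R: "0 < R" "R \<le> R0"
    show "quadrant F (n + m) (n - m) \<delta> R"
    proof
      show "continuous_on {p. 0 \<le> p $ 1 \<and> 0 \<le> p $ 2 \<and> p $ 1 + p $ 2 \<le> R} F"
        by (rule continuous_on_subset[OF lipschitz_on_continuous_on[OF r1(2)]])
          (use small R R0 in force)
      fix p q :: "real^2"
      assume p: "0 \<le> p $ 1" "0 \<le> p $ 2" "p $ 1 + p $ 2 \<le> R" and q: "0 \<le> q $ 1" "0 \<le> q $ 2" "q $ 1 + q $ 2 \<le> R"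
      define d where "d = F p - F q - (M p - M q)"
      have "norm d \<le> \<delta> / 2 * norm (p - q)"
        unfolding d_def by (rule le) (use small[OF p] small[OF q] R R0 in auto)
      then have d: "\<bar>d $ 1\<bar> + \<bar>d $ 2\<bar> \<le> \<delta> * norm (p - q)"
        using component_le_norm_cart[of d 1] component_le_norm_cart[of d 2] by simp
      have "(F p $ 1 + F p $ 2) - (F q $ 1 + F q $ 2) - (n + m) * (p $ 1 + p $ 2 - (q $ 1 + q $ 2)) = d $ 1 + d $ 2"
        by (simp add: d_def M algebra_simps)
      then show "\<bar>(F p $ 1 + F p $ 2) - (F q $ 1 + F q $ 2) - (n + m) * (p $ 1 + p $ 2 - (q $ 1 + q $ 2))\<bar> \<le> \<delta> * norm (p - q)"
        using d by linarith
      have "(F p $ 1 - F p $ 2) - (F q $ 1 - F q $ 2) + (n - m) * (p $ 1 - p $ 2 - (q $ 1 - q $ 2)) = d $ 1 - d $ 2"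
        by (simp add: d_def M algebra_simps)
      then show "\<bar>(F p $ 1 - F p $ 2) - (F q $ 1 - F q $ 2) + (n - m) * (p $ 1 - p $ 2 - (q $ 1 - q $ 2))\<bar> \<le> \<delta> * norm (p - q)"
        using d by linarith
    qed (use \<delta> R F in \<open>auto simp: strict_at0_def\<close>)
  qed (rule R0)
qed

text \<open>A normalisation preserving the switching line (reflection \<open>e\<close>, shear
  \<open>s\<close>, vertical scaling \<open>\<kappa>\<close>), followed by the reflection that takes
  the quadrant of signs \<open>e1\<close>, \<open>e2\<close> to the positive one.\<close>

definition to_quad :: "real \<Rightarrow> real \<Rightarrow> real \<Rightarrow> real \<Rightarrow> real \<Rightarrow> real^2 \<Rightarrow> real^2" where
  "to_quad e s \<kappa> e1 e2 p = vec2 (e1 * (e * p $ 1 + s * p $ 2)) (e2 * \<kappa> * p $ 2)"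

definition from_quad :: "real \<Rightarrow> real \<Rightarrow> real \<Rightarrow> real \<Rightarrow> real \<Rightarrow> real^2 \<Rightarrow> real^2" where
  "from_quad e s \<kappa> e1 e2 q = vec2 (e * (e1 * q $ 1 - s * e2 * q $ 2 / \<kappa>)) (e2 * q $ 2 / \<kappa>)"

lemma bounded_linear_quad: "bounded_linear (to_quad e s \<kappa> e1 e2)" "bounded_linear (from_quad e s \<kappa> e1 e2)"
  unfolding linear_conv_bounded_linear[symmetric]
  by (auto intro!: linearI simp: to_quad_def from_quad_def vec2_eq_iff algebra_simps add_divide_distrib)

lemma sign_mult:
  fixes e :: real assumes "\<bar>e\<bar> = 1" shows "e * e = 1" "e * (e * x) = x"
  using assms by (auto simp: abs_if split: if_splits)

lemma from_to_quad:
  assumes "\<bar>e\<bar> = 1" "\<bar>e1\<bar> = 1" "\<bar>e2\<bar> = 1" "\<kappa> \<noteq> 0"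
  shows "from_quad e s \<kappa> e1 e2 (to_quad e s \<kappa> e1 e2 p) = p" "to_quad e s \<kappa> e1 e2 (from_quad e s \<kappa> e1 e2 p) = p"
proof -
  have e: "e * (e * x) = x" "e1 * (e1 * x) = x" "e2 * (e2 * x) = x" for x using assms by (simp_all add: sign_mult)
  have \<kappa>: "\<kappa> * (x / \<kappa>) = x" "x * \<kappa> * y / \<kappa> = x * y" for x y using assms by simp_all
  show "from_quad e s \<kappa> e1 e2 (to_quad e s \<kappa> e1 e2 p) = p" "to_quad e s \<kappa> e1 e2 (from_quad e s \<kappa> e1 e2 p) = p"
    using assms(4) by (simp_all add: from_quad_def to_quad_def vec2_eq_iff e \<kappa> mult.assoc right_diff_distrib)
qed

text \<open>When \<open>e1\<close> and \<open>e2\<close> differ, the reflection makes the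
  off-diagonal entries of the linear part negative. The factor \<open>e1 * e2\<close> reverses time
  and restores their sign, at the price of replacing \<open>m\<close> by \<open>- m\<close>, which
  \<open>\<bar>m\<bar> < n\<close> tolerates.\<close>

definition pull :: "real \<Rightarrow> real \<Rightarrow> real \<Rightarrow> real \<Rightarrow> real \<Rightarrow> vfield \<Rightarrow> vfield" where
  "pull e s \<kappa> e1 e2 X q = (e1 * e2) *\<^sub>R to_quad e s \<kappa> e1 e2 (X (from_quad e s \<kappa> e1 e2 q))"

text \<open>A sector is a half-plane quadrant in the normalising coordinates; \<open>e1\<close>, \<open>e2\<close> are the signs of the
  quadrant. Straightened orbits in it move in the direction \<open>(e2, e1)\<close>.\<close>

locale sector_map =
  fixes X :: vfield and e s \<kappa> e1 e2 R :: real and K :: "real^2 \<Rightarrow> real^2" and g :: "real^2 \<Rightarrow> real" and S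
  defines "S \<equiv> {z :: real^2. 0 \<le> e1 * z $ 1 \<and> 0 \<le> e2 * z $ 2 \<and> \<bar>z $ 1\<bar> + \<bar>z $ 2\<bar> < R}"
  assumes R: "R > 0" and e: "\<bar>e\<bar> = 1" and e1: "\<bar>e1\<bar> = 1" and e2: "\<bar>e2\<bar> = 1" and \<kappa>: "\<kappa> > 0"
    and cont: "continuous_on S K" and inj: "inj_on K S"
    and sgn2: "z \<in> S \<Longrightarrow> 0 \<le> e2 * K z $ 2 \<and> (K z $ 2 = 0 \<longleftrightarrow> z $ 2 = 0)"
    and sgn1: "z \<in> S \<Longrightarrow> 0 \<le> e1 * (e * K z $ 1 + s * K z $ 2) \<and> (e * K z $ 1 + s * K z $ 2 = 0 \<longleftrightarrow> z $ 1 = 0)"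
    and axis2: "z \<in> S \<Longrightarrow> z $ 2 = 0 \<Longrightarrow> K z = vec2 (e * z $ 1) 0"
    and axis1: "z \<in> S \<Longrightarrow> z $ 1 = 0 \<Longrightarrow> K z = vec2 (- e * s * z $ 2 / \<kappa>) (z $ 2 / \<kappa>)"
    and bound: "z \<in> S \<Longrightarrow> norm (K z) \<le> (1 + \<bar>s\<bar> / \<kappa> + 1 / \<kappa>) * (\<bar>z $ 1\<bar> + \<bar>z $ 2\<bar>)"
    and g_cont: "continuous_on (S - {0}) g" and g_pos: "z \<in> S \<Longrightarrow> z \<noteq> 0 \<Longrightarrow> 0 < g z"
    and flow: "z \<in> S \<Longrightarrow> z $ 1 \<noteq> 0 \<Longrightarrow> z $ 2 \<noteq> 0 \<Longrightarrow>
        ((\<lambda>t. K (z + t *\<^sub>R vec2 e2 e1)) has_vector_derivative (1 / g z) *\<^sub>R X (K z)) (at 0)"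
    and unique: "\<lbrakk>z \<in> S; z $ 1 \<noteq> 0; z $ 2 \<noteq> 0; 0 < d; \<gamma> t0 = K z;
        \<And>t. \<bar>t - t0\<bar> < d \<Longrightarrow> (\<gamma> has_vector_derivative X (\<gamma> t)) (at t)\<rbrakk> \<Longrightarrow>
        \<exists>d'>0. \<exists>\<theta>. \<theta> t0 = 0 \<and> (\<theta> has_real_derivative g z) (at t0) \<and>
          (\<forall>t. \<bar>t - t0\<bar> < d' \<longrightarrow> z + \<theta> t *\<^sub>R vec2 e2 e1 \<in> S \<and> \<gamma> t = K (z + \<theta> t *\<^sub>R vec2 e2 e1))"
    and cross2: "z \<in> S \<Longrightarrow> z $ 2 = 0 \<Longrightarrow> z \<noteq> 0 \<Longrightarrow> 0 < e1 * X (K z) $ 2"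
    and cross1: "z \<in> S \<Longrightarrow> z $ 1 = 0 \<Longrightarrow> z \<noteq> 0 \<Longrightarrow> 0 < e2 * (e * X (K z) $ 1 + s * X (K z) $ 2)"

lemma sector_map_ex:
  fixes X :: vfield and e s \<kappa> e1 e2 a b \<delta> R :: real
  assumes e: "\<bar>e\<bar> = 1" and e1: "\<bar>e1\<bar> = 1" and e2: "\<bar>e2\<bar> = 1" and \<kappa>: "\<kappa> > 0"
    and q: "quadrant (pull e s \<kappa> e1 e2 X) a b \<delta> R"
  shows "\<exists>K g. sector_map X e s \<kappa> e1 e2 R K g"
proof -
  define F where "F = pull e s \<kappa> e1 e2 X"
  interpret quadrant F a b \<delta> R unfolding F_def by (rule q)
  define L where "L = to_quad e s \<kappa> e1 e2"
  define Li where "Li = from_quad e s \<kappa> e1 e2"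
  have bl: "bounded_linear L" "bounded_linear Li" unfolding L_def Li_def by (rule bounded_linear_quad)+
  have LLi: "L (Li p) = p" "Li (L p) = p" for p
    using from_to_quad[OF e e1 e2] \<kappa> by (auto simp: L_def Li_def)
  define \<epsilon> where "\<epsilon> = e1 * e2"
  have \<epsilon>: "\<bar>\<epsilon>\<bar> = 1" "\<epsilon> * \<epsilon> = 1" using e1 e2 by (auto simp: \<epsilon>_def abs_mult sign_mult algebra_simps)
  have FL: "F q = \<epsilon> *\<^sub>R L (X (Li q))" for q by (simp add: F_def pull_def L_def Li_def \<epsilon>_def)
  have XF: "L (X p) = \<epsilon> *\<^sub>R F (L p)" for p using \<epsilon> by (simp add: sign_mult FL LLi)
  define \<sigma> where "\<sigma> z = vec2 (e1 * z $ 1) (e2 * z $ 2)" for z :: "real^2"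
  define S where "S = {z :: real^2. 0 \<le> e1 * z $ 1 \<and> 0 \<le> e2 * z $ 2 \<and> \<bar>z $ 1\<bar> + \<bar>z $ 2\<bar> < R}"
  have nz: "e \<noteq> 0" "e1 \<noteq> 0" "e2 \<noteq> 0" using e e1 e2 by auto
  have abs1: "\<bar>z $ 1\<bar> = e1 * z $ 1" "\<bar>z $ 2\<bar> = e2 * z $ 2" if "0 \<le> e1 * z $ 1" "0 \<le> e2 * z $ 2" for z :: "real^2"
    using that e1 e2 by (auto simp: abs_if split: if_splits)
  have T_lt: "w $ 1 + w $ 2 < R" if "w \<in> T" for w using that by (simp add: T_def)
  have \<sigma>T: "\<sigma> z \<in> T" if "z \<in> S" for z
    using that abs1[of z] by (auto simp: S_def T_def \<sigma>_def)
  have TS: "z \<in> S" if "\<sigma> z \<in> T" for z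
    using that abs1[of z] by (auto simp: S_def T_def \<sigma>_def)
  have inj\<sigma>: "\<sigma> z = \<sigma> z' \<Longrightarrow> z = z'" for z z' using nz by (auto simp: \<sigma>_def vec2_eq_iff)
  have \<sigma>0: "\<sigma> z = 0 \<longleftrightarrow> z = 0" for z using nz by (auto simp: \<sigma>_def vec2_eq_iff)
  have cont\<sigma>: "continuous_on A \<sigma>" for A unfolding \<sigma>_def by (intro continuous_intros)
  define K where "K z = Li (k (\<sigma> z))" for z
  \<comment> \<open>The derivative of \<open>k\<close> along the diagonal carries the factor
    \<open>2 / A\<close>; its reciprocal is the speed in the straightened picture.\<close>
  define g where "g z = A (k (\<sigma> z)) / 2" for z
  have LK: "L (K z) = k (\<sigma> z)" for z by (simp add: K_def LLi)
  have contk\<sigma>: "continuous_on S (\<lambda>z. k (\<sigma> z))"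
    by (rule continuous_on_compose2[OF cont_k cont\<sigma>]) (use \<sigma>T in auto)
  have \<sigma>line: "\<sigma> (z + t *\<^sub>R vec2 e2 e1) = \<sigma> z + (\<epsilon> * t) *\<^sub>R vec2 1 1" for z t
    by (simp add: \<sigma>_def \<epsilon>_def vec2_eq_iff algebra_simps)
  have "sector_map X e s \<kappa> e1 e2 R K g"
  proof (unfold_locales, fold S_def)
    show "continuous_on S K" unfolding K_def
      by (rule bounded_linear.continuous_on[OF bl(2) contk\<sigma>])
    show "inj_on K S"
    proof (rule inj_onI)
      fix z z' assume z: "z \<in> S" "z' \<in> S" and "K z = K z'"
      then have "k (\<sigma> z) = k (\<sigma> z')" using LK by metis
      then show "z = z'" using inj_k \<sigma>T[OF z(1)] \<sigma>T[OF z(2)] inj\<sigma> by (auto dest: inj_onD)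
    qed
    show "continuous_on (S - {0}) g" unfolding g_def A_def
    proof -
      have "continuous_on S (\<lambda>z. F (k (\<sigma> z)))"
        by (rule continuous_on_compose2[OF contF contk\<sigma>])
          (clarsimp simp: k_nonneg[OF \<sigma>T] k_sum[OF \<sigma>T] less_imp_le[OF T_lt[OF \<sigma>T]])
      then have "continuous_on (S - {0}) (\<lambda>z. F (k (\<sigma> z)))" by (rule continuous_on_subset) auto
      then show "continuous_on (S - {0}) (\<lambda>z. (F (k (\<sigma> z)) $ 1 + F (k (\<sigma> z)) $ 2) / 2)"
        by (intro continuous_intros) auto
    qed
  next
    fix z assume z: "z \<in> S"
    note kn = k_nonneg[OF \<sigma>T[OF z], unfolded LK[symmetric]]
    have LK': "L (K z) = vec2 (e1 * (e * K z $ 1 + s * K z $ 2)) (e2 * \<kappa> * K z $ 2)" by (simp add: L_def to_quad_def)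
    show "0 \<le> e2 * K z $ 2 \<and> (K z $ 2 = 0 \<longleftrightarrow> z $ 2 = 0)"
    proof -
      have cancel: "0 \<le> \<kappa> * y \<longleftrightarrow> 0 \<le> y" for y using \<kappa> by (simp add: zero_le_mult_iff)
      have "L (K z) $ 2 = \<kappa> * (e2 * K z $ 2)" by (simp add: LK')
      then show ?thesis using kn(2,4) \<kappa> nz cancel by (simp add: \<sigma>_def)
    qed
    show "0 \<le> e1 * (e * K z $ 1 + s * K z $ 2) \<and> (e * K z $ 1 + s * K z $ 2 = 0 \<longleftrightarrow> z $ 1 = 0)"
      using kn(1,3) nz by (auto simp: LK' \<sigma>_def)
    have ks: "k (\<sigma> z) $ 1 + k (\<sigma> z) $ 2 = e1 * z $ 1 + e2 * z $ 2"
      using k_sum[OF \<sigma>T[OF z]] by (simp add: \<sigma>_def)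
    note kn' = k_nonneg[OF \<sigma>T[OF z]]
    show "norm (K z) \<le> (1 + \<bar>s\<bar> / \<kappa> + 1 / \<kappa>) * (\<bar>z $ 1\<bar> + \<bar>z $ 2\<bar>)"
    proof -
      define u v where "u = k (\<sigma> z) $ 1" and "v = k (\<sigma> z) $ 2"
      have uv: "0 \<le> u" "0 \<le> v" using kn' by (auto simp: u_def v_def)
      have sum: "u + v = \<bar>z $ 1\<bar> + \<bar>z $ 2\<bar>"
        using ks abs1[of z] z by (simp add: u_def v_def S_def)
      have "K z = vec2 (e * (e1 * u - s * e2 * v / \<kappa>)) (e2 * v / \<kappa>)"
        by (simp add: K_def Li_def from_quad_def u_def v_def)
      then have "norm (K z) \<le> \<bar>e * (e1 * u - s * e2 * v / \<kappa>)\<bar> + \<bar>e2 * v / \<kappa>\<bar>"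
        using norm_le_sum_abs[of "K z"] by simp
      also have "\<dots> = \<bar>e1 * u - s * e2 * v / \<kappa>\<bar> + v / \<kappa>"
        using e e2 \<kappa> uv by (simp add: abs_mult)
      also have "\<dots> \<le> u + \<bar>s\<bar> / \<kappa> * v + v / \<kappa>"
        using abs_triangle_ineq4[of "e1 * u" "s * e2 * v / \<kappa>"] e1 e2 \<kappa> uv by (simp add: abs_mult)
      also have "u + \<bar>s\<bar> / \<kappa> * v + v / \<kappa> \<le> (1 + \<bar>s\<bar> / \<kappa> + 1 / \<kappa>) * (u + v)"
      proof -
        \<comment> \<open>The surplus \<open>v + (x + y) * u\<close> is nonnegative for the values
          inserted below.\<close>
        have "(1 + x + y) * (u + v) = (u + x * v + y * v) + (v + (x + y) * u)" for x y :: real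
          by (simp add: algebra_simps)
        from this[of "\<bar>s\<bar> / \<kappa>" "1 / \<kappa>"] uv \<kappa> show ?thesis by simp
      qed
      finally show ?thesis unfolding sum .
    qed
    {
      assume z2: "z $ 2 = 0"
      then have k2: "k (\<sigma> z) = vec2 (e1 * z $ 1) 0"
      proof -
        have "k (\<sigma> z) $ 2 = 0" using kn'(4) z2 by (simp add: \<sigma>_def)
        then show ?thesis using ks z2 by (simp add: vec2_eq_iff)
      qed
      then show Kz: "K z = vec2 (e * z $ 1) 0"
        using e1 by (simp add: sign_mult K_def Li_def from_quad_def vec2_eq_iff)
      assume "z \<noteq> 0"
      then have "z $ 1 \<noteq> 0" using z2 by (simp add: vec2_eq_iff)
      then have "0 < e1 * z $ 1" "e1 * z $ 1 \<le> R" using z nz z2 abs1(1)[of z] by (simp_all add: S_def less_le)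
      then have "0 < F (k (\<sigma> z)) $ 2" using F_axis_pos(1)[of "e1 * z $ 1"] k2 by simp
      moreover have "F (k (\<sigma> z)) $ 2 = \<epsilon> * (e2 * \<kappa> * X (K z) $ 2)"
        by (simp add: FL K_def[symmetric] L_def to_quad_def)
      moreover have "\<epsilon> * (e2 * \<kappa> * X (K z) $ 2) = \<kappa> * (e1 * X (K z) $ 2)"
        using e2 by (simp add: sign_mult \<epsilon>_def algebra_simps)
      moreover have "0 < \<kappa> * y \<longleftrightarrow> 0 < y" for y using \<kappa> by (simp add: zero_less_mult_iff)
      ultimately show "0 < e1 * X (K z) $ 2" by metis
    }
    {
      assume z1: "z $ 1 = 0"
      then have k1: "k (\<sigma> z) = vec2 0 (e2 * z $ 2)"
      proof -
        have "k (\<sigma> z) $ 1 = 0" using kn'(3) z1 by (simp add: \<sigma>_def)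
        then show ?thesis using ks z1 by (simp add: vec2_eq_iff)
      qed
      then show Kz: "K z = vec2 (- e * s * z $ 2 / \<kappa>) (z $ 2 / \<kappa>)"
        using e2 by (simp add: sign_mult K_def Li_def from_quad_def vec2_eq_iff mult.assoc)
      assume "z \<noteq> 0"
      then have "z $ 2 \<noteq> 0" using z1 by (simp add: vec2_eq_iff)
      then have "0 < e2 * z $ 2" "e2 * z $ 2 \<le> R" using z nz z1 abs1(2)[of z] by (simp_all add: S_def less_le)
      then have "0 < F (k (\<sigma> z)) $ 1" using F_axis_pos(2)[of "e2 * z $ 2"] k1 by simp
      moreover have "F (k (\<sigma> z)) $ 1 = \<epsilon> * (e1 * (e * X (K z) $ 1 + s * X (K z) $ 2))"
        by (simp add: FL K_def[symmetric] L_def to_quad_def)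
      moreover have "\<epsilon> * (e1 * (e * X (K z) $ 1 + s * X (K z) $ 2)) = e2 * (e * X (K z) $ 1 + s * X (K z) $ 2)"
        using e1 by (simp add: sign_mult \<epsilon>_def algebra_simps)
      ultimately show "0 < e2 * (e * X (K z) $ 1 + s * X (K z) $ 2)" by simp
    }
    show "0 < g z" if "z \<noteq> 0" using A_pos_k[OF \<sigma>T[OF z]] that \<sigma>0 by (simp add: g_def)
    assume z12: "z $ 1 \<noteq> 0" "z $ 2 \<noteq> 0"
    have \<sigma>pos: "0 < \<sigma> z $ 1" "0 < \<sigma> z $ 2" using z z12 nz by (auto simp: S_def \<sigma>_def less_le)
    have "((\<lambda>t. \<epsilon> * t) has_vector_derivative \<epsilon>) (at 0)" by (auto intro!: derivative_eq_intros)
    moreover have "((\<lambda>t. k (\<sigma> z + t *\<^sub>R vec2 1 1)) has_vector_derivative (2 / A (k (\<sigma> z))) *\<^sub>R F (k (\<sigma> z))) (at (\<epsilon> * 0))"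
      using k_has_derivative[OF \<sigma>T[OF z] \<sigma>pos] by simp
    ultimately have "((\<lambda>t. k (\<sigma> z + (\<epsilon> * t) *\<^sub>R vec2 1 1)) has_vector_derivative
        \<epsilon> *\<^sub>R (2 / A (k (\<sigma> z))) *\<^sub>R F (k (\<sigma> z))) (at 0)"
      by (rule vector_diff_chain_at[unfolded o_def])
    from bounded_linear.has_vector_derivative[OF bl(2) this]
    have "((\<lambda>t. K (z + t *\<^sub>R vec2 e2 e1)) has_vector_derivative Li (\<epsilon> *\<^sub>R (2 / A (k (\<sigma> z))) *\<^sub>R F (k (\<sigma> z)))) (at 0)"
      unfolding K_def \<sigma>line .
    also have "\<epsilon> *\<^sub>R (2 / A (k (\<sigma> z))) *\<^sub>R F (k (\<sigma> z)) = (1 / g z) *\<^sub>R L (X (K z))"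
    proof -
      have Fk: "F (k (\<sigma> z)) = \<epsilon> *\<^sub>R L (X (K z))" by (simp add: FL K_def)
      have "\<epsilon> * (x * \<epsilon>) = x" for x using \<epsilon>(2) by (metis mult.assoc mult.commute mult_1)
      then show ?thesis by (simp add: Fk g_def del: times_divide_eq_left times_divide_eq_right)
    qed
    also have "Li ((1 / g z) *\<^sub>R L (X (K z))) = (1 / g z) *\<^sub>R X (K z)"
      by (simp add: linear_scale[OF bounded_linear.linear[OF bl(2)]] LLi)
    finally show "((\<lambda>t. K (z + t *\<^sub>R vec2 e2 e1)) has_vector_derivative (1 / g z) *\<^sub>R X (K z)) (at 0)" .
    fix d t0 :: real and \<gamma> assume d: "0 < d" and \<gamma>0: "\<gamma> t0 = K z"
      and \<gamma>: "\<And>t. \<bar>t - t0\<bar> < d \<Longrightarrow> (\<gamma> has_vector_derivative X (\<gamma> t)) (at t)"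
    define \<eta> where "\<eta> t = L (\<gamma> t)" for t
    have \<eta>': "(\<eta> has_vector_derivative \<epsilon> *\<^sub>R F (\<eta> t)) (at t)" if "\<bar>t - t0\<bar> < d" for t
      using bounded_linear.has_vector_derivative[OF bl(1) \<gamma>[OF that]] by (simp add: \<eta>_def[abs_def] XF)
    have \<eta>0: "\<eta> t0 = k (\<sigma> z)" by (simp add: \<eta>_def \<gamma>0 LK)
    have iso: "isCont \<eta> t0" using \<eta>'[of t0] d has_vector_derivative_continuous by auto
    \<comment> \<open>\<open>k_unique\<close> wants the curve in the open quadrant; continuity
      provides this near \<open>t0\<close>.\<close>
    define W where "W = {p :: real^2. 0 < p $ 1 \<and> 0 < p $ 2 \<and> p $ 1 + p $ 2 < R}"
    have W1: "open W" unfolding W_def by (intro open_Collect_conj open_Collect_less continuous_intros)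
    have W2: "\<eta> t0 \<in> W"
      using kn' \<sigma>pos k_sum[OF \<sigma>T[OF z]] \<sigma>T[OF z] unfolding \<eta>0 W_def by (auto simp: T_def less_le)
    obtain B where B: "open B" "t0 \<in> B" "\<forall>t\<in>B. \<eta> t \<in> W"
      using iso[unfolded continuous_at_open, rule_format, OF conjI[OF W1 W2]] by (elim exE conjE)
    obtain d1 where d1': "d1 > 0" "\<forall>t. dist t t0 < d1 \<longrightarrow> t \<in> B"
      using B(1)[unfolded open_dist, rule_format, OF B(2)] by (elim exE conjE)
    have d1: "d1 > 0" "\<And>t. \<bar>t - t0\<bar> < d1 \<Longrightarrow> 0 < \<eta> t $ 1 \<and> 0 < \<eta> t $ 2 \<and> \<eta> t $ 1 + \<eta> t $ 2 < R"
      using d1' B(3) by (auto simp: W_def dist_real_def)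
    define st where "st t = (\<eta> t $ 1 + \<eta> t $ 2 - (\<sigma> z $ 1 + \<sigma> z $ 2)) / 2" for t
    have "\<exists>d'>0. \<forall>t. \<bar>t - t0\<bar> < d' \<longrightarrow>
      (let u = (\<eta> t $ 1 + \<eta> t $ 2 - (\<sigma> z $ 1 + \<sigma> z $ 2)) / 2
       in 0 < \<sigma> z $ 1 + u \<and> 0 < \<sigma> z $ 2 + u \<and> \<eta> t = k (\<sigma> z + u *\<^sub>R vec2 1 1))"
      by (rule k_unique[of \<epsilon> "min d d1" t0 \<eta> "\<sigma> z"]) (use \<epsilon>(1) d d1 \<eta>' \<sigma>T[OF z] \<eta>0 in auto)
    then obtain d2 where d2: "d2 > 0" "\<And>t. \<bar>t - t0\<bar> < d2 \<Longrightarrow>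
        0 < \<sigma> z $ 1 + st t \<and> 0 < \<sigma> z $ 2 + st t \<and> \<eta> t = k (\<sigma> z + st t *\<^sub>R vec2 1 1)"
      unfolding Let_def st_def by blast
    define d' where "d' = min d1 d2"
    have d': "d' > 0" "d' \<le> d1" "d' \<le> d2" using d1 d2 by (auto simp: d'_def)
    show "\<exists>d'>0. \<exists>\<theta>. \<theta> t0 = 0 \<and> (\<theta> has_real_derivative g z) (at t0) \<and>
        (\<forall>t. \<bar>t - t0\<bar> < d' \<longrightarrow> z + \<theta> t *\<^sub>R vec2 e2 e1 \<in> S \<and> \<gamma> t = K (z + \<theta> t *\<^sub>R vec2 e2 e1))"
    \<comment> \<open>A displacement \<open>st t\<close> along the diagonal corresponds to
      \<open>\<epsilon> * st t\<close> along \<open>(e2, e1)\<close>, since the reflection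
      \<open>\<sigma>\<close> takes that direction to \<open>\<epsilon>\<close> times the
      diagonal.\<close>
    proof (rule exI[of _ d'], intro conjI exI[of _ "\<lambda>t. \<epsilon> * st t"] allI impI)
      show "\<epsilon> * st t0 = 0" using k_sum[OF \<sigma>T[OF z]] by (simp add: st_def \<eta>0)
      have "((\<lambda>t. \<eta> t $ 1 + \<eta> t $ 2) has_vector_derivative (\<epsilon> *\<^sub>R F (\<eta> t0)) $ 1 + (\<epsilon> *\<^sub>R F (\<eta> t0)) $ 2) (at t0)"
        by (intro derivative_intros has_vector_derivative_nth \<eta>') (use d in auto)
      then have "((\<lambda>t. \<eta> t $ 1 + \<eta> t $ 2) has_real_derivative \<epsilon> * A (k (\<sigma> z))) (at t0)"
        by (simp add: has_real_derivative_iff_has_vector_derivative \<eta>0 A_def distrib_left)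
      then have "((\<lambda>t. \<epsilon> * st t) has_real_derivative \<epsilon> * ((\<epsilon> * A (k (\<sigma> z)) - 0) / 2)) (at t0)"
        unfolding st_def by (intro DERIV_cmult DERIV_cdivide DERIV_diff DERIV_const)
      then show "((\<lambda>t. \<epsilon> * st t) has_real_derivative g z) (at t0)"
        using \<epsilon>(2) by (simp add: g_def flip: mult.assoc)
      fix t assume t: "\<bar>t - t0\<bar> < d'"
      have l: "\<sigma> (z + (\<epsilon> * st t) *\<^sub>R vec2 e2 e1) = \<sigma> z + st t *\<^sub>R vec2 1 1"
        unfolding \<sigma>line using \<epsilon>(2) by (simp flip: mult.assoc)
      have t2: "0 < \<sigma> z $ 1 + st t \<and> 0 < \<sigma> z $ 2 + st t \<and> \<eta> t = k (\<sigma> z + st t *\<^sub>R vec2 1 1)"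
        using d2(2)[of t] t d' by auto
      have "\<eta> t $ 1 + \<eta> t $ 2 < R" using d1(2)[of t] t d' by auto
      moreover have "2 * st t = \<eta> t $ 1 + \<eta> t $ 2 - (\<sigma> z $ 1 + \<sigma> z $ 2)" by (simp add: st_def)
      ultimately have "2 * st t + (\<sigma> z $ 1 + \<sigma> z $ 2) < R" by linarith
      then show "z + (\<epsilon> * st t) *\<^sub>R vec2 e2 e1 \<in> S"
        using t2 by (intro TS) (simp add: l T_def)
      show "\<gamma> t = K (z + (\<epsilon> * st t) *\<^sub>R vec2 e2 e1)"
      proof -
        have "\<gamma> t = Li (\<eta> t)" by (simp add: \<eta>_def LLi)
        then show ?thesis unfolding K_def l using t2 by simp
      qed
    qed (rule d')
  qed (rule R e e1 e2 \<kappa>)+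
  then show ?thesis by blast
qed

section \<open>Gluing the sectors\<close>

text \<open>The eigenvalues are \<open>m + n\<close> and \<open>m - n\<close>: \<open>m\<close> is
  half the trace, \<open>2 * n\<close> the root of the discriminant, and a negative determinant
  means exactly \<open>\<bar>m\<bar> < n\<close>. The shear makes the diagonal entries equal, the
  scaling the off-diagonal ones, and the reflection by \<open>sgn c\<close> makes the latter
  positive.\<close>

lemma normal_form:
  fixes a b c d :: real
  assumes c: "c \<noteq> 0" and det: "a * d - b * c < 0"
  shows "\<exists>s \<kappa> m n. 0 < \<kappa> \<and> \<bar>m\<bar> < n \<and>
    (\<forall>p q. q = to_quad (sgn c) s \<kappa> 1 1 p \<longrightarrow>
      to_quad (sgn c) s \<kappa> 1 1 (vec2 (a * p $ 1 + b * p $ 2) (c * p $ 1 + d * p $ 2)) =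
      vec2 (m * q $ 1 + n * q $ 2) (n * q $ 1 + m * q $ 2))"
proof -
  define e C where "e = sgn c" and "C = \<bar>c\<bar>"
  have C: "C > 0" and ce: "c = e * C" and ee: "e * e = 1" "\<bar>e\<bar> = 1"
    using c by (auto simp: C_def e_def sgn_if)
  define D where "D = (d - a)\<^sup>2 + 4 * (b * c)"
  define r where "r = sqrt D"
  have D2: "D = (a + d)\<^sup>2 - 4 * (a * d - b * c)" by (simp add: D_def power2_eq_square algebra_simps)
  then have D: "(a + d)\<^sup>2 < D" using det by simp
  have D0: "0 < D" using D zero_le_power2[of "a + d"] by linarith
  have r: "0 < r" "r * r = D" using D0 by (auto simp: r_def)
  have "sqrt ((a + d)\<^sup>2) < r" unfolding r_def using D by (rule real_sqrt_less_mono)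
  then have ad: "\<bar>a + d\<bar> < r" by simp
  define m n s \<kappa> where "m = (a + d) / 2" and "n = r / 2" and "s = (d - a) / (2 * C)" and "\<kappa> = r / (2 * C)"
  have sC: "s * C = (d - a) / 2" and \<kappa>C: "\<kappa> * C = n" using C by (simp_all add: s_def \<kappa>_def n_def)
  have dm: "d - m = (d - a) / 2" "m - a = (d - a) / 2" by (simp_all add: m_def field_simps)
  have i1: "e * a + s * c = m * e"
  proof -
    have "s * c = (s * C) * e" by (simp add: ce)
    also have "\<dots> = (m - a) * e" by (simp only: sC dm)
    finally show ?thesis by (simp add: algebra_simps)
  qed
  have i2: "e * b + s * d = m * s + n * \<kappa>"
  proof -
    have "n * \<kappa> = D / (4 * C)" using r(2) by (simp add: n_def \<kappa>_def)
    also have "\<dots> = (d - a)\<^sup>2 / (4 * C) + e * b" using C by (simp add: D_def ce add_divide_distrib)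
    also have "(d - a)\<^sup>2 / (4 * C) = s * (d - m)" unfolding dm by (simp add: s_def power2_eq_square)
    finally show ?thesis by (simp add: algebra_simps)
  qed
  have i3: "\<kappa> * c = n * e" unfolding \<kappa>C[symmetric] by (simp add: ce)
  have i4: "\<kappa> * d = n * s + m * \<kappa>"
  proof -
    have "\<kappa> * (d - m) = n * s" unfolding dm by (simp add: \<kappa>_def n_def s_def)
    then show ?thesis by (simp add: algebra_simps)
  qed
  show ?thesis
  proof (rule exI[of _ s], rule exI[of _ \<kappa>], rule exI[of _ m], rule exI[of _ n], intro conjI allI impI)
    show "0 < \<kappa>" using r C by (simp add: \<kappa>_def)
    show "\<bar>m\<bar> < n" using ad by (simp add: m_def n_def)
    fix p q :: "real^2" assume q: "q = to_quad (sgn c) s \<kappa> 1 1 p"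
    have 1: "e * (a * x + b * y) + s * (c * x + d * y) = m * (e * x + s * y) + n * (\<kappa> * y)" for x y
    proof -
      have "e * (a * x + b * y) + s * (c * x + d * y) = (e * a + s * c) * x + (e * b + s * d) * y"
        by (simp add: algebra_simps)
      then show ?thesis unfolding i1 i2 by (simp add: algebra_simps)
    qed
    have 2: "\<kappa> * (c * x + d * y) = n * (e * x + s * y) + m * (\<kappa> * y)" for x y
    proof -
      have "\<kappa> * (c * x + d * y) = (\<kappa> * c) * x + (\<kappa> * d) * y" by (simp add: algebra_simps)
      then show ?thesis unfolding i3 i4 by (simp add: algebra_simps)
    qed
    show "to_quad (sgn c) s \<kappa> 1 1 (vec2 (a * p $ 1 + b * p $ 2) (c * p $ 1 + d * p $ 2)) =
        vec2 (m * q $ 1 + n * q $ 2) (n * q $ 1 + m * q $ 2)"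
      unfolding q e_def[symmetric] to_quad_def vec2_nth mult_1 1 2 ..
  qed
qed

lemma half_sectors:
  fixes A :: "real^2^2"
  assumes X: "strict_at0 X ((*v) A)" and det: "det A < 0" and c: "A $ 2 $ 1 \<noteq> 0"
  shows "\<exists>s \<kappa> R0. 0 < \<kappa> \<and> 0 < R0 \<and> (\<forall>R e1 e2. 0 < R \<longrightarrow> R \<le> R0 \<longrightarrow> \<bar>e1\<bar> = 1 \<longrightarrow> \<bar>e2\<bar> = 1 \<longrightarrow>
    (\<exists>K g. sector_map X (sgn (A $ 2 $ 1)) s \<kappa> e1 e2 R K g))"
proof -
  define e where "e = sgn (A $ 2 $ 1)"
  have e: "\<bar>e\<bar> = 1" using c by (simp add: e_def sgn_if)
  have Av: "A *v p = vec2 (A $ 1 $ 1 * p $ 1 + A $ 1 $ 2 * p $ 2) (A $ 2 $ 1 * p $ 1 + A $ 2 $ 2 * p $ 2)" for p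
    by (simp add: vec2_eq_iff matrix_vector_mult_def UNIV_2)
  obtain s \<kappa> m n where \<kappa>: "0 < \<kappa>" and mn: "\<bar>m\<bar> < n" and
    L: "\<And>p q. q = to_quad e s \<kappa> 1 1 p \<Longrightarrow>
      to_quad e s \<kappa> 1 1 (A *v p) = vec2 (m * q $ 1 + n * q $ 2) (n * q $ 1 + m * q $ 2)"
    using normal_form[OF c, of "A $ 1 $ 1" "A $ 2 $ 2" "A $ 1 $ 2"] det unfolding Av e_def det_2 by blast
  have ex: "\<exists>R0. 0 < R0 \<and> (\<forall>R. 0 < R \<longrightarrow> R \<le> R0 \<longrightarrow> (\<exists>K g. sector_map X e s \<kappa> e1 e2 R K g))"
    if e1: "\<bar>e1\<bar> = 1" and e2: "\<bar>e2\<bar> = 1" for e1 e2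
  proof -
    have bl: "bounded_linear (\<lambda>v. (e1 * e2) *\<^sub>R to_quad e s \<kappa> e1 e2 v)"
      by (rule bounded_linear_compose[OF bounded_linear_scaleR_right bounded_linear_quad(1)])
    have "strict_at0 (pull e s \<kappa> e1 e2 X) (pull e s \<kappa> e1 e2 ((*v) A))"
      using strict_at0_conj[OF X bl bounded_linear_quad(2)] by (simp add: pull_def[abs_def])
    moreover have "pull e s \<kappa> e1 e2 ((*v) A) q = vec2 ((e1 * e2 * m) * q $ 1 + n * q $ 2) (n * q $ 1 + (e1 * e2 * m) * q $ 2)" for q
    proof -
      have tq: "to_quad e s \<kappa> e1 e2 v = vec2 (e1 * to_quad e s \<kappa> 1 1 v $ 1) (e2 * to_quad e s \<kappa> 1 1 v $ 2)" for v
        by (simp add: to_quad_def mult.assoc)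
      define p where "p = from_quad e s \<kappa> e1 e2 q"
      have "to_quad e s \<kappa> e1 e2 p = q" unfolding p_def using from_to_quad(2)[OF e e1 e2] \<kappa> by simp
      then have *: "e1 * to_quad e s \<kappa> 1 1 p $ 1 = q $ 1" "e2 * to_quad e s \<kappa> 1 1 p $ 2 = q $ 2"
        unfolding tq[of p] by auto
      have p12: "to_quad e s \<kappa> 1 1 p $ 1 = e1 * q $ 1" "to_quad e s \<kappa> 1 1 p $ 2 = e2 * q $ 2"
        using e1 e2 by (simp_all add: sign_mult flip: *)
      have "pull e s \<kappa> e1 e2 ((*v) A) q = (e1 * e2) *\<^sub>R vec2 (e1 * (m * (e1 * q $ 1) + n * (e2 * q $ 2))) (e2 * (n * (e1 * q $ 1) + m * (e2 * q $ 2)))"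
        unfolding pull_def p_def[symmetric] tq[of "A *v p"] L[OF refl] by (simp add: p12)
      also have "\<dots> = vec2 ((e1 * e2 * m) * q $ 1 + n * q $ 2) (n * q $ 1 + (e1 * e2 * m) * q $ 2)"
        using e1 e2 by (simp add: sign_mult vec2_eq_iff algebra_simps)
      finally show ?thesis .
    qed
    moreover have "\<bar>e1 * e2 * m\<bar> < n" using e1 e2 mn by (simp add: abs_mult)
    ultimately obtain \<delta> R0 where "0 < R0" "\<And>R. 0 < R \<Longrightarrow> R \<le> R0 \<Longrightarrow>
        quadrant (pull e s \<kappa> e1 e2 X) (n + e1 * e2 * m) (n - e1 * e2 * m) \<delta> R"
      using quadrant_ex by meson
    then show ?thesis using sector_map_ex[OF e e1 e2 \<kappa>] by blast
  qed
  obtain Rf where Rf: "\<And>e1 e2. \<bar>e1\<bar> = 1 \<Longrightarrow> \<bar>e2\<bar> = 1 \<Longrightarrow> 0 < Rf e1 e2 \<and>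
      (\<forall>R. 0 < R \<longrightarrow> R \<le> Rf e1 e2 \<longrightarrow> (\<exists>K g. sector_map X e s \<kappa> e1 e2 R K g))"
    using ex by metis
  \<comment> \<open>One radius for all four choices of signs.\<close>
  define R0 where "R0 = Min {Rf 1 1, Rf 1 (- 1), Rf (- 1) 1, Rf (- 1) (- 1)}"
  have R0: "0 < R0" using Rf by (auto simp: R0_def)
  have "R0 \<le> Rf e1 e2" if "\<bar>e1\<bar> = 1" "\<bar>e2\<bar> = 1" for e1 e2
  proof -
    have "e1 = 1 \<or> e1 = - 1" "e2 = 1 \<or> e2 = - 1" using that by linarith+
    then show ?thesis by (auto simp: R0_def)
  qed
  then have "\<exists>K g. sector_map X e s \<kappa> e1 e2 R K g" if "0 < R" "R \<le> R0" "\<bar>e1\<bar> = 1" "\<bar>e2\<bar> = 1" for R e1 e2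
    using Rf[OF that(3,4)] that by (meson order_trans)
  then show ?thesis using \<kappa> R0 unfolding e_def by blast
qed

section \<open>Coordinates adapted to the straightened orbits\<close>

definition kap :: "real^2 \<Rightarrow> real" where
  "kap z = \<bar>z $ 1\<bar> - \<bar>z $ 2\<bar>"

text \<open>A unit-speed parameter for the field \<open>(sgn y, sgn x)\<close>: orbits off the
  diagonals pass from a quadrant with negative \<open>z $ 1 * z $ 2\<close> to one with positive
  product, and \<open>sig\<close> vanishes on the axis in between.\<close>

definition sig :: "real^2 \<Rightarrow> real" where
  "sig z = sgn (z $ 1 * z $ 2) * min \<bar>z $ 1\<bar> \<bar>z $ 2\<bar>"

text \<open>In the coordinates \<open>z\<close> with \<open>K z\<close> the original point, orbits follow the piecewise constant
  direction \<open>(sgn y, sgn x)\<close> with speed \<open>g\<close>: along them \<open>kap\<close> is constant and \<open>sig\<close> is increasing.\<close>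

locale straightened =
  fixes \<U> :: "(real^2) set" and X Y :: vfield and R :: real and K :: "real^2 \<Rightarrow> real^2" and g :: "real^2 \<Rightarrow> real"
    and V and fld :: "real \<Rightarrow> vfield"
  defines "V \<equiv> {z :: real^2. \<bar>z $ 1\<bar> + \<bar>z $ 2\<bar> < R}"
    and "fld \<equiv> \<lambda>y. if y > 0 then X else Y"
  assumes R: "R > 0" and contK: "continuous_on V K" and injK: "inj_on K V" and KU: "K ` V \<subseteq> \<U>" and K0: "K 0 = 0"
    and sgnK: "z \<in> V \<Longrightarrow> sgn (K z $ 2) = sgn (z $ 2)"
    and lip: "\<exists>C. \<forall>p\<in>K ` V. norm (X p) \<le> C * norm p \<and> norm (Y p) \<le> C * norm p"
    and cross: "z \<in> V \<Longrightarrow> z $ 2 = 0 \<Longrightarrow> z \<noteq> 0 \<Longrightarrow> 0 < X (K z) $ 2 * Y (K z) $ 2"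
    and g_pos: "z \<in> V \<Longrightarrow> z $ 1 \<noteq> 0 \<Longrightarrow> z $ 2 \<noteq> 0 \<Longrightarrow> 0 < g z"
    and g_ext: "\<bar>e1\<bar> = 1 \<Longrightarrow> \<bar>e2\<bar> = 1 \<Longrightarrow>
        \<exists>h. continuous_on {z \<in> V. 0 \<le> e1 * z $ 1 \<and> 0 \<le> e2 * z $ 2 \<and> z \<noteq> 0} h \<and>
          (\<forall>z\<in>V. 0 \<le> e1 * z $ 1 \<longrightarrow> 0 \<le> e2 * z $ 2 \<longrightarrow> z \<noteq> 0 \<longrightarrow> 0 < h z) \<and>
          (\<forall>z\<in>V. 0 < e1 * z $ 1 \<longrightarrow> 0 < e2 * z $ 2 \<longrightarrow> g z = h z)"
    and flow: "z \<in> V \<Longrightarrow> z $ 1 \<noteq> 0 \<Longrightarrow> z $ 2 \<noteq> 0 \<Longrightarrow>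
        ((\<lambda>t. K (z + t *\<^sub>R vec2 (sgn (z $ 2)) (sgn (z $ 1)))) has_vector_derivative
          (1 / g z) *\<^sub>R fld (z $ 2) (K z)) (at 0)"
    and unique: "\<lbrakk>z \<in> V; z $ 1 \<noteq> 0; z $ 2 \<noteq> 0; 0 < d; \<gamma> t0 = K z;
        \<And>t. \<bar>t - t0\<bar> < d \<Longrightarrow> (\<gamma> has_vector_derivative fld (z $ 2) (\<gamma> t)) (at t)\<rbrakk> \<Longrightarrow>
        \<exists>d'>0. \<exists>\<theta>. \<theta> t0 = 0 \<and> (\<theta> has_real_derivative g z) (at t0) \<and>
          (\<forall>t. \<bar>t - t0\<bar> < d' \<longrightarrow> (\<exists>z'\<in>V. \<gamma> t = K z' \<and> kap z' = kap z \<and> sig z' = sig z + \<theta> t))"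
    and axis: "\<lbrakk>a < b; e2 \<noteq> 0; \<And>t. a < t \<Longrightarrow> t < b \<Longrightarrow> (\<gamma> has_vector_derivative fld e2 (\<gamma> t)) (at t) \<and>
        (\<exists>z\<in>V. z $ 1 = 0 \<and> 0 < e2 * z $ 2 \<and> \<gamma> t = K z)\<rbrakk> \<Longrightarrow> False"

text \<open>A sign without the value 0, so that points of the axes too are assigned to one of the
  four closed sectors.\<close>

definition sg :: "real \<Rightarrow> real" where "sg x = (if x \<le> 0 then - 1 else 1)"

lemma sg [simp]: "\<bar>sg x\<bar> = 1" "0 \<le> sg x * x"
  by (auto simp: sg_def)

lemma sg_eq: "\<bar>e\<bar> = 1 \<Longrightarrow> 0 \<le> e * x \<Longrightarrow> x \<noteq> 0 \<Longrightarrow> sg x = e"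
  by (auto simp: sg_def abs_if zero_le_mult_iff split: if_splits)

lemma sg_sgn: "x \<noteq> 0 \<Longrightarrow> sg x = sgn x" by (simp add: sg_def sgn_if)

lemma sgn_eqI: "\<bar>e\<bar> = 1 \<Longrightarrow> 0 \<le> e * x \<Longrightarrow> 0 \<le> e * y \<Longrightarrow> (x = 0 \<longleftrightarrow> y = 0) \<Longrightarrow> sgn x = sgn (y :: real)"
  by (auto simp: abs_if sgn_if zero_le_mult_iff split: if_splits)

text \<open>Within a quadrant both absolute values change by \<open>e1 * e2 * \<theta>\<close>. The
  difference is therefore unchanged, and the signed minimum changes by \<open>\<theta>\<close>, the
  two factors \<open>e1 * e2\<close> cancelling.\<close>

lemma kap_sig_line:
  assumes e: "\<bar>e1\<bar> = 1" "\<bar>e2\<bar> = 1" and z: "0 < e1 * z $ 1" "0 < e2 * z $ 2"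
    and z': "z' = z + \<theta> *\<^sub>R vec2 e2 e1" "0 \<le> e1 * z' $ 1" "0 \<le> e2 * z' $ 2"
  shows "kap z' = kap z" "sig z' = sig z + \<theta>"
proof -
  define \<epsilon> where "\<epsilon> = e1 * e2"
  have \<epsilon>: "\<epsilon> * \<epsilon> = 1" using e by (auto simp: \<epsilon>_def sign_mult algebra_simps)
  have abs: "\<bar>x\<bar> = e * x" if "\<bar>e\<bar> = 1" "0 \<le> e * x" for e x :: real
    using that by (metis abs_mult abs_of_nonneg mult_1)
  have a: "\<bar>z $ 1\<bar> = e1 * z $ 1" "\<bar>z $ 2\<bar> = e2 * z $ 2" "\<bar>z' $ 1\<bar> = e1 * z' $ 1" "\<bar>z' $ 2\<bar> = e2 * z' $ 2"
    using abs e z z'(2,3) by simp_all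
  have z'_eq: "e1 * z' $ 1 = e1 * z $ 1 + \<epsilon> * \<theta>" "e2 * z' $ 2 = e2 * z $ 2 + \<epsilon> * \<theta>"
    by (simp_all add: z'(1) \<epsilon>_def algebra_simps)
  show "kap z' = kap z" by (simp add: kap_def a z'_eq)
  have sgn: "sgn x = e" if "\<bar>e\<bar> = 1" "0 \<le> e * x" "x \<noteq> 0" for e x :: real
    using that by (auto simp: abs_if sgn_if zero_le_mult_iff split: if_splits)
  have "z $ 1 \<noteq> 0" "z $ 2 \<noteq> 0" using z by auto
  then have "sig z = \<epsilon> * min \<bar>z $ 1\<bar> \<bar>z $ 2\<bar>"
    using sgn[OF e(1), of "z $ 1"] sgn[OF e(2), of "z $ 2"] z by (simp add: sig_def sgn_mult \<epsilon>_def)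
  moreover have "sig z' = \<epsilon> * min \<bar>z' $ 1\<bar> \<bar>z' $ 2\<bar>"
    using sgn[OF e(1) z'(2)] sgn[OF e(2) z'(3)]
    by (cases "z' $ 1 = 0 \<or> z' $ 2 = 0") (auto simp: sig_def sgn_mult \<epsilon>_def)
  moreover have "min \<bar>z' $ 1\<bar> \<bar>z' $ 2\<bar> = min \<bar>z $ 1\<bar> \<bar>z $ 2\<bar> + \<epsilon> * \<theta>"
    unfolding a z'_eq by (simp add: min_add_distrib_left)
  ultimately show "sig z' = sig z + \<theta>" using \<epsilon> by (simp add: distrib_left flip: mult.assoc)
qed

lemma continuous_on_Int_Un:
  assumes "closed C1" "closed C2" "continuous_on (V \<inter> C1) f" "continuous_on (V \<inter> C2) f"
  shows "continuous_on (V \<inter> (C1 \<union> C2)) f"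
proof -
  have "continuous_on (V \<inter> C1 \<union> V \<inter> C2) f"
    by (rule continuous_on_Un_local[OF _ _ assms(3,4)])
      (use assms(1,2) in \<open>auto simp: closedin_closed\<close>)
  then show ?thesis by (simp add: Int_Un_distrib)
qed

lemma straightened_ex:
  fixes A B :: "real^2^2"
  assumes U: "open \<U>" "0 \<in> \<U>" and X: "strict_at0 X ((*v) A)" and Y: "strict_at0 Y ((*v) B)"
    and det: "det A < 0" "det B < 0" and c: "0 < A $ 2 $ 1 * B $ 2 $ 1"
  shows "\<exists>R0>0. \<forall>R. 0 < R \<longrightarrow> R \<le> R0 \<longrightarrow> (\<exists>K g. straightened \<U> X Y R K g)"
proof -
  \<comment> \<open>By the sign condition this reflection is common to both half-planes, so that
    both maps are multiplication by \<open>e\<close> on the switching line.\<close>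
  define e where "e = sgn (A $ 2 $ 1)"
  have e: "\<bar>e\<bar> = 1" "sgn (B $ 2 $ 1) = e" and nz: "A $ 2 $ 1 \<noteq> 0" "B $ 2 $ 1 \<noteq> 0"
    using c by (auto simp: e_def sgn_if zero_less_mult_iff)
  obtain sX \<kappa>X RX where SX: "0 < \<kappa>X" "0 < RX" "\<And>R e1 e2. 0 < R \<Longrightarrow> R \<le> RX \<Longrightarrow> \<bar>e1\<bar> = 1 \<Longrightarrow> \<bar>e2\<bar> = 1 \<Longrightarrow>
      \<exists>K g. sector_map X e sX \<kappa>X e1 e2 R K g"
    using half_sectors[OF X det(1) nz(1)] unfolding e_def by blast
  obtain sY \<kappa>Y RY where SY: "0 < \<kappa>Y" "0 < RY" "\<And>R e1 e2. 0 < R \<Longrightarrow> R \<le> RY \<Longrightarrow> \<bar>e1\<bar> = 1 \<Longrightarrow> \<bar>e2\<bar> = 1 \<Longrightarrow>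
      \<exists>K g. sector_map Y e sY \<kappa>Y e1 e2 R K g"
    using half_sectors[OF Y det(2) nz(2)] unfolding e(2) by blast
  obtain r1 C1 where r1: "r1 > 0" "C1-lipschitz_on (ball 0 r1) X"
    using strict_at0_lipschitz[OF X matrix_vector_mul_bounded_linear] by blast
  obtain r2 C2 where r2: "r2 > 0" "C2-lipschitz_on (ball 0 r2) Y"
    using strict_at0_lipschitz[OF Y matrix_vector_mul_bounded_linear] by blast
  obtain r3 where r3: "r3 > 0" "ball 0 r3 \<subseteq> \<U>" using U open_contains_ball by blast
  define r where "r = min r1 (min r2 r3)"
  have r: "r > 0" "r \<le> r1" "r \<le> r2" "r \<le> r3" using r1 r2 r3 by (auto simp: r_def)
  define fld where "fld y = (if y > 0 then X else Y)" for y :: real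
  define sf where "sf y = (if y > 0 then sX else sY)" for y :: real
  define \<kappa>f where "\<kappa>f y = (if y > 0 then \<kappa>X else \<kappa>Y)" for y :: real
  \<comment> \<open>The factor in \<open>sector_map.bound\<close>. A square of radius at most
    \<open>r / cm\<close> is thus mapped into the ball of radius \<open>r\<close>, which lies in
    \<open>\<U>\<close> and in the Lipschitz balls of both fields.\<close>
  define cf where "cf y = 1 + \<bar>sf y\<bar> / \<kappa>f y + 1 / \<kappa>f y" for y
  have \<kappa>f: "0 < \<kappa>f y" for y using SX SY by (simp add: \<kappa>f_def)
  have cf: "1 \<le> cf y" for y using \<kappa>f[of y] by (simp add: cf_def)
  define cm where "cm = max (cf 1) (cf (- 1))"
  have cm: "cf y \<le> cm" for y by (auto simp: cm_def cf_def sf_def \<kappa>f_def)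
  have cm0: "0 < cm" using cf[of 1] cm[of 1] by linarith
  define R0 where "R0 = min (min RX RY) (r / cm)"
  show ?thesis
  proof (intro exI[of _ R0] conjI allI impI)
    show "R0 > 0" using SX SY r cm0 by (simp add: R0_def)
    fix R assume R: "0 < R" "R \<le> R0"
    have Rr: "cm * R \<le> r" using R cm0 by (simp add: R0_def field_simps)
    define P where "P e1 e2 Kg \<longleftrightarrow> sector_map (fld e2) e (sf e2) (\<kappa>f e2) e1 e2 R (fst Kg) (snd Kg)" for e1 e2 Kg
    have "\<exists>Kg. P e1 e2 Kg" if "\<bar>e1\<bar> = 1" "\<bar>e2\<bar> = 1" for e1 e2
      using SX(3)[OF R(1) _ that] SY(3)[OF R(1) _ that] R unfolding P_def R0_def fld_def sf_def \<kappa>f_def by simp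
    then obtain Kg where Kg: "\<And>e1 e2. \<bar>e1\<bar> = 1 \<Longrightarrow> \<bar>e2\<bar> = 1 \<Longrightarrow> P e1 e2 (Kg e1 e2)" by metis
    define Kf gf where "Kf e1 e2 = fst (Kg e1 e2)" and "gf e1 e2 = snd (Kg e1 e2)" for e1 e2
    have SM: "sector_map (fld e2) e (sf e2) (\<kappa>f e2) e1 e2 R (Kf e1 e2) (gf e1 e2)" if "\<bar>e1\<bar> = 1" "\<bar>e2\<bar> = 1" for e1 e2
      using Kg[OF that] by (simp add: P_def Kf_def gf_def)
    define V where "V = {z :: real^2. \<bar>z $ 1\<bar> + \<bar>z $ 2\<bar> < R}"
    define S where "S e1 e2 = {z :: real^2. 0 \<le> e1 * z $ 1 \<and> 0 \<le> e2 * z $ 2 \<and> \<bar>z $ 1\<bar> + \<bar>z $ 2\<bar> < R}" for e1 e2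
    note sm = sector_map.cont[OF SM, folded S_def] sector_map.inj[OF SM, folded S_def]
      sector_map.sgn2[OF SM, folded S_def] sector_map.sgn1[OF SM, folded S_def]
      sector_map.axis2[OF SM, folded S_def] sector_map.axis1[OF SM, folded S_def]
      sector_map.bound[OF SM, folded S_def] sector_map.g_cont[OF SM, folded S_def] sector_map.g_pos[OF SM, folded S_def]
      sector_map.flow[OF SM, folded S_def] sector_map.unique[OF SM, folded S_def]
      sector_map.cross2[OF SM, folded S_def] sector_map.cross1[OF SM, folded S_def]
    have VS: "z \<in> S (sg (z $ 1)) (sg (z $ 2))" if "z \<in> V" for z using that by (simp add: V_def S_def)
    have SV: "z \<in> V" if "z \<in> S e1 e2" for z e1 e2 using that by (simp add: V_def S_def)
    define K where "K z = Kf (sg (z $ 1)) (sg (z $ 2)) z" for z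
    define g where "g z = gf (sg (z $ 1)) (sg (z $ 2)) z" for z
    \<comment> \<open>Adjacent sector maps coincide on their common axis: on
      \<open>z $ 2 = 0\<close> the formula involves only the shared \<open>e\<close>, and on
      \<open>z $ 1 = 0\<close> only \<open>e\<close> and the shear and scaling of the one half-plane
      containing both sectors.\<close>
    have agree: "K z = Kf e1 e2 z" if E: "\<bar>e1\<bar> = 1" "\<bar>e2\<bar> = 1" and z: "z \<in> S e1 e2" for e1 e2 z
    proof -
      have z': "z \<in> S (sg (z $ 1)) e2" using z by (simp add: S_def)
      have "Kf e1 e2 z = Kf (sg (z $ 1)) e2 z"
      proof (cases "z $ 1 = 0")
        case True
        show ?thesis using sm(6)[OF E z True] sm(6)[OF sg(1) E(2) z' True] by simp
      next
        case False
        then show ?thesis using sg_eq[OF E(1)] z by (simp add: S_def)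
      qed
      also have "\<dots> = K z" unfolding K_def
      proof (cases "z $ 2 = 0")
        case True
        show "Kf (sg (z $ 1)) e2 z = Kf (sg (z $ 1)) (sg (z $ 2)) z"
          using sm(5)[OF sg(1) E(2) z' True] sm(5)[OF sg(1) sg(1) VS[OF SV[OF z]] True] by simp
      next
        case False
        then show "Kf (sg (z $ 1)) e2 z = Kf (sg (z $ 1)) (sg (z $ 2)) z"
          using sg_eq[OF E(2)] z by (simp add: S_def)
      qed
      finally show ?thesis by simp
    qed
    have "straightened \<U> X Y R K g"
    proof (unfold_locales, fold V_def fld_def)
      show "R > 0" by (rule R)
      define C where "C e1 e2 = {z :: real^2. 0 \<le> e1 * z $ 1 \<and> 0 \<le> e2 * z $ 2}" for e1 e2
      have "closed (C e1 e2)" for e1 e2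
        unfolding C_def by (intro closed_Collect_conj closed_Collect_le continuous_intros)
      moreover have "continuous_on (V \<inter> C e1 e2) K" if "\<bar>e1\<bar> = 1" "\<bar>e2\<bar> = 1" for e1 e2
      proof -
        have "V \<inter> C e1 e2 = S e1 e2" by (auto simp: V_def C_def S_def)
        then show ?thesis using sm(1)[OF that] agree[OF that] by (metis (no_types, lifting) continuous_on_cong)
      qed
      ultimately have "continuous_on (V \<inter> ((C 1 1 \<union> C 1 (- 1)) \<union> (C (- 1) 1 \<union> C (- 1) (- 1)))) K"
        by (intro continuous_on_Int_Un closed_Un) auto
      moreover have "V \<inter> ((C 1 1 \<union> C 1 (- 1)) \<union> (C (- 1) 1 \<union> C (- 1) (- 1))) = V" by (auto simp: C_def)
      ultimately show "continuous_on V K" by simp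
      have sgnK: "sgn (K z $ 2) = sgn (z $ 2)" if z: "z \<in> V" for z
        using sm(3)[OF sg(1) sg(1) VS[OF z]] unfolding K_def[symmetric]
        by (intro sgn_eqI[OF sg(1)[of "z $ 2"]]) auto
      then show "sgn (K z $ 2) = sgn (z $ 2)" if "z \<in> V" for z using that by simp
      have sgnK1: "sgn (e * K z $ 1 + sf (sg (z $ 2)) * K z $ 2) = sgn (z $ 1)" if z: "z \<in> V" for z
        using sm(4)[OF sg(1) sg(1) VS[OF z]] unfolding K_def[symmetric]
        by (intro sgn_eqI[OF sg(1)[of "z $ 1"]]) auto
      have sgcong: "sg x = sg y" if "sgn x = sgn y" for x y :: real
        using that by (auto simp: sg_def sgn_if split: if_splits)
      show "inj_on K V"
      proof (rule inj_onI)
        fix z z' assume z: "z \<in> V" "z' \<in> V" and eq: "K z = K z'"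
        \<comment> \<open>The sector of \<open>z\<close> can be read off from \<open>K z\<close>:
          its second coordinate and its sheared first coordinate have the signs of the coordinates
          of \<open>z\<close>.\<close>
        have s2: "sg (z $ 2) = sg (z' $ 2)" using sgnK z eq by (intro sgcong) metis
        then have s1: "sg (z $ 1) = sg (z' $ 1)" using sgnK1 z eq by (intro sgcong) metis
        have zz: "z \<in> S (sg (z $ 1)) (sg (z $ 2))" "z' \<in> S (sg (z $ 1)) (sg (z $ 2))"
          using VS[OF z(1)] VS[OF z(2)] by (simp_all add: s1 s2)
        have "Kf (sg (z $ 1)) (sg (z $ 2)) z = Kf (sg (z $ 1)) (sg (z $ 2)) z'"
          using eq by (simp add: K_def s1 s2)
        with sm(2)[OF sg(1) sg(1)] zz show "z = z'" by (meson inj_onD)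
      qed
      have Kr: "norm (K z) < r" if z: "z \<in> V" for z
      proof -
        have "norm (K z) \<le> cf (sg (z $ 2)) * (\<bar>z $ 1\<bar> + \<bar>z $ 2\<bar>)"
          using sm(7)[OF sg(1) sg(1) VS[OF z]] by (simp add: K_def cf_def)
        also have "\<dots> \<le> cm * (\<bar>z $ 1\<bar> + \<bar>z $ 2\<bar>)" by (intro mult_right_mono cm) auto
        also have "\<dots> < cm * R" using z cm0 by (simp add: V_def)
        finally show ?thesis using Rr by simp
      qed
      then show "K ` V \<subseteq> \<U>" using r r3 by (force simp: subset_iff)
      have z0: "0 \<in> V" using R by (simp add: V_def)
      show "K 0 = 0" using sm(5)[OF sg(1) sg(1) VS[OF z0]] by (simp add: K_def vec2_eq_iff)
      show "\<exists>C. \<forall>p\<in>K ` V. norm (X p) \<le> C * norm p \<and> norm (Y p) \<le> C * norm p"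
      proof (rule exI[of _ "max C1 C2"], rule ballI)
        fix p assume "p \<in> K ` V"
        then have p: "norm p < r" using Kr by auto
        have "norm (X p) \<le> C1 * norm p" "norm (Y p) \<le> C2 * norm p"
          using lipschitz_onD[OF r1(2), of p 0] lipschitz_onD[OF r2(2), of p 0] p r r1(1) r2(1) X Y
          by (auto simp: strict_at0_def)
        then show "norm (X p) \<le> max C1 C2 * norm p \<and> norm (Y p) \<le> max C1 C2 * norm p"
          using mult_right_mono[of C1 "max C1 C2" "norm p"] mult_right_mono[of C2 "max C1 C2" "norm p"] by auto
      qed
      show "0 < X (K z) $ 2 * Y (K z) $ 2" if z: "z \<in> V" "z $ 2 = 0" "z \<noteq> 0" for z
      proof -
        have z': "z \<in> S (sg (z $ 1)) 1" "z \<in> S (sg (z $ 1)) (- 1)" using z by (auto simp: V_def S_def)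
        have "0 < sg (z $ 1) * X (K z) $ 2" "0 < sg (z $ 1) * Y (K z) $ 2"
          using sm(12)[OF sg(1) _ z'(1) z(2,3)] sm(12)[OF sg(1) _ z'(2) z(2,3)]
            agree[OF sg(1) _ z'(1)] agree[OF sg(1) _ z'(2)] by (auto simp: fld_def)
        then show ?thesis by (auto simp: zero_less_mult_iff)
      qed
      show "0 < g z" if z: "z \<in> V" "z $ 1 \<noteq> 0" "z $ 2 \<noteq> 0" for z
      proof -
        have "z \<noteq> 0" using z(2) by auto
        then show ?thesis using sm(9)[OF sg(1) sg(1) VS[OF z(1)]] by (simp add: g_def)
      qed
      show "\<exists>h. continuous_on {z \<in> V. 0 \<le> e1 * z $ 1 \<and> 0 \<le> e2 * z $ 2 \<and> z \<noteq> 0} h \<and>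
          (\<forall>z\<in>V. 0 \<le> e1 * z $ 1 \<longrightarrow> 0 \<le> e2 * z $ 2 \<longrightarrow> z \<noteq> 0 \<longrightarrow> 0 < h z) \<and>
          (\<forall>z\<in>V. 0 < e1 * z $ 1 \<longrightarrow> 0 < e2 * z $ 2 \<longrightarrow> g z = h z)" if E: "\<bar>e1\<bar> = 1" "\<bar>e2\<bar> = 1" for e1 e2
      proof (intro exI[of _ "gf e1 e2"] conjI ballI impI)
        have "{z \<in> V. 0 \<le> e1 * z $ 1 \<and> 0 \<le> e2 * z $ 2 \<and> z \<noteq> 0} = S e1 e2 - {0}" by (auto simp: V_def S_def)
        then show "continuous_on {z \<in> V. 0 \<le> e1 * z $ 1 \<and> 0 \<le> e2 * z $ 2 \<and> z \<noteq> 0} (gf e1 e2)"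
          using sm(8)[OF E] by simp
        show "0 < gf e1 e2 z" if "z \<in> V" "0 \<le> e1 * z $ 1" "0 \<le> e2 * z $ 2" "z \<noteq> 0" for z
          using sm(9)[OF E, of z] that by (simp add: V_def S_def)
        show "g z = gf e1 e2 z" if "z \<in> V" "0 < e1 * z $ 1" "0 < e2 * z $ 2" for z
        proof -
          have "z $ 1 \<noteq> 0" "z $ 2 \<noteq> 0" using that by auto
          then show ?thesis using sg_eq[OF E(1), of "z $ 1"] sg_eq[OF E(2), of "z $ 2"] that by (simp add: g_def)
        qed
      qed
    next
      fix z assume z: "z \<in> V" "z $ 1 \<noteq> 0" "z $ 2 \<noteq> 0"
      define e1 e2 where "e1 = sgn (z $ 1)" and "e2 = sgn (z $ 2)"
      have e12: "sg (z $ 1) = e1" "sg (z $ 2) = e2" using z by (simp_all add: sg_sgn e1_def e2_def)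
      have E: "\<bar>e1\<bar> = 1" "\<bar>e2\<bar> = 1" using z by (simp_all add: e1_def e2_def sgn_if)
      have zS: "z \<in> S e1 e2" using VS[OF z(1)] by (simp add: e12)
      have pos: "0 < e1 * z $ 1" "0 < e2 * z $ 2" using z by (simp_all add: e1_def e2_def sgn_if)
      have fe: "fld (z $ 2) = fld e2" using z by (simp add: fld_def e2_def sgn_if)
      have ge: "g z = gf e1 e2 z" by (simp add: g_def e12)
      \<comment> \<open>An open set of parameters for which the line stays in the interior of the
        sector.\<close>
      define W where "W = {t. 0 < e1 * (z + t *\<^sub>R vec2 e2 e1) $ 1 \<and> 0 < e2 * (z + t *\<^sub>R vec2 e2 e1) $ 2 \<and>
          \<bar>(z + t *\<^sub>R vec2 e2 e1) $ 1\<bar> + \<bar>(z + t *\<^sub>R vec2 e2 e1) $ 2\<bar> < R}"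
      have W: "open W" "0 \<in> W"
        unfolding W_def using pos z
        by (auto intro!: open_Collect_conj open_Collect_less continuous_intros simp: V_def)
      have WS: "z + t *\<^sub>R vec2 e2 e1 \<in> S e1 e2" if "t \<in> W" for t
        using that unfolding W_def S_def by auto
      have "((\<lambda>t. K (z + t *\<^sub>R vec2 e2 e1)) has_vector_derivative (1 / g z) *\<^sub>R fld e2 (Kf e1 e2 z)) (at 0)"
        by (rule has_vector_derivative_transform_within_open[OF _ W])
          (use sm(10)[OF E zS z(2,3)] agree[OF E WS] ge in auto)
      then show "((\<lambda>t. K (z + t *\<^sub>R vec2 (sgn (z $ 2)) (sgn (z $ 1)))) has_vector_derivative
          (1 / g z) *\<^sub>R fld (z $ 2) (K z)) (at 0)"
        unfolding fe agree[OF E zS] e1_def[symmetric] e2_def[symmetric] .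
      fix d t0 :: real and \<gamma> assume d: "0 < d" and \<gamma>0: "\<gamma> t0 = K z"
        and \<gamma>: "\<And>t. \<bar>t - t0\<bar> < d \<Longrightarrow> (\<gamma> has_vector_derivative fld (z $ 2) (\<gamma> t)) (at t)"
      obtain d' \<theta> where d': "d' > 0" and \<theta>: "\<theta> t0 = 0" "(\<theta> has_real_derivative g z) (at t0)" and
        eq: "\<And>t. \<bar>t - t0\<bar> < d' \<Longrightarrow> z + \<theta> t *\<^sub>R vec2 e2 e1 \<in> S e1 e2 \<and> \<gamma> t = Kf e1 e2 (z + \<theta> t *\<^sub>R vec2 e2 e1)"
        using sm(11)[OF E zS z(2,3) d, of \<gamma> t0] \<gamma>0 \<gamma> agree[OF E zS] unfolding ge fe by auto
      show "\<exists>d'>0. \<exists>\<theta>. \<theta> t0 = 0 \<and> (\<theta> has_real_derivative g z) (at t0) \<and>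
          (\<forall>t. \<bar>t - t0\<bar> < d' \<longrightarrow> (\<exists>z'\<in>V. \<gamma> t = K z' \<and> kap z' = kap z \<and> sig z' = sig z + \<theta> t))"
      proof (rule exI[of _ d'], intro conjI exI[of _ \<theta>] allI impI d' \<theta>)
        fix t assume "\<bar>t - t0\<bar> < d'"
        note t = eq[OF this]
        define z' where "z' = z + \<theta> t *\<^sub>R vec2 e2 e1"
        have z': "z' \<in> S e1 e2" "\<gamma> t = K z'" using t agree[OF E, of z'] by (auto simp: z'_def)
        then have "0 \<le> e1 * z' $ 1" "0 \<le> e2 * z' $ 2" by (auto simp: S_def)
        from kap_sig_line[OF E pos z'_def this] z' SV
        show "\<exists>z'\<in>V. \<gamma> t = K z' \<and> kap z' = kap z \<and> sig z' = sig z + \<theta> t" by blast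
      qed
    next
      fix a b e2 :: real and \<gamma> assume ab: "a < b" and e2: "e2 \<noteq> 0"
        and \<gamma>: "\<And>t. a < t \<Longrightarrow> t < b \<Longrightarrow> (\<gamma> has_vector_derivative fld e2 (\<gamma> t)) (at t) \<and>
          (\<exists>z\<in>V. z $ 1 = 0 \<and> 0 < e2 * z $ 2 \<and> \<gamma> t = K z)"
      define E2 where "E2 = sgn e2"
      have E: "\<bar>1 :: real\<bar> = 1" "\<bar>E2\<bar> = 1" using e2 by (simp_all add: E2_def sgn_if)
      have fe: "fld e2 = fld E2" using e2 by (simp add: fld_def E2_def sgn_if)
      have zS: "z \<in> S 1 E2" if "z \<in> V" "z $ 1 = 0" "0 < e2 * z $ 2" for z
        using that by (auto simp: V_def S_def E2_def sgn_if zero_less_mult_iff)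
      \<comment> \<open>The half-axis is mapped into a straight line through 0 on which the sheared
        coordinate vanishes. A solution remaining there has zero derivative in this coordinate,
        contrary to the transversality \<open>cross1\<close>.\<close>
      have 0: "e * \<gamma> t $ 1 + sf E2 * \<gamma> t $ 2 = 0" if t: "t \<in> {a<..<b}" for t
      proof -
        obtain z where z: "z \<in> V" "z $ 1 = 0" "0 < e2 * z $ 2" "\<gamma> t = K z" using \<gamma>[of t] t by auto
        note zS' = zS[OF z(1-3)]
        show ?thesis using sm(4)[OF E zS'] z(2,4) agree[OF E zS'] by simp
      qed
      obtain t where t: "a < t" "t < b" using dense ab by blast
      have "((\<lambda>t. e * \<gamma> t $ 1 + sf E2 * \<gamma> t $ 2) has_vector_derivative e * fld E2 (\<gamma> t) $ 1 + sf E2 * fld E2 (\<gamma> t) $ 2) (at t)"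
        using \<gamma>[OF t] unfolding fe
        by (intro derivative_intros has_vector_derivative_mult_right has_vector_derivative_nth) auto
      moreover have "((\<lambda>t. e * \<gamma> t $ 1 + sf E2 * \<gamma> t $ 2) has_vector_derivative 0) (at t)"
        by (rule has_vector_derivative_transform_within_open[of "\<lambda>_. 0" _ _ "{a<..<b}"]) (use 0 t in auto)
      ultimately have eq0: "e * fld E2 (\<gamma> t) $ 1 + sf E2 * fld E2 (\<gamma> t) $ 2 = 0"
        by (rule vector_derivative_unique_at)
      obtain z where z: "z \<in> V" "z $ 1 = 0" "0 < e2 * z $ 2" "\<gamma> t = K z" using \<gamma>[OF t] by auto
      note zS' = zS[OF z(1-3)]
      have "z \<noteq> 0" using z(3) by auto
      from sm(13)[OF E zS' z(2) this] eq0 z(4) agree[OF E zS'] show False by simp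
    qed
    then show "\<exists>K g. straightened \<U> X Y R K g" by blast
  qed
qed

section \<open>Trajectories in straightened coordinates\<close>

lemma is_interval_Icc: "is_interval I \<Longrightarrow> a \<in> I \<Longrightarrow> b \<in> I \<Longrightarrow> {a..b} \<subseteq> (I :: real set)"
  by (rule connected_contains_Icc[OF is_interval_connected])

lemma sgn_const_on_interval:
  fixes h :: "real \<Rightarrow> real"
  assumes I: "is_interval I" and cont: "continuous_on I h" and nz: "\<And>t. t \<in> I \<Longrightarrow> h t \<noteq> 0"
    and st: "s \<in> I" "t \<in> I"
  shows "sgn (h s) = sgn (h t)"
proof -
  have "connected (h ` I)" using cont is_interval_connected[OF I] by (rule connected_continuous_image)
  then have c: "{h x..h y} \<subseteq> h ` I" if "x \<in> I" "y \<in> I" for x y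
    by (rule connected_contains_Icc[OF _ imageI[OF that(1)] imageI[OF that(2)]])
  have "0 \<notin> h ` I" using nz by auto
  then have "0 \<notin> {h s..h t}" "0 \<notin> {h t..h s}" using c[OF st] c[OF st(2,1)] by (meson subsetD)+
  then show ?thesis using nz[OF st(1)] nz[OF st(2)] by (auto simp: sgn_if)
qed

text \<open>This form shows continuity across the axes, which the sign function hides.\<close>

lemma sig_alt: "sig z = (\<bar>z $ 1 + z $ 2\<bar> - \<bar>z $ 1 - z $ 2\<bar>) / 2"
proof -
  have pos: "min x y = (\<bar>x + y\<bar> - \<bar>x - y\<bar>) / 2" if "0 < x" "0 < y" for x y :: real
    using that by (cases "x \<le> y") (simp_all add: min_def)
  have "sgn (x * y) * min \<bar>x\<bar> \<bar>y\<bar> = (\<bar>x + y\<bar> - \<bar>x - y\<bar>) / 2" for x y :: real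
  proof -
    consider "x = 0 \<or> y = 0" | "0 < x" "0 < y" | "x < 0" "y < 0" | "0 < x" "y < 0" | "x < 0" "0 < y" by linarith
    then show ?thesis
    proof cases
      case 1
      then show ?thesis by (auto simp: min_def)
    next
      case 2
      then show ?thesis using pos by (simp add: sgn_mult)
    next
      case 3
      then show ?thesis using pos[of "- x" "- y"] by (simp add: sgn_mult)
    next
      case 4
      then show ?thesis using pos[of x "- y"] by (simp add: sgn_mult)
    next
      case 5
      then show ?thesis using pos[of "- x" y] by (simp add: sgn_mult)
    qed
  qed
  then show ?thesis by (simp only: sig_def)
qed

lemma continuous_on_sig:
  assumes "continuous_on S f"
  shows "continuous_on S (\<lambda>t. sig (f t))"
  unfolding sig_alt by (intro continuous_intros assms) simp

lemma continuous_on_kap: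
  assumes "continuous_on S f"
  shows "continuous_on S (\<lambda>t. kap (f t))"
  unfolding kap_def by (intro continuous_intros assms)

lemma sig_eq_0: "sig z = 0 \<longleftrightarrow> z $ 1 = 0 \<or> z $ 2 = 0"
  by (auto simp: sig_def sgn_zero_iff min_def)

text \<open>Describes the square \<open>V\<close> in the orbit coordinates; the bound in
  \<open>cdom\<close> comes from here.\<close>

lemma kap_sig_norm: "\<bar>kap z\<bar> + 2 * \<bar>sig z\<bar> = \<bar>z $ 1\<bar> + \<bar>z $ 2\<bar>"
proof -
  have "\<bar>sig z\<bar> = min \<bar>z $ 1\<bar> \<bar>z $ 2\<bar>"
    by (auto simp: sig_def abs_mult sgn_if min_def)
  then show ?thesis by (auto simp: kap_def min_def)
qed

text \<open>The canonical orbits: the level sets of \<open>kap\<close>, parametrised by \<open>sig\<close>; the signs \<open>e\<close> and, for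
  \<open>\<kappa> = 0\<close>, \<open>e'\<close> select the branch.\<close>

definition cc :: "real \<Rightarrow> real \<Rightarrow> real \<Rightarrow> real^2" where
  "cc \<kappa> e s = (if \<kappa> \<ge> 0 then vec2 (e * (\<kappa> + \<bar>s\<bar>)) (e * s) else vec2 (e * s) (e * (\<bar>s\<bar> - \<kappa>)))"

text \<open>The level set 0 consists of the diagonals, which pass through the equilibrium. There
  \<open>s = 0\<close> is removed, and \<open>e'\<close> keeps the incoming half
  (\<open>s < 0\<close>) or the outgoing half (\<open>s > 0\<close>).\<close>

definition cdom :: "real \<Rightarrow> real \<Rightarrow> real \<Rightarrow> real set" where
  "cdom R \<kappa> e' = {s. \<bar>\<kappa>\<bar> + 2 * \<bar>s\<bar> < R \<and> (\<kappa> = 0 \<longrightarrow> 0 < e' * s)}"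

text \<open>The sign of the coordinate of larger absolute value, which cannot vanish off the
  origin.\<close>

definition branch :: "real^2 \<Rightarrow> real" where
  "branch z = (if kap z \<ge> 0 then sgn (z $ 1) else sgn (z $ 2))"

lemma cc_eq:
  assumes "z \<noteq> 0"
  shows "cc (kap z) (branch z) (sig z) = z"
proof -
  have sgn1: "sgn x * (sgn x * w) = w" if "x \<noteq> 0" for x w :: real
    using that by (cases "x > 0") (simp_all add: sgn_if)
  have abs_sig: "\<bar>sig z\<bar> = min \<bar>z $ 1\<bar> \<bar>z $ 2\<bar>" by (auto simp: sig_def abs_mult sgn_if min_def)
  show ?thesis
  proof (cases "\<bar>z $ 2\<bar> \<le> \<bar>z $ 1\<bar>")
    case True
    then have "z $ 1 \<noteq> 0" using assms by (auto simp: vec2_eq_iff)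
    then have "branch z = sgn (z $ 1)" "sgn (z $ 1) * sig z = z $ 2" "\<bar>sig z\<bar> = \<bar>z $ 2\<bar>" "0 \<le> kap z"
      using True abs_sig sgn1[of "z $ 1"] by (simp_all add: branch_def kap_def sig_def sgn_mult mult.assoc min_absorb2 mult_sgn_abs)
    then show ?thesis by (simp add: cc_def kap_def vec2_eq_iff mult_sgn_abs)
  next
    case False
    then have "z $ 2 \<noteq> 0" by auto
    moreover have "sig z = sgn (z $ 2) * (sgn (z $ 1) * \<bar>z $ 1\<bar>)"
      using False by (simp add: sig_def sgn_mult min_absorb1)
    ultimately have "branch z = sgn (z $ 2)" "sgn (z $ 2) * sig z = z $ 1" "\<bar>sig z\<bar> = \<bar>z $ 1\<bar>" "\<not> 0 \<le> kap z"
      using False abs_sig sgn1[of "z $ 2"] by (simp_all add: branch_def kap_def min_absorb1 mult_sgn_abs)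
    then show ?thesis by (simp add: cc_def kap_def vec2_eq_iff mult_sgn_abs)
  qed
qed

lemma abs_branch:
  assumes "z \<noteq> 0"
  shows "\<bar>branch z\<bar> = 1"
proof -
  have "z $ 1 \<noteq> 0" if "kap z \<ge> 0" using assms that by (auto simp: kap_def vec2_eq_iff)
  moreover have "z $ 2 \<noteq> 0" if "\<not> kap z \<ge> 0" using that by (auto simp: kap_def)
  ultimately show ?thesis by (simp add: branch_def abs_sgn_eq)
qed

lemma kap_cc: "\<bar>e\<bar> = 1 \<Longrightarrow> kap (cc \<kappa> e s) = \<kappa>"
  by (simp add: kap_def cc_def abs_mult)

lemma sig_cc: "\<bar>e\<bar> = 1 \<Longrightarrow> sig (cc \<kappa> e s) = s"
proof -
  assume "\<bar>e\<bar> = 1"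
  then have "e = 1 \<or> e = - 1" by linarith
  then show ?thesis by (auto simp: sig_alt cc_def)
qed

lemma cdom_eq:
  "cdom R \<kappa> e' = (if \<kappa> = 0 then (if e' > 0 then {0<..<R / 2} else if e' < 0 then {- R / 2<..<0} else {})
    else {- (R - \<bar>\<kappa>\<bar>) / 2<..<(R - \<bar>\<kappa>\<bar>) / 2})"
proof (cases "\<kappa> = 0")
  case True
  show ?thesis
  proof (rule set_eqI)
    fix s show "s \<in> cdom R \<kappa> e' \<longleftrightarrow> s \<in> (if \<kappa> = 0 then (if e' > 0 then {0<..<R / 2} else if e' < 0 then {- R / 2<..<0} else {})
      else {- (R - \<bar>\<kappa>\<bar>) / 2<..<(R - \<bar>\<kappa>\<bar>) / 2})"
      using True by (cases "s > 0"; cases e' "0 :: real" rule: linorder_cases)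
        (simp_all add: cdom_def zero_less_mult_iff, linarith+)
  qed
next
  case False
  then show ?thesis by (simp add: cdom_def set_eq_iff) linarith
qed

lemma open_cdom: "open (cdom R \<kappa> e')"
  by (simp add: cdom_eq)

lemma interval_cdom: "is_interval (cdom R \<kappa> e')"
  by (simp add: cdom_eq is_interval_1)

lemma continuous_on_cc: "continuous_on S (cc \<kappa> e)"
proof (cases "\<kappa> \<ge> 0")
  case True
  then show ?thesis unfolding cc_def if_P[OF True] by (intro continuous_intros)
next
  case False
  then show ?thesis unfolding cc_def if_not_P[OF False] by (intro continuous_intros)
qed

context straightened begin

section \<open>The inverse map and the Filippov field near the origin\<close>

lemma open_V: "open V"
  unfolding V_def by (intro open_Collect_less continuous_intros)

definition E :: "real^2 \<Rightarrow> real^2" where "E = inv_into V K"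

text \<open>Invariance of domain: \<open>K\<close> is continuous and injective on an open set of the
  plane.\<close>

lemma homeo: "homeomorphism V (K ` V) K E"
proof -
  obtain h where h: "homeomorphism V (K ` V) K h"
    using invariance_of_domain_homeomorphism[OF open_V contK _ injK] by auto
  have "E p = h p" if "p \<in> K ` V" for p
    using that h injK by (auto simp: E_def homeomorphism_def)
  then show ?thesis using homeomorphism_cong[OF h] by auto
qed

lemma EK [simp]: "z \<in> V \<Longrightarrow> E (K z) = z" and KE [simp]: "p \<in> K ` V \<Longrightarrow> K (E p) = p"
  and EV: "p \<in> K ` V \<Longrightarrow> E p \<in> V" and contE: "continuous_on (K ` V) E"
  using homeo by (auto simp: homeomorphism_def)

lemma zero_V: "0 \<in> V" using R by (simp add: V_def)

lemma K_eq_0: "z \<in> V \<Longrightarrow> K z = 0 \<longleftrightarrow> z = 0"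
  using injK K0 zero_V by (metis inj_onD)

lemma cc_V: "\<bar>e\<bar> = 1 \<Longrightarrow> s \<in> cdom R \<kappa> e' \<Longrightarrow> cc \<kappa> e s \<in> V"
  by (simp add: V_def flip: kap_sig_norm) (simp add: kap_cc sig_cc cdom_def)

lemma fld0: "X 0 = 0" "Y 0 = 0"
proof -
  obtain C where "\<forall>p\<in>K ` V. norm (X p) \<le> C * norm p \<and> norm (Y p) \<le> C * norm p" using lip by blast
  moreover have "0 \<in> K ` V" using K0 zero_V by (metis imageI)
  ultimately show "X 0 = 0" "Y 0 = 0" by fastforce+
qed

text \<open>By \<open>cross\<close> every point of the line near 0 other than 0 is a crossing point,
  so the Filippov field is \<open>X\<close> or \<open>Y\<close> there and points off the line. At 0
  both fields vanish and so does \<open>Z_Sigma\<close>.\<close>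

lemma Z_Sigma_values:
  assumes p: "p \<in> Sigma_line \<U>" "p \<in> K ` V"
  shows "Z_Sigma \<U> (X, Y) p = X p \<or> Z_Sigma \<U> (X, Y) p = Y p" and "p \<noteq> 0 \<Longrightarrow> Z_Sigma \<U> (X, Y) p $ 2 \<noteq> 0"
proof -
  obtain z where z: "z \<in> V" "p = K z" using p by blast
  have z2: "z $ 2 = 0" using sgnK[OF z(1)] p z by (simp add: Sigma_line_def sgn_zero_iff)
  have *: "(Z_Sigma \<U> (X, Y) p = X p \<or> Z_Sigma \<U> (X, Y) p = Y p) \<and> (p \<noteq> 0 \<longrightarrow> Z_Sigma \<U> (X, Y) p $ 2 \<noteq> 0)"
  proof (cases "p = 0")
    case True
    then show ?thesis by (auto simp: Z_Sigma_def crossing_set_def fld0)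
  next
    case False
    then have "0 < X p $ 2 * Y p $ 2" using cross[OF z(1) z2] K_eq_0[OF z(1)] z by auto
    then show ?thesis using p by (auto simp: Z_Sigma_def crossing_set_def)
  qed
  show "Z_Sigma \<U> (X, Y) p = X p \<or> Z_Sigma \<U> (X, Y) p = Y p" "p \<noteq> 0 \<Longrightarrow> Z_Sigma \<U> (X, Y) p $ 2 \<noteq> 0"
    using * by auto
qed

end

lemma avoid_finite:
  fixes t :: real
  assumes "finite (D \<inter> {a..b})" "a < t" "t < b" "t \<notin> D"
  obtains d where "d > 0" "a < t - d" "t + d < b" "{t - d<..<t + d} \<inter> D = {}"
proof -
  have "open (- (D \<inter> {a..b}))" by (intro open_Compl finite_imp_closed assms(1))
  moreover have "t \<in> - (D \<inter> {a..b})" using assms(4) by simp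
  ultimately obtain d where d0: "d > 0" "\<forall>s. dist s t < d \<longrightarrow> s \<in> - (D \<inter> {a..b})"
    unfolding open_dist by (elim ballE exE conjE) auto
  then have d: "d > 0" "\<And>s. \<bar>s - t\<bar> < d \<Longrightarrow> s \<notin> D \<inter> {a..b}" by (auto simp: dist_real_def)
  define d' where "d' = min d (min (t - a) (b - t)) / 2"
  have d': "0 < d'" "d' < d" "d' < t - a" "d' < b - t" using assms d by (auto simp: d'_def)
  show thesis
  proof (rule that[of d'])
    show "{t - d'<..<t + d'} \<inter> D = {}"
    proof (rule ccontr)
      assume "{t - d'<..<t + d'} \<inter> D \<noteq> {}"
      then obtain s where "t - d' < s" "s < t + d'" "s \<in> D" by auto
      then show False using d(2)[of s] d' by (auto simp: abs_less_iff)
    qed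
  qed (use d' in auto)
qed

locale traj = straightened +
  fixes I :: "real set" and \<gamma> :: "real \<Rightarrow> real^2" and D :: "real set"
  assumes I: "is_interval I" and cont\<gamma>: "continuous_on I \<gamma>" and \<gamma>U: "\<gamma> ` I \<subseteq> K ` V"
    and finD: "\<And>a b. a \<in> I \<Longrightarrow> b \<in> I \<Longrightarrow> finite (D \<inter> {a..b})"
    and arcs: "\<And>a b. a \<in> I \<Longrightarrow> b \<in> I \<Longrightarrow> a < b \<Longrightarrow> {a<..<b} \<inter> D = {} \<Longrightarrow>
      follows X (Sigma_plus \<U>) {a<..<b} \<gamma> \<or> follows Y (Sigma_minus \<U>) {a<..<b} \<gamma> \<or>
      follows (Z_Sigma \<U> (X, Y)) (Sigma_line \<U>) {a<..<b} \<gamma>"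
begin

lemma arc_at:
  assumes "a \<in> I" "b \<in> I" "a < t" "t < b" "t \<notin> D"
  obtains d where "d > 0" "{t - d..t + d} \<subseteq> {a..b}" "follows X (Sigma_plus \<U>) {t - d<..<t + d} \<gamma> \<or>
    follows Y (Sigma_minus \<U>) {t - d<..<t + d} \<gamma> \<or> follows (Z_Sigma \<U> (X, Y)) (Sigma_line \<U>) {t - d<..<t + d} \<gamma>"
proof -
  obtain d where d: "d > 0" "a < t - d" "t + d < b" "{t - d<..<t + d} \<inter> D = {}"
    using avoid_finite[OF finD[OF assms(1,2)] assms(3-5)] by blast
  have "t - d \<in> I" "t + d \<in> I" using is_interval_Icc[OF I assms(1,2)] d assms by auto
  from arcs[OF this _ d(4)] d show thesis by (intro that[of d]) auto
qed

text \<open>Arcs on the switching line are covered as well, because \<open>Z_Sigma\<close> takes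
  only values of \<open>X\<close> or \<open>Y\<close> there.\<close>

lemma deriv_bound:
  obtains C where "\<And>a b t. a \<in> I \<Longrightarrow> b \<in> I \<Longrightarrow> a < t \<Longrightarrow> t < b \<Longrightarrow> t \<notin> D \<Longrightarrow>
    \<exists>v. (\<gamma> has_vector_derivative v) (at t) \<and> norm v \<le> C * norm (\<gamma> t)"
proof -
  obtain C where C: "\<And>p. p \<in> K ` V \<Longrightarrow> norm (X p) \<le> C * norm p \<and> norm (Y p) \<le> C * norm p" using lip by blast
  show thesis
  proof (rule that[of C])
    fix a b t assume t: "a \<in> I" "b \<in> I" "a < t" "t < b" "t \<notin> D"
    obtain d where d: "d > 0" and fo: "follows X (Sigma_plus \<U>) {t - d<..<t + d} \<gamma> \<or>
      follows Y (Sigma_minus \<U>) {t - d<..<t + d} \<gamma> \<or> follows (Z_Sigma \<U> (X, Y)) (Sigma_line \<U>) {t - d<..<t + d} \<gamma>"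
      using arc_at[OF t] by metis
    have "t \<in> I" using is_interval_Icc[OF I t(1,2)] t by auto
    then have p: "\<gamma> t \<in> K ` V" using \<gamma>U by auto
    from fo have "(\<gamma> has_vector_derivative X (\<gamma> t)) (at t) \<or> (\<gamma> has_vector_derivative Y (\<gamma> t)) (at t) \<or>
        (\<gamma> t \<in> Sigma_line \<U> \<and> (\<gamma> has_vector_derivative Z_Sigma \<U> (X, Y) (\<gamma> t)) (at t))"
      using d by (auto simp: follows_def)
    then have "(\<gamma> has_vector_derivative X (\<gamma> t)) (at t) \<or> (\<gamma> has_vector_derivative Y (\<gamma> t)) (at t)"
      using Z_Sigma_values(1)[OF _ p] by auto
    then show "\<exists>v. (\<gamma> has_vector_derivative v) (at t) \<and> norm v \<le> C * norm (\<gamma> t)" using C[OF p] by blast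
  qed
qed

text \<open>The speed is at most a multiple of the distance to the equilibrium, so by Gronwall 0 can
  be neither reached nor left in finite time, switching included.\<close>

lemma zero_everywhere:
  assumes t0: "t0 \<in> I" "\<gamma> t0 = 0" and t: "t \<in> I"
  shows "\<gamma> t = 0"
proof -
  obtain C where C: "\<And>a b t. a \<in> I \<Longrightarrow> b \<in> I \<Longrightarrow> a < t \<Longrightarrow> t < b \<Longrightarrow> t \<notin> D \<Longrightarrow>
    \<exists>v. (\<gamma> has_vector_derivative v) (at t) \<and> norm v \<le> C * norm (\<gamma> t)" using deriv_bound by metis
  define v where "v t = (SOME v. (\<gamma> has_vector_derivative v) (at t) \<and> norm v \<le> C * norm (\<gamma> t))" for t
  define a b where "a = min t0 t" and "b = max t0 t"
  have ab: "a \<in> I" "b \<in> I" "t0 \<in> {a..b}" "t \<in> {a..b}" using t0 t by (auto simp: a_def b_def min_def max_def)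
  have v: "(\<gamma> has_vector_derivative v s) (at s) \<and> norm (v s) \<le> C * norm (\<gamma> s)"
    if "s \<in> {a<..<b} - (D \<inter> {a..b})" for s
    unfolding v_def by (rule someI_ex, rule C[OF ab(1,2)]) (use that in auto)
  show ?thesis
    by (rule gronwall_zero[OF continuous_on_subset[OF cont\<gamma> is_interval_Icc[OF I ab(1,2)]] finD[OF ab(1,2)] _ _ ab(3) t0(2) ab(4)])
      (use v in auto)
qed

end

locale traj_nz = traj +
  assumes nz: "\<And>t. t \<in> I \<Longrightarrow> \<gamma> t \<noteq> 0"
begin

section \<open>Monotonicity along a trajectory that avoids the origin\<close>

definition \<zeta> :: "real \<Rightarrow> real^2" where "\<zeta> t = E (\<gamma> t)"

lemma \<zeta>V: "t \<in> I \<Longrightarrow> \<zeta> t \<in> V" and K\<zeta>: "t \<in> I \<Longrightarrow> K (\<zeta> t) = \<gamma> t"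
  using \<gamma>U EV by (auto simp: \<zeta>_def)

lemma \<zeta>_nz: "t \<in> I \<Longrightarrow> \<zeta> t \<noteq> 0"
  using K\<zeta> \<zeta>V K_eq_0 nz by metis

lemma cont\<zeta>: "continuous_on I \<zeta>"
  unfolding \<zeta>_def by (rule continuous_on_compose2[OF contE cont\<gamma> \<gamma>U])

text \<open>An arc inside the switching line would have zero vertical velocity, whereas
  \<open>Z_Sigma\<close> has a nonzero vertical component off the origin. Every time off
  \<open>D\<close> thus belongs to an arc in an open half-plane.\<close>

lemma arc_half:
  assumes t: "a \<in> I" "b \<in> I" "a < t" "t < b" "t \<notin> D"
  obtains d y where "d > 0" "\<bar>y\<bar> = 1" "{t - d..t + d} \<subseteq> {a..b}"
    "\<And>s. \<bar>s - t\<bar> < d \<Longrightarrow> 0 < y * \<zeta> s $ 2 \<and> (\<gamma> has_vector_derivative fld y (\<gamma> s)) (at s)"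
proof -
  obtain d where d: "d > 0" "{t - d..t + d} \<subseteq> {a..b}" and fo: "follows X (Sigma_plus \<U>) {t - d<..<t + d} \<gamma> \<or>
      follows Y (Sigma_minus \<U>) {t - d<..<t + d} \<gamma> \<or> follows (Z_Sigma \<U> (X, Y)) (Sigma_line \<U>) {t - d<..<t + d} \<gamma>"
    using arc_at[OF t] by metis
  have dI: "s \<in> I" if "\<bar>s - t\<bar> < d" for s
  proof -
    have "s \<in> {t - d..t + d}" using that by (auto simp: abs_less_iff)
    then show ?thesis using is_interval_Icc[OF I t(1,2)] d(2) by blast
  qed
  have s2: "sgn (\<gamma> s $ 2) = sgn (\<zeta> s $ 2)" if "\<bar>s - t\<bar> < d" for s
    using sgnK[OF \<zeta>V[OF dI[OF that]]] K\<zeta>[OF dI[OF that]] by simp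
  have mem: "s \<in> {t - d<..<t + d}" if "\<bar>s - t\<bar> < d" for s using that by (auto simp: abs_less_iff)
  from fo show thesis
  proof (elim disjE)
    assume f: "follows X (Sigma_plus \<U>) {t - d<..<t + d} \<gamma>"
    show thesis
    proof (rule that[OF d(1), of 1])
      show "0 < 1 * \<zeta> s $ 2 \<and> (\<gamma> has_vector_derivative fld 1 (\<gamma> s)) (at s)" if "\<bar>s - t\<bar> < d" for s
        using bspec[OF f[unfolded follows_def] mem[OF that]] s2[OF that]
        by (auto simp: Sigma_plus_def fld_def sgn_if split: if_splits)
    qed (use d in auto)
  next
    assume f: "follows Y (Sigma_minus \<U>) {t - d<..<t + d} \<gamma>"
    show thesis
    proof (rule that[OF d(1), of "- 1"])
      show "0 < - 1 * \<zeta> s $ 2 \<and> (\<gamma> has_vector_derivative fld (- 1) (\<gamma> s)) (at s)" if "\<bar>s - t\<bar> < d" for s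
        using bspec[OF f[unfolded follows_def] mem[OF that]] s2[OF that]
        by (auto simp: Sigma_minus_def fld_def sgn_if split: if_splits)
    qed (use d in auto)
  next
    assume f: "follows (Z_Sigma \<U> (X, Y)) (Sigma_line \<U>) {t - d<..<t + d} \<gamma>"
    have tI: "t \<in> I" using dI[of t] d by auto
    have "(\<gamma> has_vector_derivative Z_Sigma \<U> (X, Y) (\<gamma> t)) (at t)" and tS: "\<gamma> t \<in> Sigma_line \<U>"
      using f d by (auto simp: follows_def)
    then have "((\<lambda>s. \<gamma> s $ 2) has_vector_derivative Z_Sigma \<U> (X, Y) (\<gamma> t) $ 2) (at t)"
      by (intro has_vector_derivative_nth)
    moreover have "((\<lambda>s. \<gamma> s $ 2) has_vector_derivative 0) (at t)"
      by (rule has_vector_derivative_transform_within_open[of "\<lambda>_. 0" _ _ "{t - d<..<t + d}"])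
        (use f d in \<open>auto simp: follows_def Sigma_line_def\<close>)
    ultimately have "Z_Sigma \<U> (X, Y) (\<gamma> t) $ 2 = 0" by (rule vector_derivative_unique_at)
    moreover have "\<gamma> t \<in> K ` V" using \<gamma>U tI by auto
    ultimately show thesis using Z_Sigma_values(2)[OF tS] nz[OF tI] by blast
  qed
qed

text \<open>A nonzero \<open>sig\<close> means that the point is in an open sector, where
  \<open>unique\<close> identifies the trajectory with straight-line motion.\<close>

lemma sig_kap_deriv:
  assumes t: "a \<in> I" "b \<in> I" "a < t" "t < b" "t \<notin> D" and s: "sig (\<zeta> t) \<noteq> 0"
  shows "((\<lambda>t. sig (\<zeta> t)) has_vector_derivative g (\<zeta> t)) (at t)"
    "((\<lambda>t. kap (\<zeta> t)) has_vector_derivative 0) (at t)" "0 < g (\<zeta> t)"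
proof -
  obtain d y where d: "d > 0" "\<bar>y\<bar> = 1" "{t - d..t + d} \<subseteq> {a..b}" and
    arc: "\<And>s. \<bar>s - t\<bar> < d \<Longrightarrow> 0 < y * \<zeta> s $ 2 \<and> (\<gamma> has_vector_derivative fld y (\<gamma> s)) (at s)"
    using arc_half[OF t] by metis
  have tI: "t \<in> I" using is_interval_Icc[OF I t(1,2)] t by auto
  have z: "\<zeta> t $ 1 \<noteq> 0" "\<zeta> t $ 2 \<noteq> 0" using s by (auto simp: sig_eq_0)
  show "0 < g (\<zeta> t)" by (rule g_pos[OF \<zeta>V[OF tI] z])
  have "fld y = fld (\<zeta> t $ 2)" using arc[of t] d(1,2) by (auto simp: fld_def zero_less_mult_iff)
  then have der: "(\<gamma> has_vector_derivative fld (\<zeta> t $ 2) (\<gamma> s)) (at s)" if "\<bar>s - t\<bar> < d" for s using arc[OF that] by simp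
  obtain d' \<theta> where d': "d' > 0" and \<theta>: "\<theta> t = 0" "(\<theta> has_real_derivative g (\<zeta> t)) (at t)" and
    eq: "\<And>s. \<bar>s - t\<bar> < d' \<Longrightarrow> \<exists>z'\<in>V. \<gamma> s = K z' \<and> kap z' = kap (\<zeta> t) \<and> sig z' = sig (\<zeta> t) + \<theta> s"
    using unique[OF \<zeta>V[OF tI] z d(1) K\<zeta>[OF tI, symmetric] der] by blast
  have eq': "kap (\<zeta> s) = kap (\<zeta> t) \<and> sig (\<zeta> s) = sig (\<zeta> t) + \<theta> s" if "s \<in> {t - d'<..<t + d'}" for s
  proof -
    have "\<bar>s - t\<bar> < d'" using that by (auto simp: abs_less_iff)
    from eq[OF this] obtain z' where z': "z' \<in> V" "\<gamma> s = K z'" "kap z' = kap (\<zeta> t)" "sig z' = sig (\<zeta> t) + \<theta> s" by blast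
    then have "\<zeta> s = z'" by (simp add: \<zeta>_def)
    then show ?thesis using z' by simp
  qed
  have "((\<lambda>s. sig (\<zeta> t) + \<theta> s) has_vector_derivative g (\<zeta> t)) (at t)"
    using \<theta>(2) by (auto intro!: derivative_eq_intros simp: has_real_derivative_iff_has_vector_derivative)
  then show "((\<lambda>t. sig (\<zeta> t)) has_vector_derivative g (\<zeta> t)) (at t)"
    by (rule has_vector_derivative_transform_within_open[of _ _ _ "{t - d'<..<t + d'}"])
      (use d' in simp_all, rule eq'[THEN conjunct2, symmetric], simp)
  show "((\<lambda>t. kap (\<zeta> t)) has_vector_derivative 0) (at t)"
    by (rule has_vector_derivative_transform_within_open[of "\<lambda>_. kap (\<zeta> t)" _ _ "{t - d'<..<t + d'}"])
      (use d' in simp_all, rule eq'[THEN conjunct1, symmetric], simp)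
qed

lemma sig_less_aux:
  assumes t: "a \<in> I" "b \<in> I" "a < b" and ne: "\<And>t. a < t \<Longrightarrow> t < b \<Longrightarrow> sig (\<zeta> t) \<noteq> 0"
  shows "sig (\<zeta> a) < sig (\<zeta> b)"
proof (rule pos_deriv_off_finite[OF t(3) _ finD[OF t(1,2)]])
  show "continuous_on {a..b} (\<lambda>t. sig (\<zeta> t))"
    by (intro continuous_on_sig continuous_on_subset[OF cont\<zeta>] is_interval_Icc I t)
  fix s assume "s \<in> {a<..<b} - D \<inter> {a..b}"
  then have s: "a < s" "s < b" "s \<notin> D" by auto
  show "((\<lambda>t. sig (\<zeta> t)) has_vector_derivative g (\<zeta> s)) (at s)" "0 < g (\<zeta> s)"
    using sig_kap_deriv[OF t(1,2) s ne[OF s(1,2)]] by auto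
qed

text \<open>If \<open>sig\<close> vanished on an interval, then by \<open>arc_half\<close> some
  piece would lie on \<open>z $ 1 = 0\<close> within one half-plane, which \<open>axis\<close>
  forbids.\<close>

lemma sig_nonzero_somewhere:
  assumes t: "a \<in> I" "b \<in> I" "a < b"
  shows "\<exists>t. a < t \<and> t < b \<and> sig (\<zeta> t) \<noteq> 0"
proof (rule ccontr)
  assume no: "\<not> (\<exists>t. a < t \<and> t < b \<and> sig (\<zeta> t) \<noteq> 0)"
  have "infinite ({a<..<b} - D \<inter> {a..b})"
    by (rule Diff_infinite_finite[OF finD[OF t(1,2)]]) (use t(3) in simp)
  then obtain t0 where "t0 \<in> {a<..<b} - D \<inter> {a..b}" using infinite_imp_nonempty by blast
  then have t0: "a < t0" "t0 < b" "t0 \<notin> D" by auto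
  obtain d y where d: "d > 0" "\<bar>y\<bar> = 1" "{t0 - d..t0 + d} \<subseteq> {a..b}" and
    arc: "\<And>s. \<bar>s - t0\<bar> < d \<Longrightarrow> 0 < y * \<zeta> s $ 2 \<and> (\<gamma> has_vector_derivative fld y (\<gamma> s)) (at s)"
    using arc_half[OF t(1,2) t0] by metis
  show False
  proof (rule axis[of "t0 - d" "t0 + d" y \<gamma>])
    fix s assume s: "t0 - d < s" "s < t0 + d"
    then have s': "\<bar>s - t0\<bar> < d" by (auto simp: abs_less_iff)
    have "a \<le> t0 - d" "t0 + d \<le> b" using d(1,3) by auto
    then have sab: "a < s" "s < b" using s by auto
    then have sI: "s \<in> I" using is_interval_Icc[OF I t(1,2)] by auto
    have "\<zeta> s $ 1 = 0" using no sab arc[OF s'] by (auto simp: sig_eq_0)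
    then show "(\<gamma> has_vector_derivative fld y (\<gamma> s)) (at s) \<and> (\<exists>z\<in>V. z $ 1 = 0 \<and> 0 < y * z $ 2 \<and> \<gamma> s = K z)"
      using arc[OF s'] \<zeta>V[OF sI] K\<zeta>[OF sI] by metis
  qed (use d in auto)
qed

text \<open>\<open>sig\<close> stays positive: at the first later time with a value at most 0 it
  would, having had no zero on the way, exceed its initial value.\<close>

lemma sig_pos_less:
  assumes t: "a \<in> I" "b \<in> I" "a < b" and pos: "0 < sig (\<zeta> a)"
  shows "sig (\<zeta> a) < sig (\<zeta> b)"
proof -
  have sub: "{a..b} \<subseteq> I" by (rule is_interval_Icc[OF I t(1,2)])
  have cont: "continuous_on {a..b} (\<lambda>t. sig (\<zeta> t))"
    by (intro continuous_on_sig continuous_on_subset[OF cont\<zeta> sub])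
  have all: "sig (\<zeta> t) > 0" if t': "t \<in> {a..b}" for t
  proof (rule ccontr)
    assume "\<not> 0 < sig (\<zeta> t)"
    define S where "S = {a..b} \<inter> (\<lambda>t. sig (\<zeta> t)) -` {..0}"
    have "closed S" unfolding S_def by (rule continuous_closed_preimage[OF cont]) auto
    moreover have "bounded S" unfolding S_def by (rule bounded_subset[of "{a..b}"]) auto
    ultimately have "compact S" using compact_eq_bounded_closed by blast
    moreover have "t \<in> S" using t' \<open>\<not> 0 < sig (\<zeta> t)\<close> by (auto simp: S_def)
    ultimately obtain s where s: "s \<in> S" "\<And>t. t \<in> S \<Longrightarrow> s \<le> t"
      using compact_attains_inf[of S] by blast
    have as: "a < s" "s \<in> I" using s(1) pos sub by (auto simp: S_def less_le)
    have "sig (\<zeta> a) < sig (\<zeta> s)"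
    proof (rule sig_less_aux[OF t(1) as(2) as(1)])
      fix u assume u: "a < u" "u < s"
      then have "u \<notin> S" using s(2)[of u] by auto
      then show "sig (\<zeta> u) \<noteq> 0" using u s(1) by (auto simp: S_def)
    qed
    then show False using s(1) pos by (auto simp: S_def)
  qed
  have "sig (\<zeta> u) \<noteq> 0" if "a < u" "u < b" for u using all[of u] that by auto
  then show ?thesis by (rule sig_less_aux[OF t])
qed

text \<open>The mirror image in time of \<open>sig_pos_less\<close>, with the last nonnegative value
  in place of the first nonpositive one.\<close>

lemma sig_neg_less:
  assumes t: "a \<in> I" "b \<in> I" "a < b" and neg: "sig (\<zeta> b) < 0"
  shows "sig (\<zeta> a) < sig (\<zeta> b)"
proof -
  have sub: "{a..b} \<subseteq> I" by (rule is_interval_Icc[OF I t(1,2)])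
  have cont: "continuous_on {a..b} (\<lambda>t. sig (\<zeta> t))"
    by (intro continuous_on_sig continuous_on_subset[OF cont\<zeta> sub])
  have all: "sig (\<zeta> t) < 0" if t': "t \<in> {a..b}" for t
  proof (rule ccontr)
    assume "\<not> sig (\<zeta> t) < 0"
    define S where "S = {a..b} \<inter> (\<lambda>t. sig (\<zeta> t)) -` {0..}"
    have "closed S" unfolding S_def by (rule continuous_closed_preimage[OF cont]) auto
    moreover have "bounded S" unfolding S_def by (rule bounded_subset[of "{a..b}"]) auto
    ultimately have "compact S" using compact_eq_bounded_closed by blast
    moreover have "t \<in> S" using t' \<open>\<not> sig (\<zeta> t) < 0\<close> by (auto simp: S_def)
    ultimately obtain s where s: "s \<in> S" "\<And>t. t \<in> S \<Longrightarrow> t \<le> s"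
      using compact_attains_sup[of S] by blast
    have sb: "s < b" "s \<in> I" using s(1) neg sub by (auto simp: S_def less_le)
    have "sig (\<zeta> s) < sig (\<zeta> b)"
    proof (rule sig_less_aux[OF sb(2) t(2) sb(1)])
      fix u assume u: "s < u" "u < b"
      then have "u \<notin> S" using s(2)[of u] by auto
      then show "sig (\<zeta> u) \<noteq> 0" using u s(1) by (auto simp: S_def)
    qed
    then show False using s(1) neg by (auto simp: S_def)
  qed
  have "sig (\<zeta> u) \<noteq> 0" if "a < u" "u < b" for u using all[of u] that by auto
  then show ?thesis by (rule sig_less_aux[OF t])
qed

text \<open>An intermediate time with nonzero \<open>sig\<close> splits the interval. If the value
  there is positive, \<open>sig_pos_less\<close> governs the later part, and the earlier part either
  starts at a value at most 0 or is governed by it too; the negative case is symmetric.\<close>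

lemma sig_less:
  assumes t: "a \<in> I" "b \<in> I" "a < b"
  shows "sig (\<zeta> a) < sig (\<zeta> b)"
proof -
  obtain s where s: "a < s" "s < b" "sig (\<zeta> s) \<noteq> 0" using sig_nonzero_somewhere[OF t] by blast
  have sI: "s \<in> I" using is_interval_Icc[OF I t(1,2)] s by auto
  show ?thesis
  proof (cases "sig (\<zeta> s) > 0")
    case True
    then have "sig (\<zeta> s) < sig (\<zeta> b)" using sig_pos_less[OF sI t(2) s(2)] by simp
    moreover have "sig (\<zeta> a) < sig (\<zeta> s)" using sig_pos_less[OF t(1) sI s(1)] True by linarith
    ultimately show ?thesis by simp
  next
    case False
    then have "sig (\<zeta> a) < sig (\<zeta> s)" using sig_neg_less[OF t(1) sI s(1)] s by simp
    moreover have "sig (\<zeta> s) < sig (\<zeta> b)" using sig_neg_less[OF sI t(2) s(2)] False s by linarith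
    ultimately show ?thesis by simp
  qed
qed

lemma strict_mono_sig: "strict_mono_on I (\<lambda>t. sig (\<zeta> t))"
  by (rule strict_mono_onI) (rule sig_less)

text \<open>Strict growth allows at most one zero, so the zeros can be added to the finite
  exceptional set when derivatives are integrated.\<close>

lemma finite_sig_zero: "finite {t \<in> I. sig (\<zeta> t) = 0}"
proof (cases "\<exists>t0\<in>I. sig (\<zeta> t0) = 0")
  case True
  then obtain t0 where t0: "t0 \<in> I" "sig (\<zeta> t0) = 0" by blast
  have "{t \<in> I. sig (\<zeta> t) = 0} \<subseteq> {t0}"
  proof
    fix t assume t: "t \<in> {t \<in> I. sig (\<zeta> t) = 0}"
    show "t \<in> {t0}"
      using sig_less[of t t0] sig_less[of t0 t] t t0 by (cases t t0 rule: linorder_cases) auto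
  qed
  then show ?thesis using finite_subset by blast
next
  case False
  then have no: "{t \<in> I. sig (\<zeta> t) = 0} = {}" by blast
  show ?thesis unfolding no by (rule finite.emptyI)
qed

lemma kap_const:
  assumes ab: "a \<in> I" "b \<in> I"
  shows "kap (\<zeta> a) = kap (\<zeta> b)"
proof -
  have le: "kap (\<zeta> a) = kap (\<zeta> b)" if ab: "a \<in> I" "b \<in> I" "a \<le> b" for a b
  proof (rule zero_deriv_off_finite[OF ab(3), where D = "(D \<inter> {a..b}) \<union> {t \<in> I. sig (\<zeta> t) = 0}"])
    show "continuous_on {a..b} (\<lambda>t. kap (\<zeta> t))"
      by (intro continuous_on_kap continuous_on_subset[OF cont\<zeta>] is_interval_Icc I ab)
    show "finite ((D \<inter> {a..b}) \<union> {t \<in> I. sig (\<zeta> t) = 0})" using finD[OF ab(1,2)] finite_sig_zero by simp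
    fix s assume s: "s \<in> {a<..<b} - ((D \<inter> {a..b}) \<union> {t \<in> I. sig (\<zeta> t) = 0})"
    then have "s \<in> I" using is_interval_Icc[OF I ab(1,2)] by auto
    then show "((\<lambda>t. kap (\<zeta> t)) has_vector_derivative 0) (at s)"
      using s by (intro sig_kap_deriv[OF ab(1,2)]) auto
  qed
  show ?thesis
  proof (cases "a \<le> b")
    case True
    then show ?thesis by (rule le[OF ab])
  next
    case False
    then show ?thesis using le[OF ab(2,1)] by linarith
  qed
qed

text \<open>The level is constant by \<open>kap_const\<close>, and at a fixed level the coordinate
  whose sign is \<open>branch\<close> never vanishes, so connectedness of \<open>I\<close> fixes the
  branch as well.\<close>

lemma canonical_form:
  assumes ne: "I \<noteq> {}"
  shows "\<exists>\<kappa> e e'. \<bar>e\<bar> = 1 \<and> \<bar>e'\<bar> = 1 \<and> (\<forall>t\<in>I. sig (\<zeta> t) \<in> cdom R \<kappa> e' \<and> \<zeta> t = cc \<kappa> e (sig (\<zeta> t)))"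
proof -
  obtain t0 where t0: "t0 \<in> I" using ne by blast
  define \<kappa> e where "\<kappa> = kap (\<zeta> t0)" and "e = branch (\<zeta> t0)"
  \<comment> \<open>At level 0 \<open>sig\<close> cannot vanish off the origin and keeps its sign.
    At other levels it may change sign, and 1 is a default on which \<open>cdom\<close> does not
    depend.\<close>
  define e' where "e' = (if \<kappa> = 0 then sgn (sig (\<zeta> t0)) else 1)"
  have k: "kap (\<zeta> t) = \<kappa>" if "t \<in> I" for t unfolding \<kappa>_def by (rule kap_const[OF that t0])
  have s0: "sig (\<zeta> t) \<noteq> 0" if "\<kappa> = 0" "t \<in> I" for t
    using \<zeta>_nz[OF that(2)] k[OF that(2)] that(1) by (auto simp: sig_eq_0 kap_def vec2_eq_iff)
  have br: "branch (\<zeta> t) = e" if t: "t \<in> I" for t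
  proof (cases "\<kappa> \<ge> 0")
    case True
    have nz: "\<zeta> u $ 1 \<noteq> 0" if "u \<in> I" for u
      using \<zeta>_nz[OF that] k[OF that] True by (auto simp: kap_def vec2_eq_iff)
    have c: "continuous_on I (\<lambda>t. \<zeta> t $ 1)" by (intro continuous_intros cont\<zeta>)
    have "sgn (\<zeta> t $ 1) = sgn (\<zeta> t0 $ 1)" by (rule sgn_const_on_interval[OF I c nz t t0])
    then show ?thesis using True k[OF t] k[OF t0] by (simp add: branch_def e_def)
  next
    case False
    have nz: "\<zeta> u $ 2 \<noteq> 0" if "u \<in> I" for u
      using \<zeta>_nz[OF that] k[OF that] False by (auto simp: kap_def vec2_eq_iff)
    have c: "continuous_on I (\<lambda>t. \<zeta> t $ 2)" by (intro continuous_intros cont\<zeta>)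
    have "sgn (\<zeta> t $ 2) = sgn (\<zeta> t0 $ 2)" by (rule sgn_const_on_interval[OF I c nz t t0])
    then show ?thesis using False k[OF t] k[OF t0] by (simp add: branch_def e_def)
  qed
  have sgn0: "sgn (sig (\<zeta> t)) = e'" if "\<kappa> = 0" "t \<in> I" for t
  proof -
    have "sgn (sig (\<zeta> t)) = sgn (sig (\<zeta> t0))"
      by (rule sgn_const_on_interval[OF I continuous_on_sig[OF cont\<zeta>] s0[OF that(1)] that(2) t0])
    then show ?thesis using that by (simp add: e'_def)
  qed
  show ?thesis
  proof (rule exI[of _ \<kappa>], rule exI[of _ e], rule exI[of _ e'], intro conjI ballI)
    show "\<bar>e\<bar> = 1" unfolding e_def by (rule abs_branch[OF \<zeta>_nz[OF t0]])
    show "\<bar>e'\<bar> = 1" using s0[OF _ t0] by (simp add: e'_def sgn_if)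
    fix t assume t: "t \<in> I"
    show "\<zeta> t = cc \<kappa> e (sig (\<zeta> t))" using cc_eq[OF \<zeta>_nz[OF t]] k[OF t] br[OF t] by simp
    have "\<bar>\<kappa>\<bar> + 2 * \<bar>sig (\<zeta> t)\<bar> < R" using \<zeta>V[OF t] kap_sig_norm[of "\<zeta> t"] k[OF t] by (simp add: V_def)
    moreover have "0 < e' * sig (\<zeta> t)" if "\<kappa> = 0"
      using sgn0[OF that t] s0[OF that t] by (auto simp: sgn_if split: if_splits)
    ultimately show "sig (\<zeta> t) \<in> cdom R \<kappa> e'" by (simp add: cdom_def)
  qed
qed

end

lemma (in straightened) trajectory_iff:
  "trajectory \<U> (X, Y) (K ` V) I \<gamma> \<longleftrightarrow> I \<noteq> {} \<and> (\<exists>D. traj \<U> X Y R K g I \<gamma> D)"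
proof -
  have 1: "(\<forall>a\<in>I. \<forall>b\<in>I. P a b) \<longleftrightarrow> (\<forall>a b. a \<in> I \<longrightarrow> b \<in> I \<longrightarrow> P a b)" for P by blast
  show ?thesis
    unfolding trajectory_def traj_def traj_axioms_def V_def[symmetric] 1 fst_conv snd_conv
    using straightened_axioms by (simp only: simp_thms) blast
qed

section \<open>Orbits and canonical curves\<close>

lemma antiderivative_Ioo:
  fixes k :: "real \<Rightarrow> real"
  assumes "a < b" "continuous_on {a<..<b} k"
  shows "\<exists>T. \<forall>s\<in>{a<..<b}. (T has_real_derivative k s) (at s)"
proof -
  obtain T where "\<forall>s :: real. ereal a < ereal s \<longrightarrow> ereal s < ereal b \<longrightarrow> (T has_vector_derivative k s) (at s)"
    using einterval_antiderivative[of "ereal a" "ereal b" k] assms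
    by (auto simp: continuous_on_eq_continuous_at)
  then show ?thesis by (intro exI[of _ T]) (auto simp: has_real_derivative_iff_has_vector_derivative)
qed

lemma sgn_cc:
  assumes "\<bar>e\<bar> = 1" "s \<noteq> 0"
  shows "sgn (cc \<kappa> e s $ 1) = (if \<kappa> \<ge> 0 then e else e * sgn s)"
    "sgn (cc \<kappa> e s $ 2) = (if \<kappa> \<ge> 0 then e * sgn s else e)"
proof -
  have e: "sgn e = e" using assms(1) by (auto simp: sgn_if abs_if split: if_splits)
  have p: "0 < \<kappa> + \<bar>s\<bar>" if "\<kappa> \<ge> 0" using that assms by auto
  have n: "0 < \<bar>s\<bar> - \<kappa>" if "\<not> \<kappa> \<ge> 0" using that by auto
  show "sgn (cc \<kappa> e s $ 1) = (if \<kappa> \<ge> 0 then e else e * sgn s)"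
    "sgn (cc \<kappa> e s $ 2) = (if \<kappa> \<ge> 0 then e * sgn s else e)"
    using p n by (simp_all add: cc_def sgn_mult e)
qed

lemma cc_nz:
  assumes "\<bar>e\<bar> = 1" "s \<noteq> 0"
  shows "cc \<kappa> e s $ 1 \<noteq> 0" "cc \<kappa> e s $ 2 \<noteq> 0"
proof -
  have "sig (cc \<kappa> e s) \<noteq> 0" using assms by (simp add: sig_cc)
  then show "cc \<kappa> e s $ 1 \<noteq> 0" "cc \<kappa> e s $ 2 \<noteq> 0" by (auto simp: sig_eq_0)
qed

text \<open>Links the parameter \<open>s\<close> to the straight-line motion in \<open>flow\<close>,
  on one side of \<open>s = 0\<close>.\<close>

lemma cc_line:
  assumes e: "\<bar>e\<bar> = 1" and s: "0 < s * s'"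
  shows "cc \<kappa> e s' = cc \<kappa> e s + (s' - s) *\<^sub>R vec2 (sgn (cc \<kappa> e s $ 2)) (sgn (cc \<kappa> e s $ 1))"
proof -
  have s0: "s \<noteq> 0" "sgn s' = sgn s" using s by (auto simp: zero_less_mult_iff)
  have a: "\<bar>s'\<bar> = \<bar>s\<bar> + (s' - s) * sgn s"
    using s by (auto simp: zero_less_mult_iff)
  show ?thesis
    unfolding sgn_cc[OF e s0(1)] by (simp add: cc_def vec2_eq_iff a algebra_simps)
qed

context straightened begin

lemma cc_nonzero: "\<bar>e\<bar> = 1 \<Longrightarrow> s \<in> cdom R \<kappa> e' \<Longrightarrow> cc \<kappa> e s \<noteq> 0"
proof -
  assume e: "\<bar>e\<bar> = 1" and s: "s \<in> cdom R \<kappa> e'"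
  have "\<kappa> \<noteq> 0 \<or> s \<noteq> 0" using s by (auto simp: cdom_def)
  then show ?thesis
  proof
    assume "\<kappa> \<noteq> 0"
    then have "kap (cc \<kappa> e s) \<noteq> 0" using e by (simp add: kap_cc)
    then show ?thesis by (auto simp: kap_def)
  next
    assume "s \<noteq> 0"
    then show ?thesis using cc_nz(1)[OF e] by (metis zero_index)
  qed
qed

text \<open>\<open>g\<close> may jump across the axes, but it extends continuously to each closed quadrant; hence the
  time \<open>T\<close> along a canonical orbit is obtained by integrating \<open>1/g\<close> on either side of \<open>s = 0\<close>.\<close>

lemma half_time:
  assumes e: "\<bar>e\<bar> = 1" and \<epsilon>: "\<bar>\<epsilon>\<bar> = 1"
  shows "\<exists>k. continuous_on {s \<in> cdom R \<kappa> e'. 0 \<le> \<epsilon> * s} k \<and> (\<forall>s\<in>cdom R \<kappa> e'. 0 < \<epsilon> * s \<longrightarrow> k s = 1 / g (cc \<kappa> e s))"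
proof -
  \<comment> \<open>The signs of the closed quadrant that contains the part of the curve with
    \<open>0 \<le> \<epsilon> * s\<close>.\<close>
  define e1 e2 where "e1 = (if \<kappa> \<ge> 0 then e else e * \<epsilon>)" and "e2 = (if \<kappa> \<ge> 0 then e * \<epsilon> else e)"
  have E: "\<bar>e1\<bar> = 1" "\<bar>e2\<bar> = 1" using e \<epsilon> by (simp_all add: e1_def e2_def abs_mult)
  obtain h where h: "continuous_on {z \<in> V. 0 \<le> e1 * z $ 1 \<and> 0 \<le> e2 * z $ 2 \<and> z \<noteq> 0} h"
    "\<And>z. z \<in> V \<Longrightarrow> 0 \<le> e1 * z $ 1 \<Longrightarrow> 0 \<le> e2 * z $ 2 \<Longrightarrow> z \<noteq> 0 \<Longrightarrow> 0 < h z"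
    "\<And>z. z \<in> V \<Longrightarrow> 0 < e1 * z $ 1 \<Longrightarrow> 0 < e2 * z $ 2 \<Longrightarrow> g z = h z"
    using g_ext[OF E] by blast
  have ee: "e * (e * x) = x" for x using e by (simp add: sign_mult)
  have comp: "e1 * cc \<kappa> e s $ 1 = (if \<kappa> \<ge> 0 then \<kappa> + \<bar>s\<bar> else \<epsilon> * s)"
    "e2 * cc \<kappa> e s $ 2 = (if \<kappa> \<ge> 0 then \<epsilon> * s else \<bar>s\<bar> - \<kappa>)" for s
    by (simp_all add: e1_def e2_def cc_def ee mult.assoc mult.left_commute[of \<epsilon> e])
  have mem: "cc \<kappa> e s \<in> {z \<in> V. 0 \<le> e1 * z $ 1 \<and> 0 \<le> e2 * z $ 2 \<and> z \<noteq> 0}" if "s \<in> cdom R \<kappa> e'" "0 \<le> \<epsilon> * s" for s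
    using cc_V[OF e that(1)] cc_nonzero[OF e that(1)] that(2) unfolding mem_Collect_eq comp by auto
  have hpos: "0 < h (cc \<kappa> e s)" if "s \<in> cdom R \<kappa> e'" "0 \<le> \<epsilon> * s" for s
    using mem[OF that] h(2) by auto
  show ?thesis
  proof (intro exI[of _ "\<lambda>s. 1 / h (cc \<kappa> e s)"] conjI ballI impI)
    have c: "continuous_on {s \<in> cdom R \<kappa> e'. 0 \<le> \<epsilon> * s} (\<lambda>s. h (cc \<kappa> e s))"
      by (rule continuous_on_compose2[OF h(1) continuous_on_cc]) (rule image_subsetI, rule mem, simp_all)
    have nz: "h (cc \<kappa> e s) \<noteq> 0" if "s \<in> {s \<in> cdom R \<kappa> e'. 0 \<le> \<epsilon> * s}" for s
      using hpos[of s] that by auto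
    show "continuous_on {s \<in> cdom R \<kappa> e'. 0 \<le> \<epsilon> * s} (\<lambda>s. 1 / h (cc \<kappa> e s))"
      by (rule continuous_on_divide[OF continuous_on_const c ballI[OF nz]])
    fix s assume s: "s \<in> cdom R \<kappa> e'" "0 < \<epsilon> * s"
    have "s \<noteq> 0" using s(2) by auto
    then have "0 < e1 * cc \<kappa> e s $ 1" "0 < e2 * cc \<kappa> e s $ 2" using s(2) unfolding comp by auto
    then show "1 / h (cc \<kappa> e s) = 1 / g (cc \<kappa> e s)" using h(3)[OF cc_V[OF e s(1)]] by simp
  qed
qed

lemma time_ex:
  assumes e: "\<bar>e\<bar> = 1" "\<bar>e'\<bar> = 1" and ne: "cdom R \<kappa> e' \<noteq> {}"
  shows "\<exists>T. continuous_on (cdom R \<kappa> e') T \<and>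
    (\<forall>s\<in>cdom R \<kappa> e'. s \<noteq> 0 \<longrightarrow> (T has_real_derivative 1 / g (cc \<kappa> e s)) (at s))"
proof (cases "\<kappa> = 0")
  case True
  define J where "J = cdom R \<kappa> e'"
  have pos: "0 < e' * s" if "s \<in> J" for s using that True by (auto simp: cdom_def J_def)
  obtain k where k: "continuous_on {s \<in> J. 0 \<le> e' * s} k" "\<And>s. s \<in> J \<Longrightarrow> 0 < e' * s \<Longrightarrow> k s = 1 / g (cc \<kappa> e s)"
    using half_time[OF e] unfolding J_def by blast
  \<comment> \<open>At level 0 the whole curve lies on the side \<open>e'\<close>, so a single half
    suffices.\<close>
  have "{s \<in> J. 0 \<le> e' * s} = J" using pos less_imp_le by blast
  then have k1: "continuous_on J k" using k(1) by simp
  obtain a b where ab: "J = {a<..<b}" "a < b"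
  proof -
    have "e' = 1 \<or> e' = - 1" using e(2) by linarith
    then have "J = {0<..<R / 2} \<or> J = {- R / 2<..<0}" unfolding J_def cdom_eq using True by auto
    then show thesis using R that[of 0 "R / 2"] that[of "- R / 2" 0] by auto
  qed
  obtain T where T: "\<And>s. s \<in> J \<Longrightarrow> (T has_real_derivative k s) (at s)"
    using antiderivative_Ioo[OF ab(2), of k] k1 unfolding ab(1) by blast
  have T': "(T has_real_derivative 1 / g (cc \<kappa> e s)) (at s)" if "s \<in> J" for s
    using T[OF that] k(2)[OF that pos[OF that]] by simp
  then have "continuous_on J T"
    by (intro continuous_at_imp_continuous_on ballI DERIV_isCont) auto
  then show ?thesis using T' unfolding J_def by blast
next
  case False
  define r where "r = (R - \<bar>\<kappa>\<bar>) / 2"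
  define J where "J = cdom R \<kappa> e'"
  have J: "J = {- r<..<r}" using False by (simp add: J_def cdom_eq r_def minus_divide_left)
  have r: "0 < r" using ne unfolding J_def[symmetric] J by auto
  obtain k1 where k1: "continuous_on {s \<in> J. 0 \<le> 1 * s} k1" "\<And>s. s \<in> J \<Longrightarrow> 0 < 1 * s \<Longrightarrow> k1 s = 1 / g (cc \<kappa> e s)"
    using half_time[OF e(1) abs_one] unfolding J_def by blast
  obtain k2 where k2: "continuous_on {s \<in> J. 0 \<le> - 1 * s} k2" "\<And>s. s \<in> J \<Longrightarrow> 0 < - 1 * s \<Longrightarrow> k2 s = 1 / g (cc \<kappa> e s)"
  proof -
    have "\<bar>- 1 :: real\<bar> = 1" by simp
    from half_time[OF e(1) this, of \<kappa> e'] show thesis using that unfolding J_def by blast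
  qed
  \<comment> \<open>Freezing the argument at 0 extends \<open>k1\<close> continuously to negative
    \<open>s\<close>, so that an antiderivative exists on the whole interval.\<close>
  have "continuous_on {- r<..<r} (\<lambda>s. k1 (max 0 s))"
    by (rule continuous_on_compose2[OF k1(1)]) (use r in \<open>auto intro!: continuous_intros simp: J\<close>)
  with r have "\<exists>T1. \<forall>s\<in>{- r<..<r}. (T1 has_real_derivative k1 (max 0 s)) (at s)"
    by (intro antiderivative_Ioo) simp_all
  then obtain T1 where T1: "\<And>s. s \<in> {- r<..<r} \<Longrightarrow> (T1 has_real_derivative k1 (max 0 s)) (at s)" by blast
  have "continuous_on {- r<..<r} (\<lambda>s. k2 (min 0 s))"
    by (rule continuous_on_compose2[OF k2(1)]) (use r in \<open>auto intro!: continuous_intros simp: J\<close>)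
  with r have "\<exists>T2. \<forall>s\<in>{- r<..<r}. (T2 has_real_derivative k2 (min 0 s)) (at s)"
    by (intro antiderivative_Ioo) simp_all
  then obtain T2 where T2: "\<And>s. s \<in> {- r<..<r} \<Longrightarrow> (T2 has_real_derivative k2 (min 0 s)) (at s)" by blast
  \<comment> \<open>Each summand is constant on the side of 0 belonging to the other, so
    \<open>T\<close> is continuous at 0 and has the required derivative on both sides.\<close>
  define T where "T s = T1 (max 0 s) + T2 (min 0 s)" for s
  have c1: "continuous_on {- r<..<r} T1" and c2: "continuous_on {- r<..<r} T2"
    by (intro continuous_at_imp_continuous_on ballI DERIV_isCont[OF T1] DERIV_isCont[OF T2]; simp)+
  have "continuous_on {- r<..<r} T"
    unfolding T_def
    by (intro continuous_on_add continuous_on_compose2[OF c1] continuous_on_compose2[OF c2])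
      (use r in \<open>auto intro!: continuous_intros\<close>)
  moreover have "(T has_real_derivative 1 / g (cc \<kappa> e s)) (at s)" if s: "s \<in> {- r<..<r}" "s \<noteq> 0" for s
  proof (cases "s > 0")
    case True
    have "((\<lambda>s. T1 s + T2 0) has_real_derivative k1 (max 0 s)) (at s)"
      using T1[OF s(1)] by (auto intro!: derivative_eq_intros)
    moreover have "k1 (max 0 s) = 1 / g (cc \<kappa> e s)" using k1(2)[of s] s True J by simp
    ultimately have "((\<lambda>s. T1 s + T2 0) has_real_derivative 1 / g (cc \<kappa> e s)) (at s)" by simp
    then show ?thesis
      by (rule DERIV_cong_ev[THEN iffD1, rotated -1, OF _ refl _ refl])
        (use True in \<open>auto simp: T_def intro!: eventually_mono[OF eventually_nhds_in_open[of "{0<..}" s]]\<close>)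
  next
    case False
    then have s0: "s < 0" using s by simp
    have "((\<lambda>s. T1 0 + T2 s) has_real_derivative k2 (min 0 s)) (at s)"
      using T2[OF s(1)] by (auto intro!: derivative_eq_intros)
    moreover have "k2 (min 0 s) = 1 / g (cc \<kappa> e s)" using k2(2)[of s] s s0 J by simp
    ultimately have "((\<lambda>s. T1 0 + T2 s) has_real_derivative 1 / g (cc \<kappa> e s)) (at s)" by simp
    then show ?thesis
      by (rule DERIV_cong_ev[THEN iffD1, rotated -1, OF _ refl _ refl])
        (use s0 in \<open>auto simp: T_def intro!: eventually_mono[OF eventually_nhds_in_open[of "{..<0}" s]]\<close>)
  qed
  ultimately show ?thesis unfolding J_def[symmetric] J by blast
qed

lemma flow_cc:
  assumes e: "\<bar>e\<bar> = 1" and s: "s \<in> cdom R \<kappa> e'" "s \<noteq> 0"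
  shows "((\<lambda>s. K (cc \<kappa> e s)) has_vector_derivative (1 / g (cc \<kappa> e s)) *\<^sub>R fld (cc \<kappa> e s $ 2) (K (cc \<kappa> e s))) (at s)"
proof -
  define z where "z = cc \<kappa> e s"
  define d where "d = vec2 (sgn (z $ 2)) (sgn (z $ 1))"
  have zV: "z \<in> V" and z: "z $ 1 \<noteq> 0" "z $ 2 \<noteq> 0"
    unfolding z_def using cc_V[OF e s(1)] cc_nz[OF e s(2)] by auto
  have "((\<lambda>t. K (z + t *\<^sub>R d)) has_vector_derivative (1 / g z) *\<^sub>R fld (z $ 2) (K z)) (at (s - s))"
    using flow[OF zV z] by (simp add: d_def)
  moreover have "((\<lambda>t. t - s) has_vector_derivative 1) (at s)" by (auto intro!: derivative_eq_intros)
  ultimately have "((\<lambda>t. K (z + (t - s) *\<^sub>R d)) has_vector_derivative 1 *\<^sub>R (1 / g z) *\<^sub>R fld (z $ 2) (K z)) (at s)"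
    using vector_diff_chain_at[of "\<lambda>t. t - s" 1 s "\<lambda>t. K (z + t *\<^sub>R d)"] by (simp add: o_def)
  then have der: "((\<lambda>t. K (z + (t - s) *\<^sub>R d)) has_vector_derivative (1 / g z) *\<^sub>R fld (z $ 2) (K z)) (at s)" by simp
  have op: "open {t. 0 < s * t}" by (intro open_Collect_less continuous_intros)
  have "((\<lambda>s. K (cc \<kappa> e s)) has_vector_derivative (1 / g z) *\<^sub>R fld (z $ 2) (K z)) (at s)"
  proof (rule has_vector_derivative_transform_within_open[OF der op])
    show "s \<in> {t. 0 < s * t}" using s(2) by (simp add: zero_less_mult_iff) linarith
    show "K (z + (t - s) *\<^sub>R d) = K (cc \<kappa> e t)" if "t \<in> {t. 0 < s * t}" for t
      using cc_line[OF e, of s t \<kappa>] that by (simp add: z_def d_def)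
  qed
  then show ?thesis by (simp add: z_def)
qed

lemma g_cc_pos: "\<bar>e\<bar> = 1 \<Longrightarrow> s \<in> cdom R \<kappa> e' \<Longrightarrow> s \<noteq> 0 \<Longrightarrow> 0 < g (cc \<kappa> e s)"
  by (intro g_pos cc_V cc_nz)

end

text \<open>\<open>T s\<close> is the time at which the canonical curve passes the parameter
  \<open>s\<close>. Only its derivative is prescribed: the free additive constant is what allows
  \<open>orbit_curve\<close> to synchronise the curve with a given orbit.\<close>

locale timed = straightened +
  fixes \<kappa> e e' :: real and T :: "real \<Rightarrow> real" and J
  defines "J \<equiv> cdom R \<kappa> e'"
  assumes e: "\<bar>e\<bar> = 1" "\<bar>e'\<bar> = 1" and J_ne: "J \<noteq> {}" and contT: "continuous_on J T"
    and derT: "\<And>s. s \<in> J \<Longrightarrow> s \<noteq> 0 \<Longrightarrow> (T has_real_derivative 1 / g (cc \<kappa> e s)) (at s)"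
begin

section \<open>Canonical curves parametrised by time\<close>

lemma J: "open J" "is_interval J"
  unfolding J_def by (rule open_cdom interval_cdom)+

lemma T_less:
  assumes "a \<in> J" "b \<in> J" "a < b"
  shows "T a < T b"
proof (rule pos_deriv_off_finite[OF assms(3), of T "{0}" "\<lambda>s. 1 / g (cc \<kappa> e s)"])
  have sub: "{a..b} \<subseteq> J" by (rule is_interval_Icc[OF J(2) assms(1,2)])
  then show "continuous_on {a..b} T" using contT continuous_on_subset by blast
  fix s assume s: "s \<in> {a<..<b} - {0}"
  then have "s \<in> J" "s \<noteq> 0" using sub by auto
  then show "(T has_vector_derivative 1 / g (cc \<kappa> e s)) (at s)" "0 < 1 / g (cc \<kappa> e s)"
    using derT[of s] g_cc_pos[OF e(1), of s \<kappa> e'] by (auto simp: has_real_derivative_iff_has_vector_derivative J_def)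
qed simp

lemma injT: "inj_on T J"
  using T_less by (metis inj_onI linorder_less_linear less_irrefl)

definition \<tau> :: "real \<Rightarrow> real" where "\<tau> = inv_into J T"

definition \<eta> :: "real \<Rightarrow> real^2" where "\<eta> t = K (cc \<kappa> e (\<tau> t))"

lemma \<tau>J: "t \<in> T ` J \<Longrightarrow> \<tau> t \<in> J" and T\<tau>: "t \<in> T ` J \<Longrightarrow> T (\<tau> t) = t" and \<tau>T: "s \<in> J \<Longrightarrow> \<tau> (T s) = s"
  using injT by (auto simp: \<tau>_def inv_into_into f_inv_into_f)

lemma open_TJ: "open (T ` J)"
  by (rule invariance_of_domain[OF contT J(1) injT])

lemma interval_TJ: "is_interval (T ` J)"
  using connected_continuous_image[OF contT is_interval_connected[OF J(2)]] by (simp add: is_interval_connected_1)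

lemma cont\<tau>: "continuous_on (T ` J) \<tau>"
proof -
  obtain h where h: "homeomorphism J (T ` J) T h"
    using invariance_of_domain_homeomorphism[OF J(1) contT _ injT] by auto
  have "h t = \<tau> t" if "t \<in> T ` J" for t
    using that h \<tau>T by (auto simp: homeomorphism_def)
  then show ?thesis using h unfolding homeomorphism_def by (metis continuous_on_cong)
qed

lemma strict_mono_\<tau>: "strict_mono_on (T ` J) \<tau>"
proof (rule strict_mono_onI)
  fix t u assume tu: "t \<in> T ` J" "u \<in> T ` J" "t < u"
  show "\<tau> t < \<tau> u"
  proof (rule ccontr)
    assume "\<not> \<tau> t < \<tau> u"
    then have "T (\<tau> u) \<le> T (\<tau> t)"
      using T_less[OF \<tau>J[OF tu(2)] \<tau>J[OF tu(1)]] by (cases "\<tau> u = \<tau> t") auto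
    then show False using T\<tau> tu by simp
  qed
qed

lemma \<tau>_image: "\<tau> ` (T ` J) = J"
  using \<tau>T \<tau>J by force

lemma \<eta>_deriv:
  assumes t: "t \<in> T ` J" "\<tau> t \<noteq> 0"
  shows "(\<eta> has_vector_derivative fld (cc \<kappa> e (\<tau> t) $ 2) (\<eta> t)) (at t)"
proof -
  obtain d where d: "d > 0" "ball t d \<subseteq> T ` J" using open_TJ t(1) open_contains_ball by blast
  have gp: "0 < g (cc \<kappa> e (\<tau> t))" using g_cc_pos[OF e(1)] \<tau>J[OF t(1)] t(2) by (simp add: J_def)
  have "(\<tau> has_real_derivative inverse (1 / g (cc \<kappa> e (\<tau> t)))) (at t)"
  proof (rule DERIV_inverse_function[where f = T and a = "t - d" and b = "t + d"])
    show "(T has_real_derivative 1 / g (cc \<kappa> e (\<tau> t))) (at (\<tau> t))" by (rule derT[OF \<tau>J[OF t(1)] t(2)])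
    show "1 / g (cc \<kappa> e (\<tau> t)) \<noteq> 0" using gp by simp
    show "T (\<tau> y) = y" if "t - d < y" "y < t + d" for y
      by (rule T\<tau>) (use that d(2) in \<open>auto simp: subset_iff dist_real_def\<close>)
    show "isCont \<tau> t" using cont\<tau> open_TJ t(1) continuous_on_eq_continuous_at by blast
  qed (use d in auto)
  then have 1: "(\<tau> has_vector_derivative g (cc \<kappa> e (\<tau> t))) (at t)"
    by (simp add: has_real_derivative_iff_has_vector_derivative)
  have 2: "((\<lambda>s. K (cc \<kappa> e s)) has_vector_derivative (1 / g (cc \<kappa> e (\<tau> t))) *\<^sub>R fld (cc \<kappa> e (\<tau> t) $ 2) (\<eta> t)) (at (\<tau> t))"
    unfolding \<eta>_def by (rule flow_cc[OF e(1)]) (use \<tau>J[OF t(1)] t(2) in \<open>auto simp: J_def\<close>)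
  have "g (cc \<kappa> e (\<tau> t)) *\<^sub>R (1 / g (cc \<kappa> e (\<tau> t))) *\<^sub>R v = v" for v :: "real^2" using gp by simp
  then show ?thesis using vector_diff_chain_at[OF 1 2] by (simp add: o_def \<eta>_def[abs_def])
qed

lemma \<eta>_nz: "t \<in> T ` J \<Longrightarrow> \<eta> t \<noteq> 0"
  using K_eq_0 cc_V[OF e(1)] cc_nonzero[OF e(1)] \<tau>J unfolding \<eta>_def J_def by metis

text \<open>The curve meets an axis only at \<open>s = 0\<close>. For positive
  \<open>\<kappa>\<close> this is a crossing of the switching line; for negative
  \<open>\<kappa>\<close> it is a passage through \<open>z $ 1 = 0\<close> inside a half-plane, and
  listing it in \<open>D\<close> avoids a smoothness proof there.\<close>

lemma traj_\<eta>: "traj \<U> X Y R K g (T ` J) \<eta> (if 0 \<in> J then {T 0} else {})"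
proof (unfold_locales, fold V_def)
  show "is_interval (T ` J)" by (rule interval_TJ)
  have mem: "cc \<kappa> e (\<tau> t) \<in> V" if "t \<in> T ` J" for t
    using cc_V[OF e(1)] \<tau>J[OF that] by (simp add: J_def)
  show "continuous_on (T ` J) \<eta>" unfolding \<eta>_def
    by (rule continuous_on_compose2[OF contK continuous_on_compose2[OF continuous_on_cc cont\<tau>]]) (use mem in auto)
  show "\<eta> ` T ` J \<subseteq> K ` V" unfolding \<eta>_def using mem by blast
  show "finite ((if 0 \<in> J then {T 0} else {}) \<inter> {a..b})" for a b by simp
  fix a b assume ab: "a \<in> T ` J" "b \<in> T ` J" "a < b" and no: "{a<..<b} \<inter> (if 0 \<in> J then {T 0} else {}) = {}"
  have sub: "{a<..<b} \<subseteq> T ` J" using is_interval_Icc[OF interval_TJ ab(1,2)] by auto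
  have nz: "\<tau> t \<noteq> 0" if t: "t \<in> {a<..<b}" for t
  proof
    assume 0: "\<tau> t = 0"
    have tJ: "t \<in> T ` J" using sub t by blast
    have "0 \<in> J" "t = T 0" using \<tau>J[OF tJ] T\<tau>[OF tJ] 0 by auto
    then show False using no t by auto
  qed
  have int: "is_interval {a<..<b}" by (simp add: is_interval_1)
  have sgn\<tau>: "sgn (\<tau> t) = sgn (\<tau> u)" if "t \<in> {a<..<b}" "u \<in> {a<..<b}" for t u
    by (rule sgn_const_on_interval[OF int continuous_on_subset[OF cont\<tau> sub] nz that])
  obtain m where m: "m \<in> {a<..<b}" using dense[OF ab(3)] by auto
  define y where "y = sgn (cc \<kappa> e (\<tau> m) $ 2)"
  have y: "sgn (cc \<kappa> e (\<tau> t) $ 2) = y" if t: "t \<in> {a<..<b}" for t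
    unfolding y_def sgn_cc(2)[OF e(1) nz[OF t]] sgn_cc(2)[OF e(1) nz[OF m]] using sgn\<tau>[OF t m] by simp
  have y0: "y \<noteq> 0" unfolding y_def using cc_nz(2)[OF e(1) nz[OF m]] by (simp add: sgn_zero_iff)
  have pt: "\<eta> t \<in> \<U> \<and> sgn (\<eta> t $ 2) = y \<and> (\<eta> has_vector_derivative fld y (\<eta> t)) (at t)" if t: "t \<in> {a<..<b}" for t
  proof -
    have tJ: "t \<in> T ` J" using sub t by blast
    have "fld (cc \<kappa> e (\<tau> t) $ 2) = fld y" unfolding y[OF t, symmetric] by (simp add: fld_def sgn_if)
    then have "(\<eta> has_vector_derivative fld y (\<eta> t)) (at t)" using \<eta>_deriv[OF tJ nz[OF t]] by simp
    moreover have "sgn (\<eta> t $ 2) = y" unfolding \<eta>_def using sgnK[OF mem[OF tJ]] y[OF t] by simp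
    moreover have "\<eta> t \<in> \<U>" unfolding \<eta>_def using KU mem[OF tJ] by blast
    ultimately show ?thesis by simp
  qed
  show "follows X (Sigma_plus \<U>) {a<..<b} \<eta> \<or> follows Y (Sigma_minus \<U>) {a<..<b} \<eta> \<or>
      follows (Z_Sigma \<U> (X, Y)) (Sigma_line \<U>) {a<..<b} \<eta>"
  proof (cases "y > 0")
    case True
    have "0 < \<eta> t $ 2" if "t \<in> {a<..<b}" for t using pt[OF that] True by (metis sgn_greater)
    then have "follows X (Sigma_plus \<U>) {a<..<b} \<eta>"
      unfolding follows_def Sigma_plus_def using pt True by (simp add: fld_def)
    then show ?thesis by simp
  next
    case False
    then have "y < 0" using y0 by simp
    then have "\<eta> t $ 2 < 0" if "t \<in> {a<..<b}" for t using pt[OF that] by (metis sgn_less)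
    then have "follows Y (Sigma_minus \<U>) {a<..<b} \<eta>"
      unfolding follows_def Sigma_minus_def using pt False by (simp add: fld_def)
    then show ?thesis by simp
  qed
qed

lemma trajectory_\<eta>: "trajectory \<U> (X, Y) (K ` V) (T ` J) \<eta>"
  unfolding trajectory_iff using traj_\<eta> J_ne by blast

end

context straightened begin

lemma nonzero_trajectory:
  assumes "trajectory \<U> (X, Y) (K ` V) I \<gamma>" "t0 \<in> I" "\<gamma> t0 \<noteq> 0"
  obtains D where "traj_nz \<U> X Y R K g I \<gamma> D"
proof -
  obtain D where D: "traj \<U> X Y R K g I \<gamma> D" using assms(1) unfolding trajectory_iff by blast
  have "\<gamma> t \<noteq> 0" if "t \<in> I" for t using traj.zero_everywhere[OF D that _ assms(2)] assms(3) by blast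
  then show thesis using D that[of D] by (simp add: traj_nz_def traj_nz_axioms_def)
qed

end

lemma (in timed) orbit_\<eta>: "orbit \<U> (X, Y) (K ` V) (T ` J) \<eta>"
  unfolding orbit_def
proof (intro conjI allI impI trajectory_\<eta>)
  fix I \<delta> assume "trajectory \<U> (X, Y) (K ` V) I \<delta> \<and> T ` J \<subseteq> I \<and> (\<forall>t\<in>T ` J. \<delta> t = \<eta> t)"
  then have \<delta>: "trajectory \<U> (X, Y) (K ` V) I \<delta>" and sub: "T ` J \<subseteq> I" and eq: "\<And>t. t \<in> T ` J \<Longrightarrow> \<delta> t = \<eta> t" by auto
  obtain s0 where s0: "s0 \<in> J" using J_ne by blast
  have t0: "T s0 \<in> T ` J" using s0 by simp
  obtain D where D: "traj_nz \<U> X Y R K g I \<delta> D"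
    using nonzero_trajectory[OF \<delta> subsetD[OF sub t0]] eq[OF t0] \<eta>_nz[OF t0] by metis
  interpret d: traj_nz \<U> X Y R K g V fld I \<delta> D by (rule D V_def fld_def)+
  obtain \<kappa>1 e1 e1' where c: "\<bar>e1\<bar> = 1" "\<bar>e1'\<bar> = 1"
    "\<And>t. t \<in> I \<Longrightarrow> sig (d.\<zeta> t) \<in> cdom R \<kappa>1 e1' \<and> d.\<zeta> t = cc \<kappa>1 e1 (sig (d.\<zeta> t))"
    using d.canonical_form subsetD[OF sub t0] by blast
  have d\<zeta>: "d.\<zeta> t = cc \<kappa> e (\<tau> t)" if "t \<in> T ` J" for t
    unfolding d.\<zeta>_def eq[OF that] \<eta>_def by (rule EK) (use cc_V[OF e(1)] \<tau>J[OF that] in \<open>simp add: J_def V_def\<close>)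
  have \<kappa>1: "\<kappa>1 = \<kappa>"
    using c(3)[OF subsetD[OF sub t0]] d\<zeta>[OF t0] kap_cc[OF c(1)] kap_cc[OF e(1)] by metis
  \<comment> \<open>At level 0 the overlap at \<open>T s0\<close> forces the same half of the
    diagonal.\<close>
  have e1': "cdom R \<kappa>1 e1' = J"
  proof (cases "\<kappa> = 0")
    case True
    have "s0 \<in> cdom R \<kappa> e1'"
      using c(3)[OF subsetD[OF sub t0]] unfolding d\<zeta>[OF t0] \<tau>T[OF s0] sig_cc[OF e(1)] \<kappa>1 by simp
    then have "0 < e1' * s0" "0 < e' * s0" using s0 True by (auto simp: J_def cdom_def)
    then have "sgn e1' = sgn e'" by (auto simp: zero_less_mult_iff)
    then have "e1' = e'" using c(2) e(2) by (auto simp: sgn_if abs_if split: if_splits)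
    then show ?thesis by (simp add: J_def \<kappa>1)
  next
    case False
    then show ?thesis by (simp add: J_def \<kappa>1 cdom_def)
  qed
  show "I = T ` J"
  proof
    show "I \<subseteq> T ` J"
    proof
      fix t assume t: "t \<in> I"
      define s where "s = sig (d.\<zeta> t)"
      have s: "s \<in> J" using c(3)[OF t] e1' by (simp add: s_def)
      then have sJ: "T s \<in> T ` J" by simp
      have "sig (d.\<zeta> (T s)) = s" unfolding d\<zeta>[OF sJ] \<tau>T[OF s] sig_cc[OF e(1)] ..
      then have "t = T s"
        using d.sig_less[OF t subsetD[OF sub sJ]] d.sig_less[OF subsetD[OF sub sJ] t] s_def
        by (metis less_irrefl linorder_less_linear)
      then show "t \<in> T ` J" using sJ by simp
    qed
  qed (rule sub)
qed

text \<open>The equilibrium is parametrised by all of \<open>UNIV\<close> because as a maximal orbit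
  it lasts forever, and comparison with another orbit needs a strictly increasing map between the
  two domains.\<close>

definition canonical_curve :: "real \<Rightarrow> real set \<Rightarrow> (real \<Rightarrow> real^2) \<Rightarrow> bool" where
  "canonical_curve R J c \<longleftrightarrow> (J = UNIV \<and> c = (\<lambda>_. 0)) \<or>
    (\<exists>\<kappa> e e'. \<bar>e\<bar> = 1 \<and> \<bar>e'\<bar> = 1 \<and> J = cdom R \<kappa> e' \<and> J \<noteq> {} \<and> c = cc \<kappa> e)"

context straightened begin

lemma zero_orbit: "orbit \<U> (X, Y) (K ` V) UNIV (\<lambda>_. 0)"
proof -
  have 0: "0 \<in> K ` V" using K0 zero_V by (metis imageI)
  then have 0: "0 \<in> K ` V" "0 \<in> Sigma_line \<U>" using KU by (auto simp: Sigma_line_def)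
  have "Z_Sigma \<U> (X, Y) 0 = 0" using Z_Sigma_values(1)[OF 0(2,1)] fld0 by auto
  then have "follows (Z_Sigma \<U> (X, Y)) (Sigma_line \<U>) {a<..<b} (\<lambda>_. 0)" for a b
    using 0 by (simp add: follows_def)
  then show ?thesis
    unfolding orbit_def trajectory_def using 0 by (auto intro!: exI[of _ "{}"])
qed

lemma curve_orbit:
  assumes "canonical_curve R J c"
  shows "\<exists>I \<gamma> \<tau>. orbit \<U> (X, Y) (K ` V) I \<gamma> \<and> strict_mono_on I \<tau> \<and> \<tau> ` I = J \<and> (\<forall>t\<in>I. c (\<tau> t) \<in> V \<and> \<gamma> t = K (c (\<tau> t)))"
  using assms unfolding canonical_curve_def
proof (elim disjE exE conjE)
  assume J: "J = UNIV" "c = (\<lambda>_. 0)"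
  show ?thesis
  proof (intro exI conjI)
    show "orbit \<U> (X, Y) (K ` V) UNIV (\<lambda>_. 0)" by (rule zero_orbit)
    show "strict_mono_on UNIV (\<lambda>t. t)" by (rule strict_mono_onI)
    show "(\<lambda>t. t) ` UNIV = J" using J by simp
    show "\<forall>t\<in>UNIV. c t \<in> V \<and> 0 = K (c t)" using J K0 zero_V by simp
  qed
next
  fix \<kappa> e e' assume e: "\<bar>e\<bar> = 1" "\<bar>e'\<bar> = 1" and J: "J = cdom R \<kappa> e'" "J \<noteq> {}" and c: "c = cc \<kappa> e"
  obtain T where T: "continuous_on J T" "\<And>s. s \<in> J \<Longrightarrow> s \<noteq> 0 \<Longrightarrow> (T has_real_derivative 1 / g (cc \<kappa> e s)) (at s)"
    using time_ex[OF e] J by blast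
  have tm: "timed \<U> X Y R K g \<kappa> e e' T"
    by (unfold_locales, fold J(1)) (simp_all add: e J(2) T)
  interpret t: timed \<U> X Y R K g V fld \<kappa> e e' T J
    by (rule tm V_def fld_def eq_reflection[OF J(1)])+
  show ?thesis
  proof (intro exI conjI ballI)
    show "orbit \<U> (X, Y) (K ` V) (T ` J) t.\<eta>" by (rule t.orbit_\<eta>)
    show "strict_mono_on (T ` J) t.\<tau>" by (rule t.strict_mono_\<tau>)
    show "t.\<tau> ` T ` J = J" by (rule t.\<tau>_image)
    fix s assume "s \<in> T ` J"
    then have "t.\<tau> s \<in> J" by (rule t.\<tau>J)
    then show "c (t.\<tau> s) \<in> V" using cc_V[OF e(1)] unfolding c J(1) by blast
    show "t.\<eta> s = K (c (t.\<tau> s))" unfolding c t.\<eta>_def ..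
  qed
qed

text \<open>Along the orbit \<open>T0 (f t) - t\<close> is constant, where \<open>f\<close> is its
  \<open>sig\<close> value and \<open>T0\<close> the time on the canonical curve. After a shift of
  \<open>T0\<close> the timed canonical curve extends the orbit, and maximality makes the two
  equal.\<close>

lemma orbit_curve:
  assumes orb: "orbit \<U> (X, Y) (K ` V) I \<gamma>"
  shows "\<exists>J c \<tau>. canonical_curve R J c \<and> strict_mono_on I \<tau> \<and> \<tau> ` I = J \<and> (\<forall>t\<in>I. c (\<tau> t) \<in> V \<and> \<gamma> t = K (c (\<tau> t)))"
proof -
  have tr: "trajectory \<U> (X, Y) (K ` V) I \<gamma>" using orb unfolding orbit_def by blast
  have max: "J = I" if "trajectory \<U> (X, Y) (K ` V) J \<delta>" "I \<subseteq> J" "\<And>t. t \<in> I \<Longrightarrow> \<delta> t = \<gamma> t" for J \<delta>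
    using orb that unfolding orbit_def by blast
  show ?thesis
  proof (cases "\<forall>t\<in>I. \<gamma> t = 0")
    case True
    \<comment> \<open>A constant zero trajectory extends to all times, so maximality leaves no
      smaller domain.\<close>
    have "UNIV = I"
      by (rule max[of UNIV "\<lambda>_. 0"]) (use zero_orbit True in \<open>auto simp: orbit_def\<close>)
    then have I: "I = UNIV" by simp
    show ?thesis
    proof (intro exI conjI)
      show "canonical_curve R UNIV (\<lambda>_. 0)" by (simp add: canonical_curve_def)
      show "strict_mono_on I (\<lambda>t. t)" by (rule strict_mono_onI)
      show "(\<lambda>t. t) ` I = UNIV" using I by simp
      show "\<forall>t\<in>I. (\<lambda>_. 0) t \<in> V \<and> \<gamma> t = K ((\<lambda>_. 0) t)" using True K0 zero_V by simp
    qed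
  next
    case False
    then obtain t0 where t0: "t0 \<in> I" "\<gamma> t0 \<noteq> 0" by blast
    obtain D where D: "traj_nz \<U> X Y R K g I \<gamma> D" using nonzero_trajectory[OF tr t0] by blast
    interpret d: traj_nz \<U> X Y R K g V fld I \<gamma> D by (rule D V_def fld_def)+
    have neI: "I \<noteq> {}" using t0 by blast
    obtain \<kappa> e e' where e: "\<bar>e\<bar> = 1" "\<bar>e'\<bar> = 1" and
      c: "\<And>t. t \<in> I \<Longrightarrow> sig (d.\<zeta> t) \<in> cdom R \<kappa> e' \<and> d.\<zeta> t = cc \<kappa> e (sig (d.\<zeta> t))"
      using d.canonical_form[OF neI] by blast
    define J where "J = cdom R \<kappa> e'"
    have J_ne: "J \<noteq> {}" using c[OF t0(1)] J_def by blast
    obtain T0 where T0: "continuous_on J T0" "\<And>s. s \<in> J \<Longrightarrow> s \<noteq> 0 \<Longrightarrow> (T0 has_real_derivative 1 / g (cc \<kappa> e s)) (at s)"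
      using time_ex[OF e] J_ne unfolding J_def by blast
    define f where "f t = sig (d.\<zeta> t)" for t
    have fJ: "f t \<in> J" and zf: "d.\<zeta> t = cc \<kappa> e (f t)" if "t \<in> I" for t
      using c[OF that] by (simp_all add: f_def J_def)
    have contf: "continuous_on I f" unfolding f_def by (intro continuous_on_sig d.cont\<zeta>)
    \<comment> \<open>By the chain rule the speed \<open>g\<close> of \<open>f\<close> cancels the
      derivative \<open>1 / g\<close> of \<open>T0\<close>, off switching times and zeros of
      \<open>sig\<close>.\<close>
    have step: "T0 (f a) - a = T0 (f b) - b" if ab: "a \<in> I" "b \<in> I" "a \<le> b" for a b
    proof (rule zero_deriv_off_finite[OF ab(3), of "\<lambda>t. T0 (f t) - t" "(D \<inter> {a..b}) \<union> {t \<in> I. sig (d.\<zeta> t) = 0}"])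
      have sub: "{a..b} \<subseteq> I" by (rule is_interval_Icc[OF d.I ab(1,2)])
      show "continuous_on {a..b} (\<lambda>t. T0 (f t) - t)"
        by (intro continuous_on_diff continuous_on_id continuous_on_compose2[OF T0(1) continuous_on_subset[OF contf sub]])
          (use fJ sub in auto)
      show "finite ((D \<inter> {a..b}) \<union> {t \<in> I. sig (d.\<zeta> t) = 0})" using d.finD[OF ab(1,2)] d.finite_sig_zero by simp
      fix t assume t: "t \<in> {a<..<b} - ((D \<inter> {a..b}) \<union> {t \<in> I. sig (d.\<zeta> t) = 0})"
      then have tI: "t \<in> I" using sub by auto
      have t': "a < t" "t < b" "t \<notin> D" "sig (d.\<zeta> t) \<noteq> 0" using t tI by auto
      note sd = d.sig_kap_deriv[OF ab(1,2) t']
      have 1: "(f has_vector_derivative g (cc \<kappa> e (f t))) (at t)"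
        using sd(1) unfolding f_def[symmetric] zf[OF tI, symmetric] by (simp add: f_def[abs_def])
      have 2: "(T0 has_vector_derivative 1 / g (cc \<kappa> e (f t))) (at (f t))"
        using T0(2)[OF fJ[OF tI]] t'(4) by (simp add: f_def has_real_derivative_iff_has_vector_derivative)
      have "g (cc \<kappa> e (f t)) *\<^sub>R (1 / g (cc \<kappa> e (f t))) = 1" using sd(3) zf[OF tI] by simp
      then have "((\<lambda>t. T0 (f t)) has_vector_derivative 1) (at t)"
        using vector_diff_chain_at[OF 1 2] by (simp add: o_def)
      then have "((\<lambda>t. T0 (f t) - t) has_vector_derivative 1 - 1) (at t)"
        by (intro has_vector_derivative_diff has_vector_derivative_id)
      then show "((\<lambda>t. T0 (f t) - t) has_vector_derivative 0) (at t)" by simp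
    qed
    define k where "k = T0 (f t0) - t0"
    have k: "T0 (f t) - k = t" if "t \<in> I" for t
    proof -
      have "T0 (f t) - t = T0 (f t0) - t0"
        using step[OF that t0(1)] step[OF t0(1) that] by linarith
      then show ?thesis by (simp add: k_def)
    qed
    define T where "T s = T0 s - k" for s
    have tm: "timed \<U> X Y R K g \<kappa> e e' T"
    proof (unfold_locales, fold J_def)
      show "continuous_on J T" unfolding T_def by (intro continuous_intros T0(1))
      show "(T has_real_derivative 1 / g (cc \<kappa> e s)) (at s)" if "s \<in> J" "s \<noteq> 0" for s
        unfolding T_def using T0(2)[OF that] by (auto intro!: derivative_eq_intros)
    qed (rule e J_ne)+
    interpret t: timed \<U> X Y R K g V fld \<kappa> e e' T J
      by (rule tm V_def fld_def eq_reflection[OF J_def])+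
    have Tf: "T (f t) = t" if "t \<in> I" for t using k[OF that] by (simp add: T_def)
    \<comment> \<open>Maximality of the given orbit is used here, against its extension by
      \<open>t.\<eta>\<close>.\<close>
    have "T ` J = I"
    proof (rule max[of "T ` J" t.\<eta>])
      show "trajectory \<U> (X, Y) (K ` V) (T ` J) t.\<eta>" by (rule t.trajectory_\<eta>)
      show "I \<subseteq> T ` J" using Tf fJ by (metis imageI subsetI)
      fix t assume t: "t \<in> I"
      have "t.\<tau> t = f t" using t.\<tau>T[OF fJ[OF t]] Tf[OF t] by simp
      then show "t.\<eta> t = \<gamma> t" unfolding t.\<eta>_def using zf[OF t] d.K\<zeta>[OF t] by simp
    qed
    moreover have "f (T s) = s" if "s \<in> J" for s
    proof -
      have "T s \<in> I" using that calculation by blast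
      from Tf[OF this] show ?thesis using t.injT that fJ[OF \<open>T s \<in> I\<close>] by (auto dest: inj_onD)
    qed
    ultimately have fI: "f ` I = J" using fJ by force
    show ?thesis
    proof (intro exI conjI ballI)
      show "canonical_curve R J (cc \<kappa> e)" unfolding canonical_curve_def using e J_ne J_def by blast
      show "strict_mono_on I f" unfolding f_def by (rule d.strict_mono_sig)
      show "f ` I = J" by (rule fI)
      fix t assume t: "t \<in> I"
      show "cc \<kappa> e (f t) \<in> V" "\<gamma> t = K (cc \<kappa> e (f t))"
        unfolding zf[OF t, symmetric] using d.\<zeta>V[OF t] d.K\<zeta>[OF t] by (simp_all add: V_def)
    qed
  qed
qed

end

section \<open>The equivalence\<close>

text \<open>In dimension 2 the characteristic polynomial at 0 is the determinant, hence the
  determinant is the product of the eigenvalues.\<close>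

lemma Omega_ss_det:
  assumes "(X, Y) \<in> Omega_ss \<U>"
  shows "det (jac0 X) < 0" "det (jac0 Y) < 0"
proof -
  have neg: "det A < 0" if ev: "eigenvalues A (complex_of_real \<mu>1) (complex_of_real \<mu>2)" and \<mu>: "\<mu>1 * \<mu>2 < 0"
    for A :: "real^2^2" and \<mu>1 \<mu>2
  proof -
    have "det (mat 0 - map_matrix complex_of_real A) = (0 - complex_of_real \<mu>1) * (0 - complex_of_real \<mu>2)"
      using ev unfolding eigenvalues_def by blast
    then have "complex_of_real (det A) = complex_of_real (\<mu>1 * \<mu>2)"
      by (simp add: det_2 map_matrix_def mat_def)
    then show ?thesis using \<mu> by (simp only: of_real_eq_iff)
  qed
  show "det (jac0 X) < 0" "det (jac0 Y) < 0"
    using assms neg unfolding Omega_ss_def by blast+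
qed

lemma Omega_ss_straightened:
  assumes U: "open \<U>" "0 \<in> \<U>" and Z: "(X, Y) \<in> Omega_ss \<U>"
  shows "\<exists>R0>0. \<forall>R. 0 < R \<longrightarrow> R \<le> R0 \<longrightarrow> (\<exists>K g. straightened \<U> X Y R K g)"
proof -
  have X: "C1_field \<U> X" "X 0 = 0" and Y: "C1_field \<U> Y" "Y 0 = 0"
    and c: "0 < jac0 X $ 2 $ 1 * jac0 Y $ 2 $ 1"
    using Z unfolding Omega_ss_def Omega1_def Omega0_def Omega_def by auto
  show ?thesis
    by (rule straightened_ex[OF U C1_strict_at0[OF U X] C1_strict_at0[OF U Y] Omega_ss_det[OF Z] c])
qed

lemma has_derivative_swap: "((\<lambda>p :: real^2. vector [p $ 2, p $ 1] :: real^2) has_derivative (\<lambda>p. vector [p $ 2, p $ 1])) (at p)"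
proof -
  have "bounded_linear (\<lambda>p :: real^2. vector [p $ 2, p $ 1] :: real^2)"
    unfolding linear_conv_bounded_linear[symmetric] by (rule linearI) (simp_all add: vec2_eq_iff)
  then show ?thesis by (rule bounded_linear_imp_has_derivative)
qed

lemma Z_ss_in_Omega_ss: "(X_ss, Y_ss) \<in> Omega_ss \<U>"
proof -
  have XY: "Y_ss = X_ss" by (rule ext) (simp add: X_ss_def Y_ss_def)
  have der: "(X_ss has_derivative X_ss) (at p)" for p
    using has_derivative_swap[of p] by (simp add: X_ss_def[abs_def])
  have bl: "bounded_linear X_ss" using der has_derivative_bounded_linear by blast
  have C1: "C1_field \<U> X_ss"
    unfolding C1_field_def
    by (rule exI[of _ "\<lambda>_. Blinfun X_ss"]) (simp add: bounded_linear_Blinfun_apply[OF bl] der)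
  have "X_ss differentiable (at 0)" using der unfolding differentiable_def by blast
  then have "(X_ss has_derivative ((*v) (jac0 X_ss))) (at 0)" by (simp add: jacobian_works)
  from has_derivative_unique[OF this der] have J: "jac0 X_ss *v p = X_ss p" for p by simp
  have comp: "jac0 X_ss $ i $ j = X_ss (axis j 1) $ i" for i j
  proof -
    have "X_ss (axis j 1) = column j (jac0 X_ss)" unfolding J[of "axis j 1", symmetric] by (rule matrix_vector_mult_basis)
    then show ?thesis by (simp add: column_def)
  qed
  have J': "jac0 X_ss $ 1 $ 1 = 0" "jac0 X_ss $ 1 $ 2 = 1" "jac0 X_ss $ 2 $ 1 = 1" "jac0 X_ss $ 2 $ 2 = 0"
    unfolding comp by (simp_all add: X_ss_def axis_def)
  have ev: "eigenvalues (jac0 X_ss) (complex_of_real 1) (complex_of_real (- 1))"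
    unfolding eigenvalues_def by (simp add: det_2 map_matrix_def mat_def J' algebra_simps)
  have O0: "(X_ss, X_ss) \<in> Omega0 \<U>"
    unfolding Omega0_def Omega_def using C1 by (simp add: J' det_2) (simp add: X_ss_def vec2_eq_iff)
  have "(X_ss, X_ss) \<in> Omega1 \<U>"
    unfolding Omega1_def mem_Collect_eq prod.case
    by (intro conjI O0 exI[of _ "complex_of_real 1"] exI[of _ "complex_of_real (- 1)"] ev) (simp_all add: ell_def)
  then show ?thesis
    unfolding Omega_ss_def XY mem_Collect_eq prod.case
    by (intro conjI exI[of _ "1 :: real"] exI[of _ "- 1 :: real"] ev) simp_all
qed

text \<open>Both straightening maps turn orbits into the same canonical curves, so \<open>K2 o E1\<close> is the
  required homeomorphism.\<close>

lemma straightened_equivalent: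
  assumes 1: "straightened \<U> X Y R K1 g1" and 2: "straightened \<U> X' Y' R K2 g2"
  shows "locally_Sigma_equivalent \<U> (X, Y) (X', Y')"
proof -
  define V where "V = {z :: real^2. \<bar>z $ 1\<bar> + \<bar>z $ 2\<bar> < R}"
  interpret s1: straightened \<U> X Y R K1 g1 V "\<lambda>y. if y > 0 then X else Y"
    by (rule 1 eq_reflection[OF V_def] reflexive)+
  interpret s2: straightened \<U> X' Y' R K2 g2 V "\<lambda>y. if y > 0 then X' else Y'"
    by (rule 2 eq_reflection[OF V_def] reflexive)+
  define H where "H = K2 \<circ> s1.E"
  define H' where "H' = K1 \<circ> s2.E"
  have hom: "homeomorphism (K1 ` V) (K2 ` V) H H'"
    unfolding H_def H'_def
    by (rule homeomorphism_compose[OF homeomorphism_symD[OF s1.homeo] s2.homeo])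
  have HK: "H (K1 z) = K2 z" if "z \<in> V" for z using that by (simp add: H_def)
  have open1: "open (K1 ` V)" by (rule invariance_of_domain[OF s1.contK s1.open_V s1.injK])
  have open2: "open (K2 ` V)" by (rule invariance_of_domain[OF s2.contK s2.open_V s2.injK])
  have zero: "0 \<in> K1 ` V" "0 \<in> K2 ` V" using s1.K0 s2.K0 s1.zero_V by (metis imageI)+
  \<comment> \<open>Two increasing parametrisations of one parameter set differ by the increasing
    bijection obtained from inverting \<open>\<tau>2\<close> after \<open>\<tau>1\<close>; this is
    the change of parameter between an orbit and its image.\<close>
  have inv: "\<exists>\<rho>. strict_mono_on A \<rho> \<and> \<rho> ` A = B \<and> (\<forall>t\<in>A. \<tau>2 (\<rho> t) = \<tau>1 t)"
    if \<tau>1: "strict_mono_on A \<tau>1" "\<tau>1 ` A = J" and \<tau>2: "strict_mono_on B \<tau>2" "\<tau>2 ` B = J"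
    for A B J :: "real set" and \<tau>1 \<tau>2
  proof -
    define \<rho> where "\<rho> t = inv_into B \<tau>2 (\<tau>1 t)" for t
    have mem: "\<tau>1 t \<in> \<tau>2 ` B" if "t \<in> A" for t using that \<tau>1(2) \<tau>2(2) by blast
    have \<rho>: "\<rho> t \<in> B" "\<tau>2 (\<rho> t) = \<tau>1 t" if "t \<in> A" for t
      unfolding \<rho>_def using inv_into_into[OF mem[OF that]] f_inv_into_f[OF mem[OF that]] by auto
    have mono: "strict_mono_on A \<rho>"
    proof (rule strict_mono_onI)
      fix t u assume tu: "t \<in> A" "u \<in> A" "t < u"
      then have "\<tau>2 (\<rho> t) < \<tau>2 (\<rho> u)" using \<rho>(2) strict_mono_onD[OF \<tau>1(1)] by simp
      then show "\<rho> t < \<rho> u" using strict_mono_on_less[OF \<tau>2(1) \<rho>(1)[OF tu(1)] \<rho>(1)[OF tu(2)]] by simp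
    qed
    have "\<rho> ` A = B"
    proof
      show "B \<subseteq> \<rho> ` A"
      proof
        fix b assume b: "b \<in> B"
        then obtain t where t: "t \<in> A" "\<tau>1 t = \<tau>2 b" using \<tau>1(2) \<tau>2(2) by (metis imageE imageI)
        have "\<rho> t = b"
          using strict_mono_on_eqD[OF \<tau>2(1)] \<rho>[OF t(1)] t(2) b by metis
        then show "b \<in> \<rho> ` A" using t by blast
      qed
    qed (use \<rho> in blast)
    then show ?thesis using mono \<rho>(2) by blast
  qed
  have fwd: "\<exists>J \<delta>. orbit \<U> (X', Y') (K2 ` V) J \<delta> \<and> same_oriented_curve I (H \<circ> \<gamma>) J \<delta>"
    if orb: "orbit \<U> (X, Y) (K1 ` V) I \<gamma>" for I \<gamma>
  proof -
    obtain J c \<tau>1 where c: "canonical_curve R J c" and \<tau>1: "strict_mono_on I \<tau>1" "\<tau>1 ` I = J"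
      and \<gamma>: "\<forall>t\<in>I. c (\<tau>1 t) \<in> V \<and> \<gamma> t = K1 (c (\<tau>1 t))"
      using s1.orbit_curve[OF orb] by blast
    obtain I2 \<delta> \<tau>2 where \<delta>: "orbit \<U> (X', Y') (K2 ` V) I2 \<delta>" and \<tau>2: "strict_mono_on I2 \<tau>2" "\<tau>2 ` I2 = J"
      and \<delta>2: "\<forall>t\<in>I2. c (\<tau>2 t) \<in> V \<and> \<delta> t = K2 (c (\<tau>2 t))"
      using s2.curve_orbit[OF c] by blast
    obtain \<rho> where \<rho>: "strict_mono_on I \<rho>" "\<rho> ` I = I2" "\<forall>t\<in>I. \<tau>2 (\<rho> t) = \<tau>1 t"
      using inv[OF \<tau>1 \<tau>2] by blast
    have "(H \<circ> \<gamma>) t = \<delta> (\<rho> t)" if t: "t \<in> I" for t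
    proof -
      have "\<rho> t \<in> I2" using \<rho>(2) t by blast
      then show ?thesis using \<gamma> \<delta>2 \<rho>(3) t HK by simp
    qed
    then show ?thesis using \<delta> \<rho>(1,2) unfolding same_oriented_curve_def by blast
  qed
  have bwd: "\<exists>I \<gamma>. orbit \<U> (X, Y) (K1 ` V) I \<gamma> \<and> same_oriented_curve I (H \<circ> \<gamma>) J \<delta>"
    if orb: "orbit \<U> (X', Y') (K2 ` V) J \<delta>" for J \<delta>
  proof -
    obtain S c \<tau>2 where c: "canonical_curve R S c" and \<tau>2: "strict_mono_on J \<tau>2" "\<tau>2 ` J = S"
      and \<delta>: "\<forall>t\<in>J. c (\<tau>2 t) \<in> V \<and> \<delta> t = K2 (c (\<tau>2 t))"
      using s2.orbit_curve[OF orb] by blast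
    obtain I \<gamma> \<tau>1 where \<gamma>: "orbit \<U> (X, Y) (K1 ` V) I \<gamma>" and \<tau>1: "strict_mono_on I \<tau>1" "\<tau>1 ` I = S"
      and \<gamma>1: "\<forall>t\<in>I. c (\<tau>1 t) \<in> V \<and> \<gamma> t = K1 (c (\<tau>1 t))"
      using s1.curve_orbit[OF c] by blast
    obtain \<rho> where \<rho>: "strict_mono_on I \<rho>" "\<rho> ` I = J" "\<forall>t\<in>I. \<tau>2 (\<rho> t) = \<tau>1 t"
      using inv[OF \<tau>1 \<tau>2] by blast
    have "(H \<circ> \<gamma>) t = \<delta> (\<rho> t)" if t: "t \<in> I" for t
    proof -
      have "\<rho> t \<in> J" using \<rho>(2) t by blast
      then show ?thesis using \<gamma>1 \<delta> \<rho>(3) t HK by simp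
    qed
    then show ?thesis using \<gamma> \<rho>(1,2) unfolding same_oriented_curve_def by blast
  qed
  have line: "K z \<in> Sigma_line \<U> \<longleftrightarrow> z $ 2 = 0"
    if "K z \<in> \<U>" "sgn (K z $ 2) = sgn (z $ 2)" for K and z :: "real^2"
    using that by (simp add: Sigma_line_def) (metis sgn_zero_iff)
  have L1: "Sigma_line \<U> \<inter> K1 ` V = K1 ` {z \<in> V. z $ 2 = 0}"
    using line[of K1] s1.KU s1.sgnK by blast
  have L2: "Sigma_line \<U> \<inter> K2 ` V = K2 ` {z \<in> V. z $ 2 = 0}"
    using line[of K2] s2.KU s2.sgnK by blast
  have "H ` (Sigma_line \<U> \<inter> K1 ` V) = Sigma_line \<U> \<inter> K2 ` V"
    unfolding L1 L2 image_image by (rule image_cong) (simp_all add: HK)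
  then show ?thesis
    unfolding locally_Sigma_equivalent_def
    using open1 open2 zero s1.KU s2.KU hom fwd bwd by blast
qed

theorem lemma3p7:
  fixes \<U> :: "(real^2) set" and X Y :: vfield
  assumes "open \<U>" and "bounded \<U>" and "0 \<in> \<U>"
    and "(X, Y) \<in> Omega_ss \<U>"
  shows "(X_ss, Y_ss) \<in> Omega_ss \<U> \<and>
         locally_Sigma_equivalent \<U> (X, Y) (X_ss, Y_ss)"
proof
  show ss: "(X_ss, Y_ss) \<in> Omega_ss \<U>" by (rule Z_ss_in_Omega_ss)
  obtain R1 where R1: "R1 > 0" "\<And>R. 0 < R \<Longrightarrow> R \<le> R1 \<Longrightarrow> \<exists>K g. straightened \<U> X Y R K g"
    using Omega_ss_straightened[OF assms(1,3,4)] by blast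
  obtain R2 where R2: "R2 > 0" "\<And>R. 0 < R \<Longrightarrow> R \<le> R2 \<Longrightarrow> \<exists>K g. straightened \<U> X_ss Y_ss R K g"
    using Omega_ss_straightened[OF assms(1,3) ss] by blast
  \<comment> \<open>Both systems must be straightened on the same square, since the canonical curves
    depend on \<open>R\<close>.\<close>
  define R where "R = min R1 R2"
  have R: "0 < R" "R \<le> R1" "R \<le> R2" using R1 R2 by (auto simp: R_def)
  show "locally_Sigma_equivalent \<U> (X, Y) (X_ss, Y_ss)"
    using R1(2)[OF R(1,2)] R2(2)[OF R(1,3)] straightened_equivalent by blast
qed

end
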